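(* Let $L$ be a slim rectangular lattice, let $F$ be a $\mathcal C_1$-diagram of $L$, and let $\alpha$ be a congruence of $L$. Then the quotient diagram $F/\alpha$ is a $\mathcal C_1$-diagram of the quotient lattice $L/\alpha$ (where the vertex $v$ of $F/\alpha$ represents the $\alpha$-block of which $v$ is the largest element).
   Context: Lattices. For a finite lattice $L$, $\mathrm J(L)$ is the poset of nonzero join-irreducible elements and $\mathrm M(L)$ is the poset of non-unit (i.e. $\neq 1$) meet-irreducible elements. A finite lattice is slim if $\mathrm J(L)$ is the union of two chains; slim lattices are planar. A lattice is semimodular if $x\prec y$ implies $x\vee z\preceq y\vee z$ for all $z$. An element is doubly irreducible if it belongs to $\mathrm J(L)\cap \mathrm M(L)$. Two elements are complementary if their meet is $0$ and their join is $1$. A slim rectangular lattice is a slim semimodular lattice that has exactly two doubly irreducible elements and these two elements are complementary. Diagrams. A diagram means a Hasse diagram drawn in the plane $\mathbb R^2$ with straight line segments as edges (so an edge $[p,q]$ with $p\prec q$ goes upwards from $p$ to $q$, and passes through no vertex other than $p$ and $q$). It is planar if two edges meet only at common endpoints. The boundary of a planar diagram of a lattice is the union of its left boundary chain and its right boundary chain. A line segment is of a normal slope if it is parallel to $(1,1)$ or to $(1,-1)$; it is precipitous if it is vertical or parallel to a vector $(1,q)$ with $q\in\mathbb R$, $|q|>1$. $\mathcal C_1$-diagrams. (A) A planar diagram of a slim rectangular lattice $L$ is a $\mathcal C_1$-diagram if for every edge $[p,q]$ of the diagram: if $p\in \mathrm M(L)$ and $p$ is not on the boundary, then $[p,q]$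 is precipitous; otherwise $[p,q]$ is of a normal slope. (B) A diagram of a finite chain is a $\mathcal C_1$-diagram if all its edges are of normal slopes. Quotient diagrams. For a diagram $F$ of a finite lattice $L$ and a subset $X$ of the vertex set, the subdiagram determined by $X$ consists of the elements of $X$ as vertices, in their original geometric positions, and of the straight line segments connecting $u,v\in X$ whenever $u<v$ in $L$ and there is no $w\in X$ with $u<w<v$ in $L$. For a congruence $\alpha$ of $L$, the quotient diagram $F/\alpha$ is the subdiagram of $F$ determined by the set of the largest elements of the $\alpha$-blocks (for an arbitrary diagram of a finite lattice this figure need not be a Hasse diagram at all). *)

theory Defs
  imports "HOL-Analysis.Analysis" "HOL-Algebra.Lattice"
begin

section \<open>Slim rectangular lattices\<close>

definition finite_lattice :: "('a, 'b) gorder_scheme \<Rightarrow> bool" where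
  "finite_lattice L \<longleftrightarrow> lattice L \<and> finite (carrier L) \<and> carrier L \<noteq> {}"

definition finite_chain :: "('a, 'b) gorder_scheme \<Rightarrow> bool" where
  "finite_chain L \<longleftrightarrow> total_order L \<and> finite (carrier L) \<and> carrier L \<noteq> {}"

definition covered_by :: "('a, 'b) gorder_scheme \<Rightarrow> 'a \<Rightarrow> 'a \<Rightarrow> bool" where
  "covered_by L x y \<longleftrightarrow> x \<in> carrier L \<and> y \<in> carrier L \<and> x \<sqsubset>\<^bsub>L\<^esub> y \<and>
     (\<nexists>z. z \<in> carrier L \<and> x \<sqsubset>\<^bsub>L\<^esub> z \<and> z \<sqsubset>\<^bsub>L\<^esub> y)"

definition join_irreducibles :: "('a, 'b) gorder_scheme \<Rightarrow> 'a set" where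
  "join_irreducibles L = {x \<in> carrier L. x \<noteq> \<bottom>\<^bsub>L\<^esub> \<and>
     (\<forall>a\<in>carrier L. \<forall>b\<in>carrier L. x = a \<squnion>\<^bsub>L\<^esub> b \<longrightarrow> x = a \<or> x = b)}"

definition meet_irreducibles :: "('a, 'b) gorder_scheme \<Rightarrow> 'a set" where
  "meet_irreducibles L = {x \<in> carrier L. x \<noteq> \<top>\<^bsub>L\<^esub> \<and>
     (\<forall>a\<in>carrier L. \<forall>b\<in>carrier L. x = a \<sqinter>\<^bsub>L\<^esub> b \<longrightarrow> x = a \<or> x = b)}"

definition slim :: "('a, 'b) gorder_scheme \<Rightarrow> bool" where
  "slim L \<longleftrightarrow> finite_lattice L \<and>
     (\<exists>C D. pred_on.chain (carrier L) (le L) C \<and> pred_on.chain (carrier L) (le L) D \<and>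
        join_irreducibles L = C \<union> D)"

definition semimodular :: "('a, 'b) gorder_scheme \<Rightarrow> bool" where
  "semimodular L \<longleftrightarrow> lattice L \<and>
     (\<forall>x\<in>carrier L. \<forall>y\<in>carrier L. \<forall>z\<in>carrier L. covered_by L x y \<longrightarrow>
        x \<squnion>\<^bsub>L\<^esub> z = y \<squnion>\<^bsub>L\<^esub> z \<or> covered_by L (x \<squnion>\<^bsub>L\<^esub> z) (y \<squnion>\<^bsub>L\<^esub> z))"

definition complementary :: "('a, 'b) gorder_scheme \<Rightarrow> 'a \<Rightarrow> 'a \<Rightarrow> bool" where
  "complementary L a b \<longleftrightarrow> a \<sqinter>\<^bsub>L\<^esub> b = \<bottom>\<^bsub>L\<^esub> \<and> a \<squnion>\<^bsub>L\<^esub> b = \<top>\<^bsub>L\<^esub>"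

definition slim_rectangular :: "('a, 'b) gorder_scheme \<Rightarrow> bool" where
  "slim_rectangular L \<longleftrightarrow> slim L \<and> semimodular L \<and>
     (\<exists>a b. a \<noteq> b \<and> join_irreducibles L \<inter> meet_irreducibles L = {a, b} \<and> complementary L a b)"


section \<open>Congruences and quotient lattices\<close>

definition lattice_congruence :: "('a, 'b) gorder_scheme \<Rightarrow> 'a rel \<Rightarrow> bool" where
  "lattice_congruence L \<alpha> \<longleftrightarrow> equiv (carrier L) \<alpha> \<and>
     (\<forall>x x' y y'. (x, x') \<in> \<alpha> \<longrightarrow> (y, y') \<in> \<alpha> \<longrightarrow>
        (x \<squnion>\<^bsub>L\<^esub> y, x' \<squnion>\<^bsub>L\<^esub> y') \<in> \<alpha> \<and> (x \<sqinter>\<^bsub>L\<^esub> y, x' \<sqinter>\<^bsub>L\<^esub> y') \<in> \<alpha>)"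

text \<open>The blocks are joined through representatives, and \<open>X \<le> Y\<close> means that the join of
  \<open>X\<close> and \<open>Y\<close> is \<open>Y\<close>.\<close>

definition quotient_lattice :: "('a, 'b) gorder_scheme \<Rightarrow> 'a rel \<Rightarrow> 'a set gorder" where
  "quotient_lattice L \<alpha> =
     \<lparr>carrier = carrier L // \<alpha>, eq = (=),
      le = (\<lambda>X Y. \<exists>x\<in>X. \<exists>y\<in>Y. \<alpha> `` {x \<squnion>\<^bsub>L\<^esub> y} = Y)\<rparr>"


section \<open>Diagrams in the plane\<close>

text \<open>A drawing consists of abstract vertices, their geometric positions, a set of directed edges
  (drawn as straight line segments), and for every vertex the lattice element it represents.
  Keeping vertices and lattice elements apart allows one drawing to be read as a diagram of
  different lattices.\<close>

record ('v, 'a) drawing =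
  vertices :: "'v set"
  pos :: "'v \<Rightarrow> real \<times> real"
  edges :: "('v \<times> 'v) set"
  elem :: "'v \<Rightarrow> 'a"

definition edge_segment :: "('v, 'a) drawing \<Rightarrow> 'v \<times> 'v \<Rightarrow> (real \<times> real) set" where
  "edge_segment F e = closed_segment (pos F (fst e)) (pos F (snd e))"

definition hasse_diagram :: "('a, 'b) gorder_scheme \<Rightarrow> ('v, 'a) drawing \<Rightarrow> bool" where
  "hasse_diagram L F \<longleftrightarrow>
     bij_betw (elem F) (vertices F) (carrier L) \<and>
     inj_on (pos F) (vertices F) \<and>
     edges F = {(p, q). p \<in> vertices F \<and> q \<in> vertices F \<and> covered_by L (elem F p) (elem F q)} \<and>
     (\<forall>(p, q)\<in>edges F. snd (pos F p) < snd (pos F q)) \<and>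
     (\<forall>(p, q)\<in>edges F. \<forall>w\<in>vertices F. pos F w \<in> edge_segment F (p, q) \<longrightarrow> w = p \<or> w = q)"

definition planar_diagram :: "('a, 'b) gorder_scheme \<Rightarrow> ('v, 'a) drawing \<Rightarrow> bool" where
  "planar_diagram L F \<longleftrightarrow> hasse_diagram L F \<and>
     (\<forall>e\<in>edges F. \<forall>e'\<in>edges F. e \<noteq> e' \<longrightarrow>
        edge_segment F e \<inter> edge_segment F e' \<subseteq>
          {pos F (fst e), pos F (snd e)} \<inter> {pos F (fst e'), pos F (snd e')})"

text \<open>The point set drawn by a set \<open>W\<close> of vertices together with the edges between them.\<close>

definition drawn :: "('v, 'a) drawing \<Rightarrow> 'v set \<Rightarrow> (real \<times> real) set" where
  "drawn F W = pos F ` W \<union> (\<Union>e\<in>edges F \<inter> W \<times> W. edge_segment F e)"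

text \<open>A maximal chain is drawn as a path going upwards from the least to the greatest element.
  It is the left (right) boundary chain if no point of the diagram lies strictly to the left
  (right) of this path at the same height.\<close>

definition left_boundary_chain :: "('a, 'b) gorder_scheme \<Rightarrow> ('v, 'a) drawing \<Rightarrow> 'v set \<Rightarrow> bool" where
  "left_boundary_chain L F C \<longleftrightarrow> C \<subseteq> vertices F \<and>
     pred_on.maxchain (carrier L) (le L) (elem F ` C) \<and>
     (\<forall>z\<in>drawn F (vertices F). \<forall>c\<in>drawn F C. snd z = snd c \<longrightarrow> fst c \<le> fst z)"

definition right_boundary_chain :: "('a, 'b) gorder_scheme \<Rightarrow> ('v, 'a) drawing \<Rightarrow> 'v set \<Rightarrow> bool" where
  "right_boundary_chain L F C \<longleftrightarrow> C \<subseteq> vertices F \<and>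
     pred_on.maxchain (carrier L) (le L) (elem F ` C) \<and>
     (\<forall>z\<in>drawn F (vertices F). \<forall>c\<in>drawn F C. snd z = snd c \<longrightarrow> fst z \<le> fst c)"

definition boundary :: "('a, 'b) gorder_scheme \<Rightarrow> ('v, 'a) drawing \<Rightarrow> 'v set" where
  "boundary L F = \<Union>{C. left_boundary_chain L F C} \<union> \<Union>{C. right_boundary_chain L F C}"

definition parallel :: "real \<times> real \<Rightarrow> real \<times> real \<Rightarrow> bool" where
  "parallel u v \<longleftrightarrow> (\<exists>c. c \<noteq> 0 \<and> u = c *\<^sub>R v)"

definition normal_slope :: "('v, 'a) drawing \<Rightarrow> 'v \<times> 'v \<Rightarrow> bool" where
  "normal_slope F e \<longleftrightarrow>
     parallel (pos F (snd e) - pos F (fst e)) (1, 1) \<or>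
     parallel (pos F (snd e) - pos F (fst e)) (1, -1)"

definition precipitous :: "('v, 'a) drawing \<Rightarrow> 'v \<times> 'v \<Rightarrow> bool" where
  "precipitous F e \<longleftrightarrow>
     parallel (pos F (snd e) - pos F (fst e)) (0, 1) \<or>
     (\<exists>q. \<bar>q\<bar> > 1 \<and> parallel (pos F (snd e) - pos F (fst e)) (1, q))"

text \<open>The two cases exclude each other: no chain is a slim rectangular lattice.\<close>

definition C1_diagram :: "('a, 'b) gorder_scheme \<Rightarrow> ('v, 'a) drawing \<Rightarrow> bool" where
  "C1_diagram L F \<longleftrightarrow>
     (slim_rectangular L \<and> planar_diagram L F \<and>
        (\<forall>(p, q)\<in>edges F.
           if elem F p \<in> meet_irreducibles L \<and> p \<notin> boundary L F
           then precipitous F (p, q) else normal_slope F (p, q)))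
   \<or> (finite_chain L \<and> hasse_diagram L F \<and> (\<forall>e\<in>edges F. normal_slope F e))"


section \<open>Quotient diagrams\<close>

definition subdiagram ::
  "('a, 'b) gorder_scheme \<Rightarrow> ('v, 'a) drawing \<Rightarrow> 'v set \<Rightarrow> ('v, 'a) drawing" where
  "subdiagram L F X =
     \<lparr>vertices = X, pos = pos F,
      edges = {(u, v). u \<in> X \<and> v \<in> X \<and> elem F u \<sqsubset>\<^bsub>L\<^esub> elem F v \<and>
         (\<nexists>w. w \<in> X \<and> elem F u \<sqsubset>\<^bsub>L\<^esub> elem F w \<and> elem F w \<sqsubset>\<^bsub>L\<^esub> elem F v)},
      elem = elem F\<rparr>"

text \<open>Vertices, positions and edges come from the subdiagram determined by the largest elements
  of the blocks, with the edges given by the order of \<open>L\<close>; a vertex now represents the block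
  of its element.\<close>

definition quotient_diagram ::
  "('a, 'b) gorder_scheme \<Rightarrow> ('v, 'a) drawing \<Rightarrow> 'a rel \<Rightarrow> ('v, 'a set) drawing" where
  "quotient_diagram L F \<alpha> =
     (let S = subdiagram L F {v \<in> vertices F. greatest L (elem F v) (\<alpha> `` {elem F v})}
      in \<lparr>vertices = vertices S, pos = pos S, edges = edges S, elem = (\<lambda>v. \<alpha> `` {elem F v})\<rparr>)"

end

theory Submission
  imports Defs
begin

text \<open>The proof replaces C1-diagrams by coordinates. Let \<open>a\<close> and \<open>b\<close> be the two doubly irreducible
elements of a slim rectangular lattice. The ideals and the filters generated by \<open>a\<close> and by \<open>b\<close> are
chains, \<open>a\<close> and \<open>b\<close> are complementary, and every element is the join of its two \<^emph>\<open>parts\<close>: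
\<open>x = (x \<sqinter> a) \<squnion> (x \<sqinter> b)\<close>. A finite semimodular lattice with such elements is called a rectangular
frame below. Conversely, a frame in which \<open>a\<close> and \<open>b\<close> differ from \<open>0\<close> is slim rectangular
(\<open>slim_rectangularI\<close>), and a frame in which one of them is \<open>0\<close> is a chain.

Frames survive congruences (\<open>frame_Q\<close>): the conditions on \<open>a\<close> and \<open>b\<close> are inherited by homomorphic
images, and so is semimodularity, since covers of a block lift to covers of its largest element.
So the quotient of \<open>L\<close> is slim rectangular or a chain, the latter exactly when the block of \<open>a\<close>
or that of \<open>b\<close> is the least one.

The geometric core is that, up to a reflection, the C1-diagrams of a frame with \<open>a, b \<noteq> 0\<close> are
exactly the drawings that place \<open>x\<close> at the point \<open>(g (x \<sqinter> b) - f (x \<sqinter> a), g (x \<sqinter> b) + f (x \<sqinter> a))\<close>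
for strictly increasing functions \<open>f\<close> on the ideal of \<open>a\<close> and \<open>g\<close> on the ideal of \<open>b\<close>. An edge then
has a normal slope if one part stays fixed along it, and is precipitous if both parts change.

\<^item> Coordinates give a C1-diagram (\<open>C1_of_coordinates\<close>). Meets are computed coordinatewise, so if
  two edges cross in a point, then the meet of their tops lies above that point in both coordinates,
  hence is an end of both edges. This forces planarity. The boundary consists of the elements
  comparable to \<open>a\<close> and of those comparable to \<open>b\<close>.

\<^item> A C1-diagram has coordinates (\<open>C1_diagram_coordinates\<close>). It is enough that along every edge that
  preserves the \<open>a\<close>-part the point moves parallel to one fixed diagonal, and symmetrically for \<open>b\<close>.
  At an element with two covers this is a matter of orientation, which is propagated upwards from \<open>0\<close>
  by planarity: with the wrong orientation an ascending path would be trapped in a triangle formed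
  by edges (\<open>no_path_into_triangle\<close>). An element with a single cover whose edge preserves a part lies
  above \<open>a\<close> or above \<open>b\<close>. The elements comparable to \<open>a\<close> form a boundary chain (\<open>side_spine\<close>),
  so these edges have normal slopes as well, and comparing heights settles their direction.

Finally the coordinates descend to the quotient. The largest element \<open>t\<close> of a block \<open>X\<close> satisfies
\<open>t \<sqinter> a = u \<sqinter> a\<close>, where \<open>u\<close> is the largest element of the block \<open>X \<sqinter> [a]\<close>. Therefore the subdiagram of
block tops is placed by the values of \<open>f\<close> and \<open>g\<close> at the parts of block tops, and as functions of the
blocks these are again strictly increasing on the ideals of \<open>[a]\<close> and \<open>[b]\<close> (\<open>coord_Q\<close>).\<close>

section \<open>Finite lattices\<close>

locale fin_lattice = lattice L for L (structure) +
  assumes fin: "finite (carrier L)" and nonempty: "carrier L \<noteq> {}"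
begin

declare meet_left [simp] meet_right [simp] join_left [simp] join_right [simp]

lemma le_meet_iff [simp]:
  "x \<in> carrier L \<Longrightarrow> y \<in> carrier L \<Longrightarrow> z \<in> carrier L \<Longrightarrow> z \<sqsubseteq> x \<sqinter> y \<longleftrightarrow> z \<sqsubseteq> x \<and> z \<sqsubseteq> y"
  by (meson le_trans meet_closed meet_le meet_left meet_right)

lemma join_le_iff [simp]:
  "x \<in> carrier L \<Longrightarrow> y \<in> carrier L \<Longrightarrow> z \<in> carrier L \<Longrightarrow> x \<squnion> y \<sqsubseteq> z \<longleftrightarrow> x \<sqsubseteq> z \<and> y \<sqsubseteq> z"
  by (meson join_closed join_le join_left join_right le_trans)

lemma bounded: "bounded_lattice L"
proof -
  have "greatest L (\<Sqinter>carrier L) (Lower L (carrier L))"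
    by (rule finite_inf_greatest) (use fin nonempty in auto)
  then have "least L (\<Sqinter>carrier L) (carrier L)"
    unfolding least_def greatest_def Lower_def by auto
  moreover have "least L (\<Squnion>carrier L) (Upper L (carrier L))"
    by (rule finite_sup_least) (use fin nonempty in auto)
  then have "greatest L (\<Squnion>carrier L) (carrier L)"
    unfolding greatest_def least_def Upper_def by auto
  ultimately show ?thesis by unfold_locales auto
qed

end

sublocale fin_lattice \<subseteq> bounded_lattice by (rule bounded)

context fin_lattice begin

lemma chain_iff: "pred_on.chain (carrier L) (le L) C \<longleftrightarrow>
    C \<subseteq> carrier L \<and> (\<forall>x\<in>C. \<forall>y\<in>C. x \<sqsubseteq> y \<or> y \<sqsubseteq> x)"
  unfolding pred_on.chain_def sup_fun_def sup_bool_def using le_refl by (metis subsetD)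

lemma top_least: "x \<in> carrier L \<Longrightarrow> \<top> \<sqsubseteq> x \<longleftrightarrow> x = \<top>"
  by (auto intro: le_antisym)

lemma below_bottom: "x \<in> carrier L \<Longrightarrow> x \<sqsubseteq> \<bottom> \<longleftrightarrow> x = \<bottom>"
  by (auto intro: le_antisym)

lemma coverD:
  assumes "covered_by L x y"
  shows "x \<in> carrier L" "y \<in> carrier L" "x \<sqsubseteq> y" "x \<noteq> y"
  using assms by (auto simp: covered_by_def lless_eq)

lemma cover_between:
  "covered_by L x y \<Longrightarrow> z \<in> carrier L \<Longrightarrow> x \<sqsubseteq> z \<Longrightarrow> z \<sqsubseteq> y \<Longrightarrow> z = x \<or> z = y"
  by (auto simp: covered_by_def lless_eq)

lemma le_joinI:
  assumes "z \<sqsubseteq> x \<or> z \<sqsubseteq> y" "x \<in> carrier L" "y \<in> carrier L" "z \<in> carrier L" shows "z \<sqsubseteq> x \<squnion> y"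
  using assms le_trans[of z x "x \<squnion> y"] le_trans[of z y "x \<squnion> y"] by auto

lemma meet_leI:
  assumes "x \<sqsubseteq> z \<or> y \<sqsubseteq> z" "x \<in> carrier L" "y \<in> carrier L" "z \<in> carrier L" shows "x \<sqinter> y \<sqsubseteq> z"
  using assms le_trans[of "x \<sqinter> y" x z] le_trans[of "x \<sqinter> y" y z] by auto

lemma meet_absorb1: "x \<in> carrier L \<Longrightarrow> y \<in> carrier L \<Longrightarrow> x \<sqsubseteq> y \<Longrightarrow> x \<sqinter> y = x"
  by (intro le_antisym) auto

lemma meet_absorb2: "x \<in> carrier L \<Longrightarrow> y \<in> carrier L \<Longrightarrow> y \<sqsubseteq> x \<Longrightarrow> x \<sqinter> y = y"
  by (intro le_antisym) auto

lemma meet_meet: "x \<in> carrier L \<Longrightarrow> y \<in> carrier L \<Longrightarrow> c \<in> carrier L \<Longrightarrow> (x \<sqinter> y) \<sqinter> c = (x \<sqinter> c) \<sqinter> (y \<sqinter> c)"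
  by (intro le_antisym) (auto simp: meet_leI)

lemma order_induct [consumes 1, case_names less]:
  assumes "x \<in> carrier L"
    and step: "\<And>x. x \<in> carrier L \<Longrightarrow> (\<And>y. y \<in> carrier L \<Longrightarrow> y \<sqsubset> x \<Longrightarrow> P y) \<Longrightarrow> P x"
  shows "P x"
  using assms(1)
proof (induction "card {y \<in> carrier L. y \<sqsubset> x}" arbitrary: x rule: less_induct)
  case less
  show ?case
  proof (rule step[OF less.prems])
    fix y assume y: "y \<in> carrier L" "y \<sqsubset> x"
    have "{z \<in> carrier L. z \<sqsubset> y} \<subset> {z \<in> carrier L. z \<sqsubset> x}"
      using y less.prems by (auto simp: lless_eq dest: le_trans le_antisym)
    then show "P y"
      using fin y by (intro less.hyps psubset_card_mono) auto
  qed
qed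

lemma minimal_elem:
  assumes "A \<subseteq> carrier L" "A \<noteq> {}"
  obtains m where "m \<in> A" "\<And>y. y \<in> A \<Longrightarrow> y \<sqsubseteq> m \<Longrightarrow> y = m"
proof -
  obtain x where x: "x \<in> A" using assms by auto
  then have "x \<in> carrier L" using assms by auto
  then have "x \<in> A \<Longrightarrow> \<exists>m\<in>A. \<forall>y\<in>A. y \<sqsubseteq> m \<longrightarrow> y = m"
  proof (induction x rule: order_induct)
    case (less x)
    then show ?case using assms(1) unfolding lless_eq by (metis subsetD)
  qed
  then show thesis using x that by auto
qed

lemma upward_induct [consumes 1, case_names greater]:
  assumes "x \<in> carrier L"
    and step: "\<And>x. x \<in> carrier L \<Longrightarrow> (\<And>y. y \<in> carrier L \<Longrightarrow> x \<sqsubset> y \<Longrightarrow> P y) \<Longrightarrow> P x"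
  shows "P x"
  using assms(1)
proof (induction "card {y \<in> carrier L. x \<sqsubset> y}" arbitrary: x rule: less_induct)
  case less
  show ?case
  proof (rule step[OF less.prems])
    fix y assume y: "y \<in> carrier L" "x \<sqsubset> y"
    have "{z \<in> carrier L. y \<sqsubset> z} \<subset> {z \<in> carrier L. x \<sqsubset> z}"
      using y less.prems by (auto simp: lless_eq dest: le_trans le_antisym)
    then show "P y"
      using fin y by (intro less.hyps psubset_card_mono) auto
  qed
qed

lemma maximal_elem:
  assumes "A \<subseteq> carrier L" "A \<noteq> {}"
  obtains m where "m \<in> A" "\<And>y. y \<in> A \<Longrightarrow> m \<sqsubseteq> y \<Longrightarrow> y = m"
proof -
  obtain x where x: "x \<in> A" using assms by auto
  then have "x \<in> carrier L" using assms by auto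
  then have "x \<in> A \<Longrightarrow> \<exists>m\<in>A. \<forall>y\<in>A. m \<sqsubseteq> y \<longrightarrow> y = m"
  proof (induction x rule: upward_induct)
    case (greater x)
    then show ?case using assms(1) unfolding lless_eq by (metis subsetD)
  qed
  then show thesis using x that by auto
qed

lemma upper_cover_exists:
  assumes "x \<in> carrier L" "y \<in> carrier L" "x \<sqsubset> y"
  obtains z where "covered_by L x z" "z \<sqsubseteq> y"
proof -
  obtain z where z: "z \<in> {z \<in> carrier L. x \<sqsubset> z \<and> z \<sqsubseteq> y}"
    and min: "\<And>w. w \<in> {z \<in> carrier L. x \<sqsubset> z \<and> z \<sqsubseteq> y} \<Longrightarrow> w \<sqsubseteq> z \<Longrightarrow> w = z"
    by (rule minimal_elem[of "{z \<in> carrier L. x \<sqsubset> z \<and> z \<sqsubseteq> y}"]) (use assms in auto)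
  have "covered_by L x z"
    unfolding covered_by_def using z min assms by (auto simp: lless_eq) (meson le_trans)
  with z that show thesis by auto
qed

lemma lower_cover_exists:
  assumes "x \<in> carrier L" "y \<in> carrier L" "x \<sqsubset> y"
  obtains z where "covered_by L z y" "x \<sqsubseteq> z"
proof -
  obtain z where z: "z \<in> {z \<in> carrier L. x \<sqsubseteq> z \<and> z \<sqsubset> y}"
    and max: "\<And>w. w \<in> {z \<in> carrier L. x \<sqsubseteq> z \<and> z \<sqsubset> y} \<Longrightarrow> z \<sqsubseteq> w \<Longrightarrow> w = z"
    by (rule maximal_elem[of "{z \<in> carrier L. x \<sqsubseteq> z \<and> z \<sqsubset> y}"]) (use assms in auto)
  have "covered_by L z y"
    unfolding covered_by_def using z max assms by (auto simp: lless_eq) (metis le_trans)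
  with z that show thesis by auto
qed

text \<open>The two elements of a proper meet representation are incomparable, so below them there are
different covers; together with \<open>two_covers_not_irreducible\<close> this turns meet-irreducibility into the
uniqueness of the upper cover.\<close>
lemma meet_reducible_covers:
  assumes "x \<in> carrier L" "x \<noteq> \<top>" "x \<notin> meet_irreducibles L"
  obtains y z where "covered_by L x y" "covered_by L x z" "y \<noteq> z"
proof -
  from assms obtain u v where uv: "u \<in> carrier L" "v \<in> carrier L" "x = u \<sqinter> v" "x \<noteq> u" "x \<noteq> v"
    by (auto simp: meet_irreducibles_def)
  then have "x \<sqsubset> u" "x \<sqsubset> v" using meet_left meet_right by (auto simp: lless_eq)
  then obtain y z where y: "covered_by L x y" "y \<sqsubseteq> u" and z: "covered_by L x z" "z \<sqsubseteq> v"
    using upper_cover_exists uv assms by metis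
  have "y \<noteq> z"
  proof
    assume "y = z"
    then have "y \<sqsubseteq> x" using y z uv coverD by auto
    then show False using coverD[OF y(1)] by (auto dest: le_antisym)
  qed
  with that y z show thesis by blast
qed

lemma covers_meet:
  assumes "covered_by L x y" "covered_by L x z" "y \<noteq> z"
  shows "y \<sqinter> z = x"
proof -
  note c = coverD[OF assms(1)] coverD[OF assms(2)]
  have "y \<sqinter> z = x \<or> y \<sqinter> z = y" "y \<sqinter> z = x \<or> y \<sqinter> z = z"
    using cover_between[OF assms(1), of "y \<sqinter> z"] cover_between[OF assms(2), of "y \<sqinter> z"] c
      meet_left meet_right by auto
  then show ?thesis using assms by auto
qed

lemma two_covers_not_irreducible:
  assumes "covered_by L x y" "covered_by L x z" "y \<noteq> z"
  shows "x \<notin> meet_irreducibles L"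
  using covers_meet[OF assms] coverD[OF assms(1)] coverD[OF assms(2)]
  by (auto simp: meet_irreducibles_def)

end

section \<open>Rectangular frames\<close>

text \<open>The last condition says that the parts \<open>x \<sqinter> a\<close> and \<open>x \<sqinter> b\<close> determine \<open>x\<close>. All conditions on \<open>a\<close> and \<open>b\<close>
are passed on to homomorphic images, and they are symmetric in \<open>a\<close> and \<open>b\<close>; the degenerate
cases \<open>a = 0\<close> and \<open>b = 0\<close> are included because they occur among the quotients.\<close>
locale rectangular_frame = fin_lattice L for L (structure) +
  fixes a b
  assumes a_in [simp]: "a \<in> carrier L" and b_in [simp]: "b \<in> carrier L"
    and semimod: "\<And>x y z. covered_by L x y \<Longrightarrow> z \<in> carrier L \<Longrightarrow>
        x \<squnion> z = y \<squnion> z \<or> covered_by L (x \<squnion> z) (y \<squnion> z)"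
    and meet_ab: "a \<sqinter> b = \<bottom>" and join_ab: "a \<squnion> b = \<top>"
    and down_a: "\<And>x y. x \<in> carrier L \<Longrightarrow> y \<in> carrier L \<Longrightarrow> x \<sqsubseteq> a \<Longrightarrow> y \<sqsubseteq> a \<Longrightarrow> x \<sqsubseteq> y \<or> y \<sqsubseteq> x"
    and down_b: "\<And>x y. x \<in> carrier L \<Longrightarrow> y \<in> carrier L \<Longrightarrow> x \<sqsubseteq> b \<Longrightarrow> y \<sqsubseteq> b \<Longrightarrow> x \<sqsubseteq> y \<or> y \<sqsubseteq> x"
    and up_a: "\<And>x y. x \<in> carrier L \<Longrightarrow> y \<in> carrier L \<Longrightarrow> a \<sqsubseteq> x \<Longrightarrow> a \<sqsubseteq> y \<Longrightarrow> x \<sqsubseteq> y \<or> y \<sqsubseteq> x"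
    and up_b: "\<And>x y. x \<in> carrier L \<Longrightarrow> y \<in> carrier L \<Longrightarrow> b \<sqsubseteq> x \<Longrightarrow> b \<sqsubseteq> y \<Longrightarrow> x \<sqsubseteq> y \<or> y \<sqsubseteq> x"
    and span: "\<And>x. x \<in> carrier L \<Longrightarrow> (x \<sqinter> a) \<squnion> (x \<sqinter> b) = x"
begin

lemma swap: "rectangular_frame L b a"
proof unfold_locales
  show "b \<sqinter> a = \<bottom>" "b \<squnion> a = \<top>" using meet_ab join_ab by (simp_all add: join_comm meet_comm)
  show "(x \<sqinter> b) \<squnion> (x \<sqinter> a) = x" if "x \<in> carrier L" for x using span[OF that] by (simp add: join_comm)
  show "x \<squnion> z = y \<squnion> z \<or> covered_by L (x \<squnion> z) (y \<squnion> z)"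
    if "covered_by L x y" "z \<in> carrier L" for x y z using semimod[OF that] .
  show "x \<sqsubseteq> y \<or> y \<sqsubseteq> x" if "x \<in> carrier L" "y \<in> carrier L" "x \<sqsubseteq> b" "y \<sqsubseteq> b" for x y
    using down_b[OF that] .
  show "x \<sqsubseteq> y \<or> y \<sqsubseteq> x" if "x \<in> carrier L" "y \<in> carrier L" "x \<sqsubseteq> a" "y \<sqsubseteq> a" for x y
    using down_a[OF that] .
  show "x \<sqsubseteq> y \<or> y \<sqsubseteq> x" if "x \<in> carrier L" "y \<in> carrier L" "b \<sqsubseteq> x" "b \<sqsubseteq> y" for x y
    using up_b[OF that] .
  show "x \<sqsubseteq> y \<or> y \<sqsubseteq> x" if "x \<in> carrier L" "y \<in> carrier L" "a \<sqsubseteq> x" "a \<sqsubseteq> y" for x y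
    using up_a[OF that] .
qed (rule a_in b_in)+

lemma le_iff_parts:
  assumes "x \<in> carrier L" "y \<in> carrier L"
  shows "x \<sqsubseteq> y \<longleftrightarrow> x \<sqinter> a \<sqsubseteq> y \<sqinter> a \<and> x \<sqinter> b \<sqsubseteq> y \<sqinter> b"
proof
  assume "x \<sqsubseteq> y"
  then show "x \<sqinter> a \<sqsubseteq> y \<sqinter> a \<and> x \<sqinter> b \<sqsubseteq> y \<sqinter> b"
    using assms by (auto intro: meet_left meet_right le_trans[OF meet_left])
next
  assume "x \<sqinter> a \<sqsubseteq> y \<sqinter> a \<and> x \<sqinter> b \<sqsubseteq> y \<sqinter> b"
  then have "(x \<sqinter> a) \<squnion> (x \<sqinter> b) \<sqsubseteq> y" using assms by simp
  then show "x \<sqsubseteq> y" using span assms by simp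
qed

text \<open>Semimodularity makes the join of \<open>x\<close> with the successor \<open>c\<close> of its \<open>a\<close>-part a cover of \<open>x\<close>; since the
ideal of \<open>a\<close> is a chain, every larger element with a larger \<open>a\<close>-part is above \<open>c\<close>. So there is at most
one cover that changes the \<open>a\<close>-part.\<close>
lemma next_a:
  assumes x: "x \<in> carrier L" and q: "q \<in> carrier L" and ltq: "x \<sqsubseteq> q" "x \<sqinter> a \<noteq> q \<sqinter> a"
  obtains c where "covered_by L (x \<sqinter> a) c" "c \<sqsubseteq> a" "covered_by L x (x \<squnion> c)"
    "\<And>y. y \<in> carrier L \<Longrightarrow> x \<sqsubseteq> y \<Longrightarrow> y \<sqinter> a \<noteq> x \<sqinter> a \<Longrightarrow> x \<squnion> c \<sqsubseteq> y"
proof -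
  have "x \<sqinter> a \<sqsubset> q \<sqinter> a" using ltq x q le_iff_parts[of x q] by (auto simp: lless_eq)
  then obtain c where c: "covered_by L (x \<sqinter> a) c" "c \<sqsubseteq> q \<sqinter> a"
    using upper_cover_exists x q by (metis a_in meet_closed)
  note cc = coverD[OF c(1)]
  have ca: "c \<sqsubseteq> a" using c cc q by auto
  have nx: "\<not> c \<sqsubseteq> x" using ca cc x by (auto dest: le_antisym)
  have "x \<sqinter> a \<squnion> x = x" using x meet_left[of x a] by (intro le_antisym) (auto intro: join_right)
  moreover have "c \<squnion> x \<noteq> x" using nx join_left[OF cc(2) x] by metis
  ultimately have cov: "covered_by L x (x \<squnion> c)"
    using semimod[OF c(1) x] by (auto simp: join_comm)
  have "x \<squnion> c \<sqsubseteq> y" if y: "y \<in> carrier L" "x \<sqsubseteq> y" "y \<sqinter> a \<noteq> x \<sqinter> a" for y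
  proof -
    have le: "x \<sqinter> a \<sqsubseteq> y \<sqinter> a" using y x le_iff_parts[of x y] by auto
    have "c \<sqsubseteq> y \<sqinter> a \<or> y \<sqinter> a \<sqsubseteq> c" using down_a[of c "y \<sqinter> a"] ca cc y by (auto intro: meet_right)
    then have "c \<sqsubseteq> y \<sqinter> a" using cover_between[OF c(1), of "y \<sqinter> a"] le y cc by auto
    then show ?thesis using y x cc by auto
  qed
  with that c(1) ca cov show thesis by blast
qed

lemma next_b:
  assumes "x \<in> carrier L" "q \<in> carrier L" "x \<sqsubseteq> q" "x \<sqinter> b \<noteq> q \<sqinter> b"
  obtains d where "covered_by L (x \<sqinter> b) d" "d \<sqsubseteq> b" "covered_by L x (x \<squnion> d)"
    "\<And>y. y \<in> carrier L \<Longrightarrow> x \<sqsubseteq> y \<Longrightarrow> y \<sqinter> b \<noteq> x \<sqinter> b \<Longrightarrow> x \<squnion> d \<sqsubseteq> y"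
  using rectangular_frame.next_a[OF swap assms] by blast

lemma parts_eq:
  "x \<in> carrier L \<Longrightarrow> y \<in> carrier L \<Longrightarrow> x \<sqinter> a = y \<sqinter> a \<Longrightarrow> x \<sqinter> b = y \<sqinter> b \<Longrightarrow> x = y"
  using span by metis

lemma cover_changing_a_unique:
  assumes "covered_by L x y" "covered_by L x z" "y \<sqinter> a \<noteq> x \<sqinter> a" "z \<sqinter> a \<noteq> x \<sqinter> a"
  shows "y = z"
proof -
  note c = coverD[OF assms(1)] coverD[OF assms(2)]
  obtain e where e: "covered_by L x (x \<squnion> e)"
    "\<And>y. y \<in> carrier L \<Longrightarrow> x \<sqsubseteq> y \<Longrightarrow> y \<sqinter> a \<noteq> x \<sqinter> a \<Longrightarrow> x \<squnion> e \<sqsubseteq> y"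
    using next_a[of x y] c assms(3) by metis
  note ec = coverD[OF e(1)]
  have "x \<squnion> e = y" "x \<squnion> e = z"
    using cover_between[OF assms(1), of "x \<squnion> e"] cover_between[OF assms(2), of "x \<squnion> e"] e ec c assms by auto
  then show ?thesis by simp
qed

lemma cover_changing_b_unique:
  assumes "covered_by L x y" "covered_by L x z" "y \<sqinter> b \<noteq> x \<sqinter> b" "z \<sqinter> b \<noteq> x \<sqinter> b"
  shows "y = z"
  using rectangular_frame.cover_changing_a_unique[OF swap assms] .

lemma cover_changes:
  assumes "covered_by L x y" shows "y \<sqinter> a \<noteq> x \<sqinter> a \<or> y \<sqinter> b \<noteq> x \<sqinter> b"
  using parts_eq coverD[OF assms] by metis

text \<open>Two covers cannot both change the same part, so of two different covers one changes only the
\<open>a\<close>-part and the other one only the \<open>b\<close>-part.\<close>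
lemma two_covers_parts:
  assumes "covered_by L x y" "covered_by L x z" "y \<noteq> z"
  shows "y \<sqinter> a = x \<sqinter> a \<and> y \<sqinter> b \<noteq> x \<sqinter> b \<and> z \<sqinter> b = x \<sqinter> b \<and> z \<sqinter> a \<noteq> x \<sqinter> a \<or>
         z \<sqinter> a = x \<sqinter> a \<and> z \<sqinter> b \<noteq> x \<sqinter> b \<and> y \<sqinter> b = x \<sqinter> b \<and> y \<sqinter> a \<noteq> x \<sqinter> a"
  using cover_changing_a_unique[OF assms(1,2)] cover_changing_b_unique[OF assms(1,2)]
    cover_changes[OF assms(1)] cover_changes[OF assms(2)] assms(3) by metis

lemma meet_a_bottom: "x \<in> carrier L \<Longrightarrow> x \<sqsubseteq> a \<Longrightarrow> x \<sqinter> b = \<bottom>"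
  using le_trans[of "x \<sqinter> b" x a] le_meet_iff[of a b "x \<sqinter> b"] below_bottom[of "x \<sqinter> b"] meet_ab by simp

text \<open>A cover that preserves the \<open>a\<close>-part leaves room for a second one: if the \<open>a\<close>-part of \<open>x\<close> is not yet
\<open>a\<close>, then joining with its successor gives a cover that changes the \<open>a\<close>-part.\<close>
lemma two_covers_exist:
  assumes "x \<in> carrier L" "\<not> a \<sqsubseteq> x" "covered_by L x y" "y \<sqinter> a = x \<sqinter> a"
  obtains z where "covered_by L x z" "z \<sqinter> b = x \<sqinter> b" "z \<sqinter> a \<noteq> x \<sqinter> a" "z \<noteq> y"
proof -
  have ne: "x \<sqinter> a \<noteq> \<top> \<sqinter> a"
    using meet_left[OF assms(1) a_in] meet_absorb2[of \<top> a] assms(2) by (metis a_in top_closed top_higher)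
  then obtain c where c: "covered_by L x (x \<squnion> c)" "covered_by L (x \<sqinter> a) c" "c \<sqsubseteq> a"
    using next_a[OF assms(1) top_closed top_higher[OF assms(1)] ne] by metis
  note cc = coverD[OF c(1)] coverD[OF c(2)]
  have "\<not> c \<sqsubseteq> x" using cc c(3) assms(1) by (auto dest: le_antisym)
  then have ne: "(x \<squnion> c) \<sqinter> a \<noteq> x \<sqinter> a"
    using join_right[of x c] c(3) cc assms(1) le_meet_iff[of "x \<squnion> c" a c] le_meet_iff[of x a c]
    by (metis a_in join_closed)
  then have "x \<squnion> c \<noteq> y" using assms by auto
  then show thesis
    using two_covers_parts[OF c(1) assms(3)] assms(4) that[OF c(1)] by auto
qed

text \<open>The covers are the successor of \<open>x\<close> in the ideal of \<open>a\<close> and the join of \<open>x\<close> with an atom of the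
ideal of \<open>b\<close>, which is not below \<open>a\<close>.\<close>
lemma below_a_two_covers:
  assumes "b \<noteq> \<bottom>" "x \<in> carrier L" "x \<sqsubseteq> a" "x \<noteq> a"
  obtains y z where "covered_by L x y" "covered_by L x z" "y \<noteq> z"
proof -
  have xb: "x \<sqinter> b = \<bottom>" using assms meet_a_bottom by auto
  have ne: "x \<sqinter> b \<noteq> \<top> \<sqinter> b" using assms xb meet_absorb2[of \<top> b] by auto
  have ne': "x \<sqinter> a \<noteq> a \<sqinter> a" using assms meet_absorb1 by auto
  obtain c where c: "covered_by L x (x \<squnion> c)" "c \<sqsubseteq> a" "covered_by L (x \<sqinter> a) c"
    using next_a[OF assms(2) a_in assms(3) ne'] .
  obtain d where d: "covered_by L x (x \<squnion> d)" "d \<sqsubseteq> b" "covered_by L (x \<sqinter> b) d"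
    using next_b[OF assms(2) top_closed top_higher[OF assms(2)] ne] .
  have "x \<squnion> c \<noteq> x \<squnion> d"
  proof
    assume "x \<squnion> c = x \<squnion> d"
    then have "d \<sqsubseteq> x \<squnion> c" using coverD[OF d(3)] assms by simp
    then have "d \<sqsubseteq> a" using le_trans[of d "x \<squnion> c" a] coverD[OF d(3)] coverD[OF c(3)] c(2) assms by simp
    then have "d \<sqsubseteq> \<bottom>" using d(2) coverD[OF d(3)] meet_ab le_meet_iff[of a b d] by simp
    then show False using xb coverD[OF d(3)] below_bottom by auto
  qed
  then show thesis using that c d by blast
qed

lemma not_above_both: "x \<in> carrier L \<Longrightarrow> a \<sqsubseteq> x \<Longrightarrow> b \<sqsubseteq> x \<Longrightarrow> x = \<top>"
  using join_ab join_le_iff[of a b x] top_least by simp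

lemma above_a_one_cover:
  assumes "a \<sqsubseteq> x" "covered_by L x y" "covered_by L x z" shows "y = z"
proof -
  note c = coverD[OF assms(2)] coverD[OF assms(3)]
  have "y \<sqsubseteq> z \<or> z \<sqsubseteq> y" by (intro up_a) (use c assms le_trans[of a x] in auto)
  then show ?thesis
    using cover_between[OF assms(2), of z] cover_between[OF assms(3), of y] c by auto
qed

lemma a_ne_top: "b \<noteq> \<bottom> \<Longrightarrow> a \<noteq> \<top>"
  using meet_ab meet_absorb2[of \<top> b] by auto

lemma a_doubly_irreducible:
  assumes "a \<noteq> \<bottom>" "b \<noteq> \<bottom>"
  shows "a \<in> join_irreducibles L \<inter> meet_irreducibles L"
proof
  show "a \<in> join_irreducibles L"
    unfolding join_irreducibles_def
  proof (intro CollectI conjI ballI impI)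
    fix u v assume uv: "u \<in> carrier L" "v \<in> carrier L" "a = u \<squnion> v"
    then have "u \<sqsubseteq> v \<or> v \<sqsubseteq> u" using down_a[of u v] by simp
    then show "a = u \<or> a = v"
      using uv le_antisym[of "u \<squnion> v" u] le_antisym[of "u \<squnion> v" v] by auto
  qed (use assms in auto)
  show "a \<in> meet_irreducibles L"
    unfolding meet_irreducibles_def
  proof (intro CollectI conjI ballI impI)
    fix u v assume uv: "u \<in> carrier L" "v \<in> carrier L" "a = u \<sqinter> v"
    then have "u \<sqsubseteq> v \<or> v \<sqsubseteq> u" using up_a[of u v] by simp
    then show "a = u \<or> a = v"
      using uv le_antisym[of "u \<sqinter> v" u] le_antisym[of "u \<sqinter> v" v] by auto
  qed (use assms a_ne_top in auto)
qed

lemma below_a_doubly_irreducible: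
  assumes "b \<noteq> \<bottom>" "x \<in> meet_irreducibles L" "x \<sqsubseteq> a"
  shows "x = a"
  using below_a_two_covers[OF assms(1) _ assms(3)] two_covers_not_irreducible assms(2)
  by (metis (no_types, lifting) meet_irreducibles_def mem_Collect_eq)

text \<open>The elements comparable to \<open>a\<close> will turn out to form one of the two boundary chains of a C1-diagram.\<close>
definition spine where "spine = {x \<in> carrier L. x \<sqsubseteq> a \<or> a \<sqsubseteq> x}"

lemma spine_maxchain: "pred_on.maxchain (carrier L) (le L) spine"
proof -
  have "pred_on.chain (carrier L) (le L) spine"
    unfolding chain_iff
  proof (intro conjI ballI)
    fix x y assume "x \<in> spine" "y \<in> spine"
    then show "x \<sqsubseteq> y \<or> y \<sqsubseteq> x"
      unfolding spine_def
      using down_a[of x y] up_a[of x y] le_trans[of x a y] le_trans[of y a x] by auto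
  qed (auto simp: spine_def)
  moreover have "S = spine" if S: "pred_on.chain (carrier L) (le L) S" "spine \<subseteq> S" for S
  proof -
    have "a \<in> S" using S by (auto simp: spine_def)
    then show ?thesis using S unfolding chain_iff spine_def by auto
  qed
  ultimately show ?thesis unfolding pred_on.maxchain_def by auto
qed

lemma spine_next:
  assumes "x \<in> spine" "x \<noteq> \<top>"
  shows "\<exists>y\<in>spine. covered_by L x y"
proof (cases "x \<sqsubseteq> a \<and> x \<noteq> a")
  case True
  then obtain y where "covered_by L x y" "y \<sqsubseteq> a"
    using upper_cover_exists[of x a] assms by (auto simp: spine_def lless_eq)
  then show ?thesis using coverD[of x y] by (auto simp: spine_def)
next
  case False
  then have ax: "a \<sqsubseteq> x" "x \<in> carrier L" using assms by (auto simp: spine_def)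
  then obtain y where y: "covered_by L x y"
    using upper_cover_exists[of x \<top>] assms by (auto simp: lless_eq)
  then show ?thesis using ax coverD[OF y] le_trans[of a x y] by (auto simp: spine_def)
qed

lemma spine_carrier: "spine \<subseteq> carrier L" "\<bottom> \<in> spine"
  by (auto simp: spine_def)

lemma finite_lattice_L: "finite_lattice L"
  unfolding finite_lattice_def using fin nonempty lattice_axioms by auto

lemma join_irreducible_cases:
  assumes "x \<in> join_irreducibles L" shows "x \<sqsubseteq> a \<or> x \<sqsubseteq> b"
proof -
  have x: "x \<in> carrier L" using assms by (simp add: join_irreducibles_def)
  have "\<forall>u\<in>carrier L. \<forall>v\<in>carrier L. x = u \<squnion> v \<longrightarrow> x = u \<or> x = v"
    using assms unfolding join_irreducibles_def by simp
  note this[THEN bspec, OF meet_closed[OF x a_in], THEN bspec, OF meet_closed[OF x b_in]]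
  then show ?thesis using span[OF x] meet_right[OF x a_in] meet_right[OF x b_in] by metis
qed

lemma slim_rectangularI:
  assumes "a \<noteq> \<bottom>" "b \<noteq> \<bottom>"
  shows "slim_rectangular L"
proof -
  interpret s: rectangular_frame L b a by (rule swap)
  let ?J = "join_irreducibles L"
  have "pred_on.chain (carrier L) (le L) {x \<in> ?J. x \<sqsubseteq> a}"
    "pred_on.chain (carrier L) (le L) {x \<in> ?J. x \<sqsubseteq> b}"
    unfolding chain_iff join_irreducibles_def using down_a down_b by auto
  moreover have "?J = {x \<in> ?J. x \<sqsubseteq> a} \<union> {x \<in> ?J. x \<sqsubseteq> b}"
    using join_irreducible_cases by auto
  ultimately have "slim L" unfolding slim_def using finite_lattice_L by blast
  moreover have "semimodular L" unfolding semimodular_def using semimod lattice_axioms by auto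
  moreover have "a \<noteq> b" using meet_ab assms meet_absorb1[of a a] by auto
  moreover have "x = a \<or> x = b" if "x \<in> ?J \<inter> meet_irreducibles L" for x
    using join_irreducible_cases[of x] below_a_doubly_irreducible[OF assms(2), of x]
      s.below_a_doubly_irreducible[OF assms(1), of x] that by blast
  then have "?J \<inter> meet_irreducibles L = {a, b}"
    using a_doubly_irreducible[OF assms] s.a_doubly_irreducible[OF assms(2,1)] by blast
  ultimately show ?thesis
    unfolding slim_rectangular_def complementary_def using meet_ab join_ab by blast
qed

end

section \<open>Slim rectangular lattices are frames\<close>

context fin_lattice begin

lemma join_irreducibles_generate:
  assumes "x \<in> carrier L" "y \<in> carrier L"
    and "\<And>j. j \<in> join_irreducibles L \<Longrightarrow> j \<sqsubseteq> x \<Longrightarrow> j \<sqsubseteq> y"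
  shows "x \<sqsubseteq> y"
  using assms(1,3)
proof (induction x rule: order_induct)
  case (less x)
  show ?case
  proof (cases "x = \<bottom> \<or> x \<in> join_irreducibles L")
    case True
    then show ?thesis using less assms(2) by auto
  next
    case False
    then obtain u v where uv: "u \<in> carrier L" "v \<in> carrier L" "x = u \<squnion> v" "x \<noteq> u" "x \<noteq> v"
      using less.hyps unfolding join_irreducibles_def by auto
    have ji: "j \<in> join_irreducibles L \<Longrightarrow> j \<in> carrier L" for j by (simp add: join_irreducibles_def)
    have "w \<sqsubseteq> y" if "w = u \<or> w = v" for w
    proof (rule less.IH)
      show "w \<in> carrier L" "w \<sqsubset> x" using that uv by (auto simp: lless_eq)
      show "j \<sqsubseteq> y" if j: "j \<in> join_irreducibles L" "j \<sqsubseteq> w" for j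
        by (rule less.prems) (use j ji[OF j(1)] \<open>w \<sqsubset> x\<close> \<open>w \<in> carrier L\<close> less.hyps in \<open>auto simp: lless_eq dest: le_trans\<close>)
    qed
    then show ?thesis using uv assms(2) by auto
  qed
qed

text \<open>Let \<open>m\<close> be the largest element of \<open>C\<close>. Above \<open>m\<close> only the join-irreducible elements in the chain \<open>D\<close>
can distinguish elements, so the filter of \<open>m\<close> is a chain and \<open>m\<close> is meet-irreducible. Hence \<open>m\<close> is
doubly irreducible, and it must be \<open>a\<close>.\<close>
lemma chain_top:
  assumes J: "join_irreducibles L = C \<union> D"
    and C: "pred_on.chain (carrier L) (le L) C" and D: "pred_on.chain (carrier L) (le L) D"
    and ab: "join_irreducibles L \<inter> meet_irreducibles L = {a, b}" "a \<squnion> b = \<top>"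
    and aC: "a \<in> C" "\<not> a \<sqsubseteq> b"
  shows "c \<in> C \<Longrightarrow> c \<sqsubseteq> a"
    and "x \<in> carrier L \<Longrightarrow> y \<in> carrier L \<Longrightarrow> a \<sqsubseteq> x \<Longrightarrow> a \<sqsubseteq> y \<Longrightarrow> x \<sqsubseteq> y \<or> y \<sqsubseteq> x"
proof -
  have Cc: "\<And>x. x \<in> C \<Longrightarrow> x \<in> carrier L" and Cch: "\<And>x y. x \<in> C \<Longrightarrow> y \<in> C \<Longrightarrow> x \<sqsubseteq> y \<or> y \<sqsubseteq> x"
    and Dc: "\<And>x. x \<in> D \<Longrightarrow> x \<in> carrier L" and Dch: "\<And>x y. x \<in> D \<Longrightarrow> y \<in> D \<Longrightarrow> x \<sqsubseteq> y \<or> y \<sqsubseteq> x"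
    using C D unfolding chain_iff by auto
  obtain m where m: "m \<in> C" and mx: "\<And>y. y \<in> C \<Longrightarrow> m \<sqsubseteq> y \<Longrightarrow> y = m"
    by (rule maximal_elem[of C]) (use Cc aC in auto)
  have mtop: "c \<sqsubseteq> m" if "c \<in> C" for c using Cch[OF that m] mx[OF that] Cc that by auto
  have up: "x \<sqsubseteq> y \<or> y \<sqsubseteq> x"
    if xy: "x \<in> carrier L" "y \<in> carrier L" "m \<sqsubseteq> x" "m \<sqsubseteq> y" for x y
  proof (rule ccontr)
    assume n: "\<not> (x \<sqsubseteq> y \<or> y \<sqsubseteq> x)"
    obtain j where j: "j \<in> join_irreducibles L" "j \<sqsubseteq> x" "\<not> j \<sqsubseteq> y"
      using join_irreducibles_generate[of x y] n xy by blast
    obtain k where k: "k \<in> join_irreducibles L" "k \<sqsubseteq> y" "\<not> k \<sqsubseteq> x"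
      using join_irreducibles_generate[of y x] n xy by blast
    have "j \<in> D" "k \<in> D" using j k J mtop xy Cc m by (metis Un_iff le_trans)+
    then show False using Dch[of j k] j k xy Dc by (metis le_trans)
  qed
  have irr: "a \<in> carrier L" "b \<in> carrier L" "a \<noteq> \<top>" "b \<noteq> \<top>"
    using ab(1) unfolding meet_irreducibles_def by auto
  have mJ: "m \<in> join_irreducibles L" using m J by auto
  have "m = a \<squnion> b \<longrightarrow> m = a \<or> m = b" using mJ irr unfolding join_irreducibles_def by blast
  then have "m \<noteq> \<top>" using irr ab(2) by metis
  moreover have "m = u \<or> m = v" if "u \<in> carrier L" "v \<in> carrier L" "m = u \<sqinter> v" for u v
    using up[of u v] that le_antisym[of "u \<sqinter> v" u] le_antisym[of "u \<sqinter> v" v] by auto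
  ultimately have "m \<in> meet_irreducibles L" unfolding meet_irreducibles_def using Cc m by auto
  then have "m = a" using mJ ab(1) mtop[OF aC(1)] aC by auto
  then show "c \<in> C \<Longrightarrow> c \<sqsubseteq> a"
    and "x \<in> carrier L \<Longrightarrow> y \<in> carrier L \<Longrightarrow> a \<sqsubseteq> x \<Longrightarrow> a \<sqsubseteq> y \<Longrightarrow> x \<sqsubseteq> y \<or> y \<sqsubseteq> x"
    using mtop up by auto
qed

text \<open>An element of \<open>D\<close> below \<open>a\<close> would be below \<open>a \<sqinter> b = 0\<close>, so only the chain \<open>C\<close> generates elements below \<open>a\<close>.\<close>
lemma down_chain:
  assumes J: "join_irreducibles L = C \<union> D"
    and C: "pred_on.chain (carrier L) (le L) C" and D: "\<And>d. d \<in> D \<Longrightarrow> d \<sqsubseteq> b"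
    and ab: "a \<in> carrier L" "b \<in> carrier L" "a \<sqinter> b = \<bottom>"
    and xy: "x \<in> carrier L" "y \<in> carrier L" "x \<sqsubseteq> a" "y \<sqsubseteq> a"
  shows "x \<sqsubseteq> y \<or> y \<sqsubseteq> x"
proof (rule ccontr)
  assume n: "\<not> (x \<sqsubseteq> y \<or> y \<sqsubseteq> x)"
  obtain j where j: "j \<in> join_irreducibles L" "j \<sqsubseteq> x" "\<not> j \<sqsubseteq> y"
    using join_irreducibles_generate[of x y] n xy by blast
  obtain k where k: "k \<in> join_irreducibles L" "k \<sqsubseteq> y" "\<not> k \<sqsubseteq> x"
    using join_irreducibles_generate[of y x] n xy by blast
  have ji: "j \<in> carrier L" "j \<noteq> \<bottom>" "k \<in> carrier L" "k \<noteq> \<bottom>"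
    using j k by (auto simp: join_irreducibles_def)
  have "j \<sqsubseteq> a" "k \<sqsubseteq> a" using j k ji xy ab by (meson le_trans)+
  then have "\<not> j \<sqsubseteq> b" "\<not> k \<sqsubseteq> b" using ji ab le_meet_iff[of a b] below_bottom by metis+
  then have "j \<in> C" "k \<in> C" using j k J D by auto
  then have "j \<sqsubseteq> k \<or> k \<sqsubseteq> j" using C ji unfolding chain_iff by auto
  then show False using j k ji xy by (meson le_trans)
qed

end

lemma slim_rectangular_frame:
  fixes L (structure)
  assumes "slim_rectangular L"
  obtains a b where "rectangular_frame L a b" "a \<noteq> \<bottom>" "b \<noteq> \<bottom>"
proof -
  from assms have s: "slim L" "semimodular L" unfolding slim_rectangular_def by auto
  then have fl: "finite_lattice L" unfolding slim_def by auto
  interpret lattice L using fl unfolding finite_lattice_def by auto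
  interpret fin_lattice L by unfold_locales (use fl in \<open>auto simp: finite_lattice_def\<close>)
  from assms obtain a b where ab: "a \<noteq> b" "join_irreducibles L \<inter> meet_irreducibles L = {a, b}"
    "a \<sqinter> b = \<bottom>" "a \<squnion> b = \<top>" unfolding slim_rectangular_def complementary_def by auto
  have ji: "a \<in> join_irreducibles L" "b \<in> join_irreducibles L" using ab by auto
  then have ba: "a \<in> carrier L" "b \<in> carrier L" "a \<noteq> \<bottom>" "b \<noteq> \<bottom>"
    by (auto simp: join_irreducibles_def)
  have inc: "\<not> a \<sqsubseteq> b" "\<not> b \<sqsubseteq> a"
    using ab(3) ba le_meet_iff[of a b a] le_meet_iff[of a b b] below_bottom by auto
  obtain C D where CD: "pred_on.chain (carrier L) (le L) C" "pred_on.chain (carrier L) (le L) D"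
    "join_irreducibles L = C \<union> D" "a \<in> C"
  proof -
    obtain C D where *: "pred_on.chain (carrier L) (le L) C" "pred_on.chain (carrier L) (le L) D"
      "join_irreducibles L = C \<union> D" using s unfolding slim_def by auto
    then show thesis using that[of C D] that[of D C] ji by (auto simp: Un_commute)
  qed
  have "b \<notin> C"
    using CD(1,4) inc ab(1) unfolding chain_iff by auto
  then have bD: "b \<in> D" using ji CD by auto
  note ct = chain_top[OF CD(3,1,2) ab(2,4) CD(4) inc(1)]
  have "D \<union> C = join_irreducibles L" using CD by auto
  note ct' = chain_top[OF this[symmetric] CD(2,1) _ _ bD inc(2)]
  have ab': "join_irreducibles L \<inter> meet_irreducibles L = {b, a}" "b \<squnion> a = \<top>" "b \<sqinter> a = \<bottom>"
    using ab by (auto simp: join_comm meet_comm)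
  note ct' = ct'[OF ab'(1,2)]
  have "rectangular_frame L a b"
  proof unfold_locales
    show "a \<in> carrier L" "b \<in> carrier L" "a \<sqinter> b = \<bottom>" "a \<squnion> b = \<top>" by fact+
    show "x \<squnion> z = y \<squnion> z \<or> covered_by L (x \<squnion> z) (y \<squnion> z)"
      if "covered_by L x y" "z \<in> carrier L" for x y z
      using s(2) that coverD[OF that(1)] unfolding semimodular_def by auto
    show "x \<sqsubseteq> y \<or> y \<sqsubseteq> x" if "x \<in> carrier L" "y \<in> carrier L" "x \<sqsubseteq> a" "y \<sqsubseteq> a" for x y
      by (rule down_chain[OF CD(3,1) ct'(1) ba(1,2) ab(3) that])
    show "x \<sqsubseteq> y \<or> y \<sqsubseteq> x" if "x \<in> carrier L" "y \<in> carrier L" "x \<sqsubseteq> b" "y \<sqsubseteq> b" for x y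
      by (rule down_chain[OF _ CD(2) ct(1) ba(2,1) ab'(3) that]) (use CD in auto)
    show "x \<sqsubseteq> y \<or> y \<sqsubseteq> x" if "x \<in> carrier L" "y \<in> carrier L" "a \<sqsubseteq> x" "a \<sqsubseteq> y" for x y
      using ct(2) that .
    show "x \<sqsubseteq> y \<or> y \<sqsubseteq> x" if "x \<in> carrier L" "y \<in> carrier L" "b \<sqsubseteq> x" "b \<sqsubseteq> y" for x y
      using ct'(2) that .
    show "(x \<sqinter> a) \<squnion> (x \<sqinter> b) = x" if x: "x \<in> carrier L" for x
    proof (rule le_antisym)
      show "(x \<sqinter> a) \<squnion> (x \<sqinter> b) \<sqsubseteq> x" using x ba by simp
      show "x \<sqsubseteq> (x \<sqinter> a) \<squnion> (x \<sqinter> b)"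
      proof (rule join_irreducibles_generate)
        fix j assume j: "j \<in> join_irreducibles L" "j \<sqsubseteq> x"
        have jc: "j \<in> carrier L" using j by (simp add: join_irreducibles_def)
        have "j \<sqsubseteq> x \<sqinter> a \<or> j \<sqsubseteq> x \<sqinter> b" using j(1) CD(3) ct(1) ct'(1) j(2) jc ba x by auto
        then show "j \<sqsubseteq> (x \<sqinter> a) \<squnion> (x \<sqinter> b)"
          using jc x ba by (meson join_closed join_left join_right le_trans meet_closed)
      qed (use x ba in auto)
    qed (use x ba in auto)
  qed
  then show thesis using that ba by auto
qed

section \<open>Quotients of frames\<close>

locale frame_congruence = rectangular_frame L a b for L (structure) and a b +
  fixes \<alpha>
  assumes congruence: "lattice_congruence L \<alpha>"
begin

abbreviation cls where "cls x \<equiv> \<alpha> `` {x}"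
abbreviation Q where "Q \<equiv> quotient_lattice L \<alpha>"

lemma equiv_cong: "equiv (carrier L) \<alpha>"
  using congruence by (simp add: lattice_congruence_def)

lemma rel_carrier: "(x, y) \<in> \<alpha> \<Longrightarrow> x \<in> carrier L \<and> y \<in> carrier L"
  using equiv_cong by (auto simp: equiv_def refl_on_def)

lemma rel_refl: "x \<in> carrier L \<Longrightarrow> (x, x) \<in> \<alpha>"
  using equiv_cong by (auto simp: equiv_def refl_on_def)

lemma rel_sym: "(x, y) \<in> \<alpha> \<Longrightarrow> (y, x) \<in> \<alpha>"
  using equiv_cong by (auto simp: equiv_def sym_def)

lemma rel_trans: "(x, y) \<in> \<alpha> \<Longrightarrow> (y, z) \<in> \<alpha> \<Longrightarrow> (x, z) \<in> \<alpha>"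
  using equiv_cong unfolding equiv_def trans_def by blast

lemma rel_join: "(x, x') \<in> \<alpha> \<Longrightarrow> (y, y') \<in> \<alpha> \<Longrightarrow> (x \<squnion> y, x' \<squnion> y') \<in> \<alpha>"
  and rel_meet: "(x, x') \<in> \<alpha> \<Longrightarrow> (y, y') \<in> \<alpha> \<Longrightarrow> (x \<sqinter> y, x' \<sqinter> y') \<in> \<alpha>"
  using congruence by (auto simp: lattice_congruence_def)

lemma cls_eq_iff: "x \<in> carrier L \<Longrightarrow> y \<in> carrier L \<Longrightarrow> cls x = cls y \<longleftrightarrow> (x, y) \<in> \<alpha>"
  using equiv_cong by (simp add: eq_equiv_class_iff)

lemma carrier_Q: "carrier Q = cls ` carrier L"
  by (auto simp: quotient_lattice_def quotient_def)

lemma cls_carrier [simp]: "x \<in> carrier L \<Longrightarrow> cls x \<in> carrier Q"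
  by (simp add: carrier_Q)

lemma Q_cases: assumes "X \<in> carrier Q" obtains x where "x \<in> carrier L" "X = cls x"
  using assms by (auto simp: carrier_Q)

text \<open>The order of the quotient is defined through joins of arbitrary representatives; the following two
lemmas make it independent of their choice and express it dually through meets.\<close>
lemma le_cls_iff:
  assumes "x \<in> carrier L" "y \<in> carrier L"
  shows "le Q (cls x) (cls y) \<longleftrightarrow> (x \<squnion> y, y) \<in> \<alpha>"
proof
  assume "le Q (cls x) (cls y)"
  then obtain u v where uv: "(x, u) \<in> \<alpha>" "(y, v) \<in> \<alpha>" "cls (u \<squnion> v) = cls y"
    by (auto simp: quotient_lattice_def)
  then have "(u \<squnion> v, y) \<in> \<alpha>" using rel_carrier assms cls_eq_iff by auto
  then show "(x \<squnion> y, y) \<in> \<alpha>" using rel_join[OF uv(1,2)] rel_trans by blast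
next
  assume "(x \<squnion> y, y) \<in> \<alpha>"
  then have "cls (x \<squnion> y) = cls y" using cls_eq_iff assms by auto
  then show "le Q (cls x) (cls y)"
    using rel_refl assms by (auto simp: quotient_lattice_def)
qed

lemma le_cls_iff_meet:
  assumes "x \<in> carrier L" "y \<in> carrier L"
  shows "le Q (cls x) (cls y) \<longleftrightarrow> (x \<sqinter> y, x) \<in> \<alpha>"
proof -
  have 1: "x \<sqinter> (x \<squnion> y) = x" using meet_absorb1[of x "x \<squnion> y"] assms by simp
  have 2: "(x \<sqinter> y) \<squnion> y = y" using assms by (intro le_antisym) auto
  have "(x \<squnion> y, y) \<in> \<alpha> \<Longrightarrow> (x \<sqinter> y, x) \<in> \<alpha>"
    using rel_meet[OF rel_refl[OF assms(1)], of "x \<squnion> y" y] 1 rel_sym by auto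
  moreover have "(x \<sqinter> y, x) \<in> \<alpha> \<Longrightarrow> (x \<squnion> y, y) \<in> \<alpha>"
    using rel_join[OF _ rel_refl[OF assms(2)], of "x \<sqinter> y" x] 2 rel_sym by auto
  ultimately show ?thesis using le_cls_iff[OF assms] by blast
qed

lemma cls_mono:
  assumes "x \<in> carrier L" "y \<in> carrier L" "x \<sqsubseteq> y" shows "le Q (cls x) (cls y)"
proof -
  have "x \<squnion> y = y" using assms by (intro le_antisym) auto
  then show ?thesis using le_cls_iff assms rel_refl by auto
qed

lemma eq_Q: "eq Q = (=)" by (simp add: quotient_lattice_def)

lemma partial_order_Q: "partial_order Q"
proof
  fix X Y Z W
  show "le Q X X" if "X \<in> carrier Q" using that cls_mono by (auto simp: carrier_Q)
  show "eq Q X Y" if XY: "le Q X Y" "le Q Y X" "X \<in> carrier Q" "Y \<in> carrier Q"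
  proof -
    obtain x y where xy: "x \<in> carrier L" "X = cls x" "y \<in> carrier L" "Y = cls y"
      using XY Q_cases by metis
    then have "(x \<squnion> y, y) \<in> \<alpha>" "(y \<squnion> x, x) \<in> \<alpha>" using XY le_cls_iff by auto
    then have "(x, y) \<in> \<alpha>" using rel_sym rel_trans join_comm[of L x y] by metis
    then show ?thesis using xy cls_eq_iff eq_Q by auto
  qed
  show "le Q X Z" if XYZ: "le Q X Y" "le Q Y Z" "X \<in> carrier Q" "Y \<in> carrier Q" "Z \<in> carrier Q"
  proof -
    obtain x y z where xy: "x \<in> carrier L" "X = cls x" "y \<in> carrier L" "Y = cls y"
        "z \<in> carrier L" "Z = cls z"
      using XYZ Q_cases by metis
    then have r: "(x \<squnion> y, y) \<in> \<alpha>" "(y \<squnion> z, z) \<in> \<alpha>" using XYZ le_cls_iff by auto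
    have j: "x \<squnion> (y \<squnion> z) = x \<squnion> y \<squnion> z"
      using xy by (intro le_antisym) (auto simp: le_joinI)
    have "(x \<squnion> z, x \<squnion> (y \<squnion> z)) \<in> \<alpha>" using rel_join[OF rel_refl[OF xy(1)] rel_sym[OF r(2)]] .
    moreover have "(x \<squnion> y \<squnion> z, y \<squnion> z) \<in> \<alpha>" using rel_join[OF r(1) rel_refl[OF xy(5)]] .
    ultimately have "(x \<squnion> z, z) \<in> \<alpha>" using r(2) rel_trans unfolding j by blast
    then show ?thesis using xy le_cls_iff by auto
  qed
qed (auto simp: eq_Q)

lemma lub_cls:
  assumes "x \<in> carrier L" "y \<in> carrier L"
  shows "least Q (cls (x \<squnion> y)) (Upper Q {cls x, cls y})"
proof (rule least_UpperI)
  interpret Q: partial_order Q by (rule partial_order_Q)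
  show "cls (x \<squnion> y) \<in> carrier Q" "{cls x, cls y} \<subseteq> carrier Q" using assms by auto
  show "le Q Z (cls (x \<squnion> y))" if "Z \<in> {cls x, cls y}" for Z
    using that assms by (auto intro!: cls_mono)
  show "le Q (cls (x \<squnion> y)) Z" if "Z \<in> Upper Q {cls x, cls y}" for Z
  proof -
    from that have Z: "Z \<in> carrier Q" "le Q (cls x) Z" "le Q (cls y) Z"
      using assms by (auto simp: Upper_def)
    then obtain z where z: "z \<in> carrier L" "Z = cls z" using Q_cases by metis
    then have "(x \<squnion> z, z) \<in> \<alpha>" "(y \<squnion> z, z) \<in> \<alpha>" using Z le_cls_iff assms by auto
    then have "((x \<squnion> z) \<squnion> (y \<squnion> z), z \<squnion> z) \<in> \<alpha>" using rel_join by blast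
    moreover have "(x \<squnion> z) \<squnion> (y \<squnion> z) = x \<squnion> y \<squnion> z" "z \<squnion> z = z"
      using assms z by (auto intro!: le_antisym simp: le_joinI)
    ultimately show ?thesis using le_cls_iff[of "x \<squnion> y" z] z assms by auto
  qed
qed

lemma glb_cls:
  assumes "x \<in> carrier L" "y \<in> carrier L"
  shows "greatest Q (cls (x \<sqinter> y)) (Lower Q {cls x, cls y})"
proof (rule greatest_LowerI)
  interpret Q: partial_order Q by (rule partial_order_Q)
  show "cls (x \<sqinter> y) \<in> carrier Q" "{cls x, cls y} \<subseteq> carrier Q" using assms by auto
  show "le Q (cls (x \<sqinter> y)) Z" if "Z \<in> {cls x, cls y}" for Z
    using that assms by (auto intro!: cls_mono)
  show "le Q Z (cls (x \<sqinter> y))" if "Z \<in> Lower Q {cls x, cls y}" for Z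
  proof -
    from that have Z: "Z \<in> carrier Q" "le Q Z (cls x)" "le Q Z (cls y)"
      using assms by (auto simp: Lower_def)
    then obtain z where z: "z \<in> carrier L" "Z = cls z" using Q_cases by metis
    then have "(z \<sqinter> x, z) \<in> \<alpha>" "(z \<sqinter> y, z) \<in> \<alpha>" using Z le_cls_iff_meet assms by auto
    then have "((z \<sqinter> x) \<sqinter> (z \<sqinter> y), z \<sqinter> z) \<in> \<alpha>" using rel_meet by blast
    moreover have "(z \<sqinter> x) \<sqinter> (z \<sqinter> y) = z \<sqinter> (x \<sqinter> y)" "z \<sqinter> z = z"
      using assms z by (auto intro!: le_antisym simp: meet_leI)
    ultimately show ?thesis using le_cls_iff_meet[of z "x \<sqinter> y"] z assms by auto
  qed
qed

lemma lattice_Q: "lattice Q"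
proof -
  interpret Q: partial_order Q by (rule partial_order_Q)
  show ?thesis
  proof
    fix X Y assume XY: "X \<in> carrier Q" "Y \<in> carrier Q"
    then obtain x y where "x \<in> carrier L" "X = cls x" "y \<in> carrier L" "Y = cls y"
      using Q_cases by metis
    then show "\<exists>s. least Q s (Upper Q {X, Y})" "\<exists>s. greatest Q s (Lower Q {X, Y})"
      using lub_cls glb_cls by blast+
  qed
qed

lemma fin_lattice_Q: "fin_lattice Q"
proof -
  interpret Q: lattice Q by (rule lattice_Q)
  show ?thesis by unfold_locales (use fin nonempty carrier_Q in auto)
qed

lemma join_Q: 
  assumes "x \<in> carrier L" "y \<in> carrier L" shows "cls x \<squnion>\<^bsub>Q\<^esub> cls y = cls (x \<squnion> y)"
proof -
  interpret Q: lattice Q by (rule lattice_Q)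
  have "least Q (cls x \<squnion>\<^bsub>Q\<^esub> cls y) (Upper Q {cls x, cls y})"
    using Q.sup_of_two_least[of "cls x" "cls y"] assms by (simp add: join_def)
  then show ?thesis using lub_cls[OF assms] Q.least_unique by blast
qed

lemma meet_Q: 
  assumes "x \<in> carrier L" "y \<in> carrier L" shows "cls x \<sqinter>\<^bsub>Q\<^esub> cls y = cls (x \<sqinter> y)"
proof -
  interpret Q: lattice Q by (rule lattice_Q)
  have "greatest Q (cls x \<sqinter>\<^bsub>Q\<^esub> cls y) (Lower Q {cls x, cls y})"
    using Q.inf_of_two_greatest[of "cls x" "cls y"] assms by (simp add: meet_def)
  then show ?thesis using glb_cls[OF assms] Q.greatest_unique by blast
qed

text \<open>The elements of \<open>L\<close> that the vertices of the quotient diagram stand for.\<close>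
definition is_top where "is_top t \<longleftrightarrow> greatest L t (cls t)"

lemma is_top_iff: "t \<in> carrier L \<Longrightarrow> is_top t \<longleftrightarrow> (\<forall>y. (t, y) \<in> \<alpha> \<longrightarrow> y \<sqsubseteq> t)"
  unfolding is_top_def greatest_def using rel_carrier rel_refl by auto

lemma is_top_carrier: "is_top t \<Longrightarrow> t \<in> carrier L"
  unfolding is_top_def greatest_def using rel_carrier by blast

lemma top_exists:
  assumes "x \<in> carrier L"
  obtains t where "is_top t" "(x, t) \<in> \<alpha>"
proof -
  obtain t where t: "t \<in> cls x" and max: "\<And>y. y \<in> cls x \<Longrightarrow> t \<sqsubseteq> y \<Longrightarrow> y = t"
    by (rule maximal_elem[of "cls x"]) (use rel_carrier rel_refl[OF assms] in auto)
  have tc: "t \<in> carrier L" using t rel_carrier by auto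
  have "y \<sqsubseteq> t" if "(t, y) \<in> \<alpha>" for y
  proof -
    have y: "y \<in> carrier L" using that rel_carrier by auto
    have "t \<squnion> t = t" using tc by (intro le_antisym) auto
    then have "(t, t \<squnion> y) \<in> \<alpha>" using rel_join[OF rel_refl[OF tc] that] by auto
    then have "t \<squnion> y = t" using max[of "t \<squnion> y"] t tc y rel_trans by auto
    then show ?thesis using tc y join_right by metis
  qed
  then show thesis using that[of t] t tc is_top_iff by auto
qed

lemma le_tops:
  assumes "x \<in> carrier L" "is_top t"
  shows "le Q (cls x) (cls t) \<longleftrightarrow> x \<sqsubseteq> t"
proof
  have tc: "t \<in> carrier L" using is_top_carrier assms by auto
  assume "le Q (cls x) (cls t)"
  then have "(t, x \<squnion> t) \<in> \<alpha>" using le_cls_iff rel_sym assms tc by auto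
  then have "x \<squnion> t \<sqsubseteq> t" using is_top_iff tc assms by blast
  then show "x \<sqsubseteq> t" using assms tc by simp
next
  show "x \<sqsubseteq> t \<Longrightarrow> le Q (cls x) (cls t)" using cls_mono assms is_top_carrier by auto
qed

lemma tops_eq: "is_top t \<Longrightarrow> is_top t' \<Longrightarrow> cls t = cls t' \<Longrightarrow> t = t'"
  using le_tops[of t t'] le_tops[of t' t] cls_mono[of t t] is_top_carrier
  by (metis le_antisym le_refl)

text \<open>An element \<open>z\<close> whose block lies between those of \<open>x\<close> and \<open>y\<close> can be moved into the interval from \<open>x\<close> to \<open>y\<close>,
as \<open>(x \<squnion> z) \<sqinter> y\<close>, without leaving its block.\<close>
lemma cover_cls:
  assumes "covered_by L x y" shows "cls x = cls y \<or> covered_by Q (cls x) (cls y)"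
proof (rule disjCI)
  interpret Q: fin_lattice Q by (rule fin_lattice_Q)
  note c = coverD[OF assms]
  assume n: "\<not> covered_by Q (cls x) (cls y)"
  show "cls x = cls y"
  proof (rule ccontr)
    assume ne: "cls x \<noteq> cls y"
    have le: "le Q (cls x) (cls y)" using cls_mono c by auto
    obtain Z where Z: "Z \<in> carrier Q" "le Q (cls x) Z" "cls x \<noteq> Z" "le Q Z (cls y)" "Z \<noteq> cls y"
      using n ne le c unfolding covered_by_def Q.lless_eq by auto
    obtain z where z: "z \<in> carrier L" "Z = cls z" using Z Q_cases by metis
    have "(x \<squnion> z, z) \<in> \<alpha>" "(z \<sqinter> y, z) \<in> \<alpha>" using le_cls_iff le_cls_iff_meet Z z c by auto
    then have "((x \<squnion> z) \<sqinter> y, z) \<in> \<alpha>" using rel_meet[OF _ rel_refl[OF c(2)]] rel_trans by blast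
    moreover have "(x \<squnion> z) \<sqinter> y = x \<or> (x \<squnion> z) \<sqinter> y = y"
      by (rule cover_between[OF assms]) (use c z in auto)
    ultimately show False using Z z c cls_eq_iff by metis
  qed
qed

text \<open>A cover \<open>y\<close> of the largest element \<open>t\<close> of a block lies outside that block, so its block is strictly
above; if \<open>y\<close> is chosen below a representative of \<open>Y\<close>, it represents \<open>Y\<close>. This transfers
semimodularity to the quotient.\<close>
lemma cover_from_top:
  assumes "is_top t" "covered_by Q (cls t) Y"
  obtains y where "covered_by L t y" "Y = cls y"
proof -
  interpret Q: fin_lattice Q by (rule fin_lattice_Q)
  have tc: "t \<in> carrier L" using is_top_carrier assms by auto
  note C = Q.coverD[OF assms(2)]
  obtain w where w: "w \<in> carrier L" "Y = cls w" using C Q_cases by metis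
  have "(t \<squnion> w, w) \<in> \<alpha>" using C w le_cls_iff tc by auto
  then have Yw: "Y = cls (t \<squnion> w)" using w tc cls_eq_iff rel_sym by auto
  then have "t \<noteq> t \<squnion> w" using C(4) by metis
  then have "t \<sqsubset> t \<squnion> w" using tc w by (simp add: lless_eq)
  then obtain y where y: "covered_by L t y" "y \<sqsubseteq> t \<squnion> w" using upper_cover_exists tc w
    by (metis join_closed)
  note c = coverD[OF y(1)]
  have "cls y \<noteq> cls t" using is_top_iff[OF tc] assms(1) c cls_eq_iff le_antisym by (metis rel_sym)
  then have "cls y = Y"
    using Q.cover_between[OF assms(2), of "cls y"] cls_mono[of t y] cls_mono[of y "t \<squnion> w"] c y tc w Yw by auto
  then show thesis using that y by auto
qed

lemma frame_Q: "rectangular_frame Q (cls a) (cls b)"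
proof -
  interpret Q: fin_lattice Q by (rule fin_lattice_Q)
  have bot: "\<bottom>\<^bsub>Q\<^esub> = cls \<bottom>"
    by (rule Q.bottom_eq[symmetric]) (auto simp: carrier_Q intro: cls_mono)
  have top: "\<top>\<^bsub>Q\<^esub> = cls \<top>"
    by (rule Q.top_eq[symmetric]) (auto simp: carrier_Q intro: cls_mono)
  have below: "\<exists>x'. x' \<in> carrier L \<and> x' \<sqsubseteq> c \<and> X = cls x'"
    if X: "X \<in> carrier Q" "le Q X (cls c)" "c \<in> carrier L" for X c
  proof -
    obtain x where x: "x \<in> carrier L" "X = cls x" by (rule Q_cases[OF X(1)])
    then have "cls (x \<sqinter> c) = cls x" using that le_cls_iff_meet cls_eq_iff by auto
    then show ?thesis using x that by (intro exI[of _ "x \<sqinter> c"]) auto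
  qed
  have above: "\<exists>x'. x' \<in> carrier L \<and> c \<sqsubseteq> x' \<and> X = cls x'"
    if X: "X \<in> carrier Q" "le Q (cls c) X" "c \<in> carrier L" for X c
  proof -
    obtain x where x: "x \<in> carrier L" "X = cls x" by (rule Q_cases[OF X(1)])
    then have "cls (c \<squnion> x) = cls x" using that le_cls_iff cls_eq_iff by auto
    then show ?thesis using x that by (intro exI[of _ "c \<squnion> x"]) auto
  qed
  show ?thesis
  proof unfold_locales
    show "cls a \<in> carrier Q" "cls b \<in> carrier Q" by auto
    show "cls a \<sqinter>\<^bsub>Q\<^esub> cls b = \<bottom>\<^bsub>Q\<^esub>" "cls a \<squnion>\<^bsub>Q\<^esub> cls b = \<top>\<^bsub>Q\<^esub>"
      by (auto simp: meet_Q join_Q meet_ab join_ab bot top)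
    show "X \<squnion>\<^bsub>Q\<^esub> Z = Y \<squnion>\<^bsub>Q\<^esub> Z \<or> covered_by Q (X \<squnion>\<^bsub>Q\<^esub> Z) (Y \<squnion>\<^bsub>Q\<^esub> Z)"
      if XYZ: "covered_by Q X Y" "Z \<in> carrier Q" for X Y Z
    proof -
      note C = Q.coverD[OF XYZ(1)]
      obtain x z where xz: "x \<in> carrier L" "X = cls x" "z \<in> carrier L" "Z = cls z"
        using Q_cases[OF C(1)] Q_cases[OF XYZ(2)] by metis
      obtain t where t: "is_top t" "(x, t) \<in> \<alpha>" using top_exists xz by metis
      then have X: "X = cls t" using xz cls_eq_iff is_top_carrier by auto
      obtain y where y: "covered_by L t y" "Y = cls y" using cover_from_top t XYZ(1) X by metis
      note c = coverD[OF y(1)]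
      show ?thesis using semimod[OF y(1) xz(3)] cover_cls[of "t \<squnion> z" "y \<squnion> z"] X y xz c by (auto simp: join_Q)
    qed
    show "le Q X Y \<or> le Q Y X" if XY: "X \<in> carrier Q" "Y \<in> carrier Q" "le Q X (cls a)" "le Q Y (cls a)" for X Y
      using below[OF XY(1,3)] below[OF XY(2,4)] down_a cls_mono a_in by metis
    show "le Q X Y \<or> le Q Y X" if XY: "X \<in> carrier Q" "Y \<in> carrier Q" "le Q X (cls b)" "le Q Y (cls b)" for X Y
      using below[OF XY(1,3)] below[OF XY(2,4)] down_b cls_mono b_in by metis
    show "le Q X Y \<or> le Q Y X" if XY: "X \<in> carrier Q" "Y \<in> carrier Q" "le Q (cls a) X" "le Q (cls a) Y" for X Y
      using above[OF XY(1,3)] above[OF XY(2,4)] up_a cls_mono a_in by metis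
    show "le Q X Y \<or> le Q Y X" if XY: "X \<in> carrier Q" "Y \<in> carrier Q" "le Q (cls b) X" "le Q (cls b) Y" for X Y
      using above[OF XY(1,3)] above[OF XY(2,4)] up_b cls_mono b_in by metis
    show "(X \<sqinter>\<^bsub>Q\<^esub> cls a) \<squnion>\<^bsub>Q\<^esub> (X \<sqinter>\<^bsub>Q\<^esub> cls b) = X" if "X \<in> carrier Q" for X
      using that span by (auto simp: carrier_Q join_Q meet_Q)
  qed
qed

definition top_of where "top_of X = (THE t. is_top t \<and> X = cls t)"

lemma top_of: "X \<in> carrier Q \<Longrightarrow> is_top (top_of X) \<and> X = cls (top_of X)"
proof -
  assume "X \<in> carrier Q"
  then obtain x where x: "x \<in> carrier L" "X = cls x" using Q_cases by metis
  obtain t where t: "is_top t" "(x, t) \<in> \<alpha>" using top_exists[OF x(1)] .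
  then have X: "X = cls t" using x cls_eq_iff is_top_carrier by auto
  have "top_of X = t"
    unfolding top_of_def
  proof (rule the_equality)
    show "is_top t \<and> X = cls t" using t(1) X by blast
    show "u = t" if u: "is_top u \<and> X = cls u" for u
    proof (rule tops_eq)
      show "cls u = cls t" by (rule HOL.trans[OF HOL.sym[OF conjunct2[OF u]] X])
    qed (use u t(1) in blast)+
  qed
  then show "is_top (top_of X) \<and> X = cls (top_of X)" using t(1) X by blast
qed

lemma top_of_carrier: "X \<in> carrier Q \<Longrightarrow> top_of X \<in> carrier L"
  using top_of is_top_carrier by blast

lemma top_of_cls: "is_top t \<Longrightarrow> top_of (cls t) = t"
  using top_of[of "cls t"] tops_eq is_top_carrier by (metis cls_carrier)

text \<open>Taking parts commutes with passing to block tops: if \<open>u\<close> is the largest element of the block of \<open>t \<sqinter> c\<close>,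
then \<open>u \<sqinter> c\<close> is in that block, too, so joining it to the block top \<open>t\<close> stays in the block of \<open>t\<close>.\<close>
lemma top_of_meet:
  assumes "X \<in> carrier Q" "c \<in> carrier L"
  shows "top_of (X \<sqinter>\<^bsub>Q\<^esub> cls c) \<sqinter> c = top_of X \<sqinter> c"
proof -
  define t where "t = top_of X"
  have t: "is_top t" "X = cls t" "t \<in> carrier L"
    using top_of[OF assms(1)] top_of_carrier[OF assms(1)] by (auto simp: t_def)
  define u where "u = top_of (cls (t \<sqinter> c))"
  have tc: "t \<sqinter> c \<in> carrier L" using t assms by simp
  have u: "is_top u" "cls (t \<sqinter> c) = cls u" "u \<in> carrier L"
    using top_of[OF cls_carrier[OF tc]] top_of_carrier[OF cls_carrier[OF tc]] by (auto simp: u_def)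
  have ge: "t \<sqinter> c \<sqsubseteq> u" using le_tops[OF tc u(1)] cls_mono[OF tc tc] u(2) tc by auto
  have "(u, t \<sqinter> c) \<in> \<alpha>" using u tc cls_eq_iff rel_sym by auto
  then have "(u \<sqinter> c, (t \<sqinter> c) \<sqinter> c) \<in> \<alpha>" using rel_meet rel_refl[OF assms(2)] by blast
  moreover have "(t \<sqinter> c) \<sqinter> c = t \<sqinter> c" using meet_absorb1[OF tc assms(2)] t assms by simp
  ultimately have "(t \<squnion> (u \<sqinter> c), t \<squnion> (t \<sqinter> c)) \<in> \<alpha>" using rel_join[OF rel_refl[OF t(3)]] by metis
  moreover have "t \<squnion> (t \<sqinter> c) = t" using t tc by (intro le_antisym) (use assms in auto)
  ultimately have "t \<squnion> (u \<sqinter> c) \<sqsubseteq> t" using is_top_iff t rel_sym by metis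
  then have "u \<sqinter> c \<sqsubseteq> t \<sqinter> c" using t u assms by simp
  moreover have "t \<sqinter> c \<sqsubseteq> u \<sqinter> c" using ge t u assms by simp
  ultimately have "u \<sqinter> c = t \<sqinter> c" using t u assms by (intro le_antisym) auto
  then show ?thesis unfolding t_def[symmetric] t(2) meet_Q[OF t(3) assms(2)] u_def[symmetric]
    using top_of_cls[OF t(1)] by simp
qed

lemma part_mono:
  assumes X: "X \<in> carrier Q" "Y \<in> carrier Q" "X \<sqsubset>\<^bsub>Q\<^esub> Y" "le Q Y (cls c)" "c \<in> carrier L"
  shows "top_of X \<sqinter> c \<sqsubset> top_of Y \<sqinter> c"
proof -
  interpret Q: fin_lattice Q by (rule fin_lattice_Q)
  define t u where "t = top_of X" and "u = top_of Y"
  have t: "is_top t" "X = cls t" "t \<in> carrier L" and u: "is_top u" "Y = cls u" "u \<in> carrier L"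
    using top_of[OF X(1)] top_of_carrier[OF X(1)] top_of[OF X(2)] top_of_carrier[OF X(2)]
    by (auto simp: t_def u_def)
  have XY: "le Q X Y" "X \<noteq> Y" using X(3) by (auto simp: Q.lless_eq)
  have "t \<sqsubseteq> u" using le_tops[OF t(3) u(1)] XY t u by auto
  then have le: "t \<sqinter> c \<sqsubseteq> u \<sqinter> c" using t u X(5) le_trans[of "t \<sqinter> c" t u] by auto
  have Xc: "le Q X (cls c)" using Q.le_trans[OF XY(1) X(4)] X by auto
  have "cls (t \<sqinter> c) = X" "cls (u \<sqinter> c) = Y"
    using le_cls_iff_meet[of t c] le_cls_iff_meet[of u c] Xc X(4,5) t u cls_eq_iff by auto
  then have "t \<sqinter> c \<noteq> u \<sqinter> c" using XY by auto
  then show ?thesis using le by (simp add: lless_eq t_def u_def)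
qed

end

section \<open>Segments and slanted coordinates in the plane\<close>

text \<open>For \<open>s = 1\<close> or \<open>s = - 1\<close> the level lines of \<open>slant s\<close> are parallel to \<open>(1, s)\<close>. So the two values \<open>slant s z\<close> and \<open>slant (- s) z\<close> are
the coordinates of \<open>z\<close>, up to scaling, in the system of axes spanned by the two normal slopes; their sum is
twice the height of \<open>z\<close>.\<close>
definition slant :: "real \<Rightarrow> real \<times> real \<Rightarrow> real" where
  "slant s z = snd z - s * fst z"

lemma slant_on_segment: "slant r ((1 - t) *\<^sub>R p + t *\<^sub>R q) = slant r p + t * (slant r q - slant r p)"
  by (simp add: slant_def algebra_simps)

lemma slant_height: "slant s z + slant (- s) z = 2 * snd z"
  by (simp add: slant_def)

lemma slant_eqI:
  assumes "s = 1 \<or> s = - 1" "slant s z = slant s w" "slant (- s) z = slant (- s) w" shows "z = w"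
  using assms by (auto simp: slant_def prod_eq_iff)

lemma in_segmentI: "0 \<le> t \<Longrightarrow> t \<le> 1 \<Longrightarrow> (1 - t) *\<^sub>R p + t *\<^sub>R q \<in> closed_segment p q"
  unfolding in_segment by blast

lemma segment_at_height:
  assumes "snd p < snd q" "snd p < h" "h < snd (q :: real \<times> real)"
  obtains z where "z \<in> open_segment p q" "snd z = h"
proof -
  define t where "t = (h - snd p) / (snd q - snd p)"
  have t: "0 < t" "t < 1" using assms by (auto simp: t_def field_simps)
  define z where "z = (1 - t) *\<^sub>R p + t *\<^sub>R q"
  have "snd z = snd p + t * (snd q - snd p)" by (simp add: z_def algebra_simps)
  then have h: "snd z = h" using assms by (simp add: t_def)
  have "z \<in> closed_segment p q" unfolding z_def using t by (intro in_segmentI) auto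
  moreover have "z \<noteq> p" "z \<noteq> q" using h assms by auto
  ultimately show thesis using that h by (auto simp: open_segment_def)
qed

lemma segment_height_bounds:
  assumes "snd p < snd q" "z \<in> closed_segment p q"
  shows "snd p \<le> snd z" "snd z \<le> snd (q :: real \<times> real)"
proof -
  obtain t where t: "0 \<le> t" "t \<le> 1" "z = (1 - t) *\<^sub>R p + t *\<^sub>R q" using assms by (auto simp: in_segment)
  have z: "snd z = snd p + t * (snd q - snd p)" by (simp add: t algebra_simps)
  have "0 \<le> t * (snd q - snd p)" "t * (snd q - snd p) \<le> snd q - snd p"
    using t assms by (auto intro: mult_left_le_one_le)
  then show "snd p \<le> snd z" "snd z \<le> snd q" unfolding z by auto
qed

lemma segment_height_unique:
  assumes "snd p < snd q" "z \<in> closed_segment p q" "w \<in> closed_segment p q" "snd z = snd (w :: real \<times> real)"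
  shows "z = w"
proof -
  obtain t where t: "z = (1 - t) *\<^sub>R p + t *\<^sub>R q" using assms by (auto simp: in_segment)
  obtain u where u: "w = (1 - u) *\<^sub>R p + u *\<^sub>R q" using assms by (auto simp: in_segment)
  have "snd p + t * (snd q - snd p) = snd p + u * (snd q - snd p)"
    using assms(4) unfolding t u by (simp add: algebra_simps)
  then show ?thesis using assms(1) t u by simp
qed

lemma in_segment_same_slant:
  assumes s: "s = 1 \<or> s = - 1" and u: "slant s p = slant s q" "slant s z = slant s q"
    and h: "snd p \<le> snd z" "snd z \<le> snd q" "snd p < snd q"
  shows "z \<in> closed_segment p q"
proof -
  define t where "t = (snd z - snd p) / (snd q - snd p)"
  have t: "0 \<le> t" "t \<le> 1" using h by (auto simp: t_def field_simps)
  have tt: "t * (snd q - snd p) = snd z - snd p" using h by (simp add: t_def)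
  have "slant s z = slant s ((1 - t) *\<^sub>R p + t *\<^sub>R q)" unfolding slant_on_segment using u by simp
  moreover have "slant (- s) z = slant (- s) ((1 - t) *\<^sub>R p + t *\<^sub>R q)"
  proof -
    have "slant (- s) q - slant (- s) p = 2 * (snd q - snd p)" "slant (- s) z - slant (- s) p = 2 * (snd z - snd p)"
      using u unfolding slant_def by simp_all
    then have "t * (slant (- s) q - slant (- s) p) = slant (- s) z - slant (- s) p"
      using tt by (metis mult.left_commute)
    then show ?thesis unfolding slant_on_segment by simp
  qed
  ultimately have "z = (1 - t) *\<^sub>R p + t *\<^sub>R q" by (rule slant_eqI[OF s])
  then show ?thesis using t in_segmentI by simp
qed

lemma continuous_slant [continuous_intros]: "continuous_on S (slant r)"
  unfolding slant_def by (intro continuous_intros)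

section \<open>Diagrams as placements of the lattice elements\<close>

text \<open>The following notions describe a diagram through the positions \<open>P x\<close> of the lattice elements \<open>x\<close>,
without reference to the vertices of the drawing.\<close>
definition drawn_elems :: "('a, 'b) gorder_scheme \<Rightarrow> ('a \<Rightarrow> real \<times> real) \<Rightarrow> 'a set \<Rightarrow> (real \<times> real) set" where
  "drawn_elems L P X =
     P ` X \<union> (\<Union>(x, y)\<in>{(x, y). x \<in> X \<and> y \<in> X \<and> covered_by L x y}. closed_segment (P x) (P y))"

definition draws :: "('a, 'b) gorder_scheme \<Rightarrow> ('v, 'a) drawing \<Rightarrow> ('a \<Rightarrow> real \<times> real) \<Rightarrow> bool" where
  "draws L F P \<longleftrightarrow> bij_betw (elem F) (vertices F) (carrier L) \<and>
     edges F = {(p, q). p \<in> vertices F \<and> q \<in> vertices F \<and> covered_by L (elem F p) (elem F q)} \<and>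
     (\<forall>v\<in>vertices F. pos F v = P (elem F v))"

text \<open>For \<open>s = 1\<close> these are the left and for \<open>s = - 1\<close> the right boundary chains, so that a reflection of
the diagram amounts to a change of the sign \<open>s\<close>.\<close>
definition side_chain :: "('a, 'b) gorder_scheme \<Rightarrow> ('a \<Rightarrow> real \<times> real) \<Rightarrow> real \<Rightarrow> 'a set \<Rightarrow> bool" where
  "side_chain L P s C \<longleftrightarrow> pred_on.maxchain (carrier L) (le L) C \<and>
     (\<forall>z\<in>drawn_elems L P (carrier L). \<forall>c\<in>drawn_elems L P C. snd z = snd c \<longrightarrow> s * fst c \<le> s * fst z)"

definition on_boundary :: "('a, 'b) gorder_scheme \<Rightarrow> ('a \<Rightarrow> real \<times> real) \<Rightarrow> 'a \<Rightarrow> bool" where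
  "on_boundary L P x \<longleftrightarrow> (\<exists>C. x \<in> C \<and> (side_chain L P 1 C \<or> side_chain L P (- 1) C))"

locale planar_placement = fin_lattice L for L (structure) +
  fixes P :: "'a \<Rightarrow> real \<times> real"
  assumes inj_P: "inj_on P (carrier L)"
    and up: "covered_by L x y \<Longrightarrow> snd (P x) < snd (P y)"
    and avoid: "covered_by L x y \<Longrightarrow> w \<in> carrier L \<Longrightarrow> P w \<in> closed_segment (P x) (P y) \<Longrightarrow> w = x \<or> w = y"
    and planar: "covered_by L x y \<Longrightarrow> covered_by L x' y' \<Longrightarrow> (x, y) \<noteq> (x', y') \<Longrightarrow>
        closed_segment (P x) (P y) \<inter> closed_segment (P x') (P y') \<subseteq> {P x, P y} \<inter> {P x', P y'}"

lemma drawn_eq_drawn_elems: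
  assumes "draws L F P" "W \<subseteq> vertices F"
  shows "drawn F W = drawn_elems L P (elem F ` W)"
proof -
  have pos: "\<And>v. v \<in> W \<Longrightarrow> pos F v = P (elem F v)" using assms by (auto simp: draws_def)
  have ed: "edges F \<inter> W \<times> W = {(p, q). p \<in> W \<and> q \<in> W \<and> covered_by L (elem F p) (elem F q)}"
    using assms by (auto simp: draws_def)
  have "(\<Union>e\<in>edges F \<inter> W \<times> W. edge_segment F e) =
    (\<Union>(x, y)\<in>{(x, y). x \<in> elem F ` W \<and> y \<in> elem F ` W \<and> covered_by L x y}. closed_segment (P x) (P y))"
    unfolding ed edge_segment_def using pos by fastforce
  then show ?thesis unfolding drawn_def drawn_elems_def using pos by force
qed

lemma drawn_elems_cases:
  assumes "z \<in> drawn_elems L P X"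
  obtains x y where "x \<in> X" "y \<in> X" "x = y \<or> covered_by L x y" "z \<in> closed_segment (P x) (P y)"
proof -
  from assms have "(\<exists>x\<in>X. z = P x) \<or> (\<exists>x\<in>X. \<exists>y\<in>X. covered_by L x y \<and> z \<in> closed_segment (P x) (P y))"
    unfolding drawn_elems_def by blast
  then show thesis using that by (metis ends_in_segment(1))
qed

lemma draws_elem_image: "draws L F P \<Longrightarrow> elem F ` vertices F = carrier L"
  by (auto simp: draws_def bij_betw_def)

lemma boundary_iff:
  assumes "draws L F P" "v \<in> vertices F"
  shows "v \<in> boundary L F \<longleftrightarrow> on_boundary L P (elem F v)"
proof -
  have img: "elem F ` vertices F = carrier L" and inj: "inj_on (elem F) (vertices F)"
    using assms by (auto simp: draws_def bij_betw_def)
  have l: "left_boundary_chain L F C \<longleftrightarrow> C \<subseteq> vertices F \<and> side_chain L P 1 (elem F ` C)" for C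
    using drawn_eq_drawn_elems[OF assms(1), of C] drawn_eq_drawn_elems[OF assms(1), of "vertices F"] img
    by (cases "C \<subseteq> vertices F") (simp_all add: left_boundary_chain_def side_chain_def)
  have r: "right_boundary_chain L F C \<longleftrightarrow> C \<subseteq> vertices F \<and> side_chain L P (- 1) (elem F ` C)" for C
    using drawn_eq_drawn_elems[OF assms(1), of C] drawn_eq_drawn_elems[OF assms(1), of "vertices F"] img
    by (cases "C \<subseteq> vertices F") (simp_all add: right_boundary_chain_def side_chain_def)
  show ?thesis
  proof
    assume "v \<in> boundary L F"
    then show "on_boundary L P (elem F v)"
      unfolding boundary_def on_boundary_def using l r by blast
  next
    assume "on_boundary L P (elem F v)"
    then obtain C where C: "elem F v \<in> C" "side_chain L P 1 C \<or> side_chain L P (- 1) C"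
      by (auto simp: on_boundary_def)
    have "C \<subseteq> carrier L"
      using C(2) by (auto simp: side_chain_def pred_on.maxchain_def pred_on.chain_def)
    then have eq: "elem F ` {u \<in> vertices F. elem F u \<in> C} = C" using img by auto
    have "left_boundary_chain L F {u \<in> vertices F. elem F u \<in> C} \<or>
      right_boundary_chain L F {u \<in> vertices F. elem F u \<in> C}"
      unfolding l r eq using C(2) by auto
    then show "v \<in> boundary L F" unfolding boundary_def using C(1) assms(2) by blast
  qed
qed

lemma draws_edge_elems:
  assumes "draws L F P" "covered_by L x y"
  obtains p q where "(p, q) \<in> edges F" "p \<in> vertices F" "q \<in> vertices F" "elem F p = x" "elem F q = y"
    "pos F p = P x" "pos F q = P y"
proof -
  have "x \<in> elem F ` vertices F" "y \<in> elem F ` vertices F"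
    using assms(2) draws_elem_image[OF assms(1)] by (simp_all add: covered_by_def)
  then obtain p q where "p \<in> vertices F" "q \<in> vertices F" "elem F p = x" "elem F q = y" by auto
  then show thesis using that[of p q] assms by (auto simp: draws_def)
qed

lemma planar_diagram_iff:
  assumes "fin_lattice L" "draws L F P"
  shows "planar_diagram L F \<longleftrightarrow> planar_placement L P"
proof -
  interpret fin_lattice L by fact
  have bij: "bij_betw (elem F) (vertices F) (carrier L)"
    and E: "edges F = {(p, q). p \<in> vertices F \<and> q \<in> vertices F \<and> covered_by L (elem F p) (elem F q)}"
    and pos: "\<And>v. v \<in> vertices F \<Longrightarrow> pos F v = P (elem F v)"
    using assms(2) by (auto simp: draws_def)
  have img: "elem F ` vertices F = carrier L" and inj: "inj_on (elem F) (vertices F)"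
    using bij by (auto simp: bij_betw_def)
  show ?thesis
  proof
    assume *: "planar_diagram L F"
    then have h: "hasse_diagram L F" by (simp add: planar_diagram_def)
    show "planar_placement L P"
    proof
      have "inj_on (pos F) (vertices F)" using h by (simp add: hasse_diagram_def)
      then have "inj_on (P \<circ> elem F) (vertices F)" using pos by (auto simp: inj_on_def)
      then show "inj_on P (carrier L)" using inj_on_imageI img by metis
    next
      fix x y assume xy: "covered_by L x y"
      then obtain p q where pq: "(p, q) \<in> edges F" "p \<in> vertices F" "q \<in> vertices F" "elem F p = x" "elem F q = y"
        "pos F p = P x" "pos F q = P y" using draws_edge_elems[OF assms(2)] by metis
      have "snd (pos F p) < snd (pos F q)" using h pq(1) unfolding hasse_diagram_def by blast
      then show "snd (P x) < snd (P y)" using pq by simp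
      fix w assume w: "w \<in> carrier L" "P w \<in> closed_segment (P x) (P y)"
      then have "w \<in> elem F ` vertices F" using img by simp
      then obtain v where v: "v \<in> vertices F" "elem F v = w" by auto
      have "pos F v \<in> edge_segment F (p, q)" using v w pq pos by (simp add: edge_segment_def)
      then have "v = p \<or> v = q" using h pq v unfolding hasse_diagram_def by blast
      then show "w = x \<or> w = y" using v pq by auto
    next
      fix x y x' y'
      assume xy: "covered_by L x y" "covered_by L x' y'" "(x, y) \<noteq> (x', y')"
      obtain p q where pq: "(p, q) \<in> edges F" "p \<in> vertices F" "q \<in> vertices F" "elem F p = x" "elem F q = y"
        "pos F p = P x" "pos F q = P y" using draws_edge_elems[OF assms(2) xy(1)] by metis
      obtain p' q' where pq': "(p', q') \<in> edges F" "p' \<in> vertices F" "q' \<in> vertices F" "elem F p' = x'" "elem F q' = y'"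
        "pos F p' = P x'" "pos F q' = P y'" using draws_edge_elems[OF assms(2) xy(2)] by metis
      have "(p, q) \<noteq> (p', q')" using xy pq pq' by auto
      then have "edge_segment F (p, q) \<inter> edge_segment F (p', q') \<subseteq>
          {pos F (fst (p, q)), pos F (snd (p, q))} \<inter> {pos F (fst (p', q')), pos F (snd (p', q'))}"
        using * pq pq' unfolding planar_diagram_def by blast
      then show "closed_segment (P x) (P y) \<inter> closed_segment (P x') (P y') \<subseteq> {P x, P y} \<inter> {P x', P y'}"
        using pq pq' by (simp add: edge_segment_def)
    qed
  next
    assume "planar_placement L P"
    then interpret planar_placement L P .
    have seg: "edge_segment F (p, q) = closed_segment (P (elem F p)) (P (elem F q))"
      if "(p, q) \<in> edges F" for p q using that E pos by (auto simp: edge_segment_def)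
    have Ed: "p \<in> vertices F \<and> q \<in> vertices F \<and> covered_by L (elem F p) (elem F q)"
      if "(p, q) \<in> edges F" for p q using that E by auto
    have "inj_on (pos F) (vertices F)"
      using inj_P img inj pos unfolding inj_on_def by (metis image_eqI)
    moreover have "snd (pos F p) < snd (pos F q)" if "(p, q) \<in> edges F" for p q
      using up Ed[OF that] pos by auto
    moreover have "w = p \<or> w = q"
      if "(p, q) \<in> edges F" "w \<in> vertices F" "pos F w \<in> edge_segment F (p, q)" for p q w
    proof -
      have "elem F w \<in> carrier L" using img that(2) by blast
      then have "elem F w = elem F p \<or> elem F w = elem F q"
        using avoid[of "elem F p" "elem F q" "elem F w"] Ed[OF that(1)] that(2,3) seg[OF that(1)] pos img by auto
      then show ?thesis using inj Ed[OF that(1)] that(2) by (auto dest: inj_onD)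
    qed
    ultimately have "hasse_diagram L F" unfolding hasse_diagram_def using bij E by blast
    moreover have "edge_segment F e \<inter> edge_segment F e' \<subseteq>
          {pos F (fst e), pos F (snd e)} \<inter> {pos F (fst e'), pos F (snd e')}"
      if e: "e \<in> edges F" "e' \<in> edges F" "e \<noteq> e'" for e e'
    proof -
      obtain p q p' q' where pq: "e = (p, q)" "e' = (p', q')" by (metis surj_pair)
      have "(elem F p, elem F q) \<noteq> (elem F p', elem F q')"
        using e pq Ed[of p q] Ed[of p' q'] inj by (auto dest: inj_onD)
      then show ?thesis
        using planar[of "elem F p" "elem F q" "elem F p'" "elem F q'"] e pq Ed[of p q] Ed[of p' q']
          seg[of p q] seg[of p' q'] pos by auto
    qed
    ultimately show "planar_diagram L F" unfolding planar_diagram_def by blast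
  qed
qed

context fin_lattice begin

text \<open>Going up in \<open>C\<close> from cover to cover, the height cannot skip the value \<open>h\<close>; on the edge that passes
it, a convex combination of the ends has this height.\<close>
lemma path_point:
  assumes up: "\<And>x y. covered_by L x y \<Longrightarrow> snd (P x) < snd ((P y) :: real \<times> real)"
    and C: "C \<subseteq> carrier L" "\<bottom> \<in> C" "\<And>y. y \<in> C \<Longrightarrow> y \<noteq> \<top> \<Longrightarrow> \<exists>y'\<in>C. covered_by L y y'"
    and h: "snd (P \<bottom>) \<le> h" "h \<le> snd (P \<top>)"
  shows "\<exists>z\<in>drawn_elems L P C. snd z = h"
proof -
  have "y \<in> C \<Longrightarrow> snd (P y) \<le> h \<Longrightarrow> ?thesis" if "y \<in> carrier L" for y
    using that
  proof (induction y rule: upward_induct)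
    case (greater y)
    show ?case
    proof (cases "y = \<top>")
      case True
      then show ?thesis using greater.prems h by (intro bexI[of _ "P y"]) (auto simp: drawn_elems_def)
    next
      case False
      then obtain y' where y': "y' \<in> C" "covered_by L y y'" using C(3) greater.prems by auto
      show ?thesis
      proof (cases "snd (P y') \<le> h")
        case True
        then show ?thesis using greater.IH[of y'] y' coverD[OF y'(2)] by (auto simp: lless_eq)
      next
        case False
        define t where "t = (h - snd (P y)) / (snd (P y') - snd (P y))"
        have lt: "snd (P y) < snd (P y')" using up y' by auto
        then have t: "0 \<le> t" "t \<le> 1" using False greater.prems by (auto simp: t_def field_simps)
        define z where "z = (1 - t) *\<^sub>R P y + t *\<^sub>R P y'"
        have "z \<in> closed_segment (P y) (P y')" using t by (auto simp: z_def in_segment)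
        then have "z \<in> drawn_elems L P C"
          using y' greater.prems unfolding drawn_elems_def by blast
        moreover have "snd z = h"
        proof -
          have "snd z = snd (P y) + t * (snd (P y') - snd (P y))" by (simp add: z_def algebra_simps)
          then show ?thesis using lt by (simp add: t_def)
        qed
        ultimately show ?thesis by auto
      qed
    qed
  qed
  then show ?thesis using C h bottom_closed by blast
qed

lemma height_mono:
  assumes up: "\<And>x y. covered_by L x y \<Longrightarrow> snd (P x) < snd ((P y) :: real \<times> real)"
    and "x \<in> carrier L" "y \<in> carrier L" "x \<sqsubset> y"
  shows "snd (P x) < snd (P y)"
  using assms(2,4)
proof (induction x rule: upward_induct)
  case (greater x)
  obtain z where z: "covered_by L x z" "z \<sqsubseteq> y" using upper_cover_exists greater assms(3) by metis
  show ?case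
  proof (cases "z = y")
    case False
    then have "snd (P z) < snd (P y)"
      using greater.IH[of z] coverD[OF z(1)] z(2) by (auto simp: lless_eq)
    then show ?thesis using up[OF z(1)] by simp
  qed (use up z in auto)
qed

end

section \<open>Coordinatized frames are drawn as C1-diagrams\<close>

text \<open>The sign \<open>s\<close> says on which side the ideal of \<open>a\<close> is drawn: on the left for \<open>s = 1\<close>, on the right for
\<open>s = - 1\<close>. Exchanging \<open>a\<close> and \<open>b\<close> reverses it, which halves the proofs.\<close>
locale coordinatized = rectangular_frame L a b for L (structure) and a b +
  fixes f g :: "'a \<Rightarrow> real" and s :: real and P :: "'a \<Rightarrow> real \<times> real"
  assumes sign: "s = 1 \<or> s = - 1"
    and P_eq: "x \<in> carrier L \<Longrightarrow> P x = (s * (g (x \<sqinter> b) - f (x \<sqinter> a)), g (x \<sqinter> b) + f (x \<sqinter> a))"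
    and f_mono: "x \<in> carrier L \<Longrightarrow> y \<in> carrier L \<Longrightarrow> x \<sqsubset> y \<Longrightarrow> y \<sqsubseteq> a \<Longrightarrow> f x < f y"
    and g_mono: "x \<in> carrier L \<Longrightarrow> y \<in> carrier L \<Longrightarrow> x \<sqsubset> y \<Longrightarrow> y \<sqsubseteq> b \<Longrightarrow> g x < g y"
begin

lemma swap_coordinatized: "coordinatized L b a g f (- s) P"
proof -
  interpret r: rectangular_frame L b a by (rule swap)
  show ?thesis by unfold_locales (use sign P_eq f_mono g_mono in \<open>auto simp: algebra_simps\<close>)
qed

lemma sign_square [simp]: "s * (s * x) = x" using sign by auto

lemma slant_P: "x \<in> carrier L \<Longrightarrow> slant s (P x) = 2 * f (x \<sqinter> a)"
  "x \<in> carrier L \<Longrightarrow> slant (- s) (P x) = 2 * g (x \<sqinter> b)"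
  by (auto simp: slant_def P_eq algebra_simps)

lemma f_le_iff:
  assumes "x \<in> carrier L" "y \<in> carrier L" "x \<sqsubseteq> a" "y \<sqsubseteq> a"
  shows "f x \<le> f y \<longleftrightarrow> x \<sqsubseteq> y"
  using f_mono[of x y] f_mono[of y x] down_a[of x y] assms unfolding lless_eq
  by (metis leD le_antisym less_eq_real_def)

lemma g_le_iff:
  assumes "x \<in> carrier L" "y \<in> carrier L" "x \<sqsubseteq> b" "y \<sqsubseteq> b"
  shows "g x \<le> g y \<longleftrightarrow> x \<sqsubseteq> y"
  using g_mono[of x y] g_mono[of y x] down_b[of x y] assms unfolding lless_eq
  by (metis leD le_antisym less_eq_real_def)

lemma le_iff_slant:
  assumes "x \<in> carrier L" "y \<in> carrier L"
  shows "x \<sqsubseteq> y \<longleftrightarrow> slant s (P x) \<le> slant s (P y) \<and> slant (- s) (P x) \<le> slant (- s) (P y)"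
  using assms le_iff_parts[of x y] f_le_iff[of "x \<sqinter> a" "y \<sqinter> a"] g_le_iff[of "x \<sqinter> b" "y \<sqinter> b"]
  by (simp add: slant_P)

lemma slant_between:
  assumes "x \<in> carrier L" "y \<in> carrier L" "x \<sqsubseteq> y" "z \<in> closed_segment (P x) (P y)" "r = s \<or> r = - s"
  shows "slant r (P x) \<le> slant r z" "slant r z \<le> slant r (P y)"
proof -
  obtain t where t: "0 \<le> t" "t \<le> 1" "z = (1 - t) *\<^sub>R P x + t *\<^sub>R P y"
    using assms(4) by (auto simp: in_segment)
  have d: "0 \<le> slant r (P y) - slant r (P x)" using le_iff_slant assms by auto
  have "0 \<le> t * (slant r (P y) - slant r (P x))" "t * (slant r (P y) - slant r (P x)) \<le> slant r (P y) - slant r (P x)"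
    using t d by (auto intro: mult_left_le_one_le)
  then show "slant r (P x) \<le> slant r z" "slant r z \<le> slant r (P y)" unfolding t(3) slant_on_segment by auto
qed

text \<open>The ideals of \<open>a\<close> and \<open>b\<close> are chains, so each part of \<open>x \<sqinter> y\<close> is a part of \<open>x\<close> or a part of \<open>y\<close>.\<close>
lemma slant_meet:
  assumes "x \<in> carrier L" "y \<in> carrier L" "r = s \<or> r = - s" "h \<le> slant r (P x)" "h \<le> slant r (P y)"
  shows "h \<le> slant r (P (x \<sqinter> y))"
proof -
  have "(x \<sqinter> y) \<sqinter> a = x \<sqinter> a \<or> (x \<sqinter> y) \<sqinter> a = y \<sqinter> a"
    unfolding meet_meet[OF assms(1,2) a_in]
    using down_a[of "x \<sqinter> a" "y \<sqinter> a"] meet_absorb1[of "x \<sqinter> a" "y \<sqinter> a"] meet_absorb2[of "x \<sqinter> a" "y \<sqinter> a"] assms(1,2)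
    by (metis a_in meet_closed meet_right)
  moreover have "(x \<sqinter> y) \<sqinter> b = x \<sqinter> b \<or> (x \<sqinter> y) \<sqinter> b = y \<sqinter> b"
    unfolding meet_meet[OF assms(1,2) b_in]
    using down_b[of "x \<sqinter> b" "y \<sqinter> b"] meet_absorb1[of "x \<sqinter> b" "y \<sqinter> b"] meet_absorb2[of "x \<sqinter> b" "y \<sqinter> b"] assms(1,2)
    by (metis b_in meet_closed meet_right)
  ultimately show ?thesis using assms slant_P[of x] slant_P[of y] slant_P[of "x \<sqinter> y"] by auto
qed

lemma P_rises: assumes "covered_by L x y" shows "snd (P x) < snd (P y)"
proof -
  note c = coverD[OF assms]
  have "snd (P x) \<le> snd (P y)" and e: "snd (P x) = snd (P y) \<Longrightarrow> y \<sqsubseteq> x"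
    using le_iff_slant[of x y] le_iff_slant[of y x] c by (auto simp: slant_def)
  then show ?thesis using c le_antisym[of x y] by fastforce
qed

text \<open>Let the edges \<open>[x, y]\<close> and \<open>[x', y']\<close> meet in a point \<open>z\<close> and let \<open>m\<close> be the meet of their tops. Both \<open>y\<close> and \<open>y'\<close> are
above \<open>z\<close> in both coordinates, hence so is \<open>m\<close>, and \<open>x, x' \<le> m\<close>. As these are covering pairs, \<open>m\<close> is an
end of each edge. If \<open>m\<close> is a bottom end, then \<open>z\<close> is its position. Otherwise the
edges have the same top, and meeting below it they have the same direction there; then
their bottoms are comparable, hence equal.\<close>
lemma planar_placement: "planar_placement L P"
proof
  show "inj_on P (carrier L)"
    by (rule inj_onI) (metis le_antisym le_iff_slant order_refl)
next
  fix x y assume xy: "covered_by L x y"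
  note c = coverD[OF xy]
  show "snd (P x) < snd (P y)" using P_rises xy .
  fix w assume w: "w \<in> carrier L" "P w \<in> closed_segment (P x) (P y)"
  then have "x \<sqsubseteq> w" "w \<sqsubseteq> y"
    using slant_between[OF c(1-3) w(2)] le_iff_slant[of x w] le_iff_slant[of w y] c by auto
  then show "w = x \<or> w = y" using cover_between xy w by auto
next
  fix x y x' y' assume xy: "covered_by L x y" "covered_by L x' y'" "(x, y) \<noteq> (x', y')"
  note c = coverD[OF xy(1)] and c' = coverD[OF xy(2)]
  show "closed_segment (P x) (P y) \<inter> closed_segment (P x') (P y') \<subseteq> {P x, P y} \<inter> {P x', P y'}"
  proof
    fix z assume z: "z \<in> closed_segment (P x) (P y) \<inter> closed_segment (P x') (P y')"
    then have z1: "z \<in> closed_segment (P x) (P y)" and z2: "z \<in> closed_segment (P x') (P y')" by auto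
    note b = slant_between[OF c(1-3) z1] and b' = slant_between[OF c'(1-3) z2]
    define m where "m = y \<sqinter> y'"
    have m: "m \<in> carrier L" "m \<sqsubseteq> y" "m \<sqsubseteq> y'" using c c' by (auto simp: m_def)
    have zm: "slant s z \<le> slant s (P m)" "slant (- s) z \<le> slant (- s) (P m)"
      unfolding m_def using slant_meet[of y y'] b b' c c' by auto
    have "x \<sqsubseteq> m" "x' \<sqsubseteq> m"
      using le_iff_slant[of x m] le_iff_slant[of x' m] m c c' zm b(1)[of s] b(1)[of "- s"] b'(1)[of s] b'(1)[of "- s"]
      by auto
    then have mm: "m = x \<or> m = y" "m = x' \<or> m = y'"
      using cover_between[OF xy(1)] cover_between[OF xy(2)] m by auto
    have zx: "z = P x" if "m = x"
      using zm b(1)[of s] b(1)[of "- s"] that by (intro slant_eqI[OF sign]) auto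
    have zx': "z = P x'" if "m = x'"
      using zm b'(1)[of s] b'(1)[of "- s"] that by (intro slant_eqI[OF sign]) auto
    show "z \<in> {P x, P y} \<inter> {P x', P y'}"
    proof (cases "m = x \<or> m = x'")
      case True
      then show ?thesis using zx zx' mm by auto
    next
      case False
      then have yy: "y = y'" using mm by auto
      obtain t where t: "0 \<le> t" "t \<le> 1" "z = (1 - t) *\<^sub>R P x + t *\<^sub>R P y" using z1 by (auto simp: in_segment)
      obtain t' where t': "0 \<le> t'" "t' \<le> 1" "z = (1 - t') *\<^sub>R P x' + t' *\<^sub>R P y" using z2 yy by (auto simp: in_segment)
      have cmp: "u \<sqsubseteq> v" if uv: "u \<in> carrier L" "v \<in> carrier L" "u \<sqsubseteq> y" "v \<sqsubseteq> y" "z = (1 - k) *\<^sub>R P u + k *\<^sub>R P y"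
        "z = (1 - l) *\<^sub>R P v + l *\<^sub>R P y" "l \<le> k" "k < 1" for u v k l
      proof -
        have "slant r (P u) \<le> slant r (P v)" if r: "r = s \<or> r = - s" for r
        proof -
          have e: "(1 - k) * (slant r (P y) - slant r (P u)) = (1 - l) * (slant r (P y) - slant r (P v))"
            using arg_cong[OF uv(5), of "slant r"] arg_cong[OF uv(6), of "slant r"] unfolding slant_on_segment
            by (simp add: algebra_simps)
          have "0 \<le> slant r (P y) - slant r (P v)" using le_iff_slant[of v y] uv c r by auto
          then have "(1 - k) * (slant r (P y) - slant r (P v)) \<le> (1 - l) * (slant r (P y) - slant r (P v))"
            using uv(7) by (intro mult_right_mono) auto
          then have "(1 - k) * (slant r (P y) - slant r (P v)) \<le> (1 - k) * (slant r (P y) - slant r (P u))"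
            using e by simp
          then show ?thesis using uv(8) by (simp add: mult_le_cancel_left)
        qed
        then show ?thesis using le_iff_slant uv by auto
      qed
      have "t = 1 \<or> t' = 1"
      proof (rule ccontr)
        assume "\<not> (t = 1 \<or> t' = 1)"
        then have "t < 1" "t' < 1" using t t' by auto
        then have "x \<sqsubseteq> x' \<or> x' \<sqsubseteq> x"
          using cmp[OF c(1) c'(1) c(3) _ t(3) t'(3)] cmp[OF c'(1) c(1) _ c(3) t'(3) t(3)] c'(3)[folded yy]
          by (cases "t' \<le> t") auto
        then have "x = x'"
          using cover_between[OF xy(1), of x'] cover_between[OF xy(2), of x] c c' yy by auto
        then show False using xy yy by auto
      qed
      then have "z = P y" using t t' by auto
      then show ?thesis using yy by auto
    qed
  qed
qed

lemma reducible_normal: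
  assumes "x \<in> carrier L" "x \<notin> meet_irreducibles L" "covered_by L x y"
  shows "x \<sqinter> a = y \<sqinter> a \<or> x \<sqinter> b = y \<sqinter> b"
proof -
  have "x \<noteq> \<top>" using coverD[OF assms(3)] top_least by metis
  then obtain y1 y2 where "covered_by L x y1" "covered_by L x y2" "y1 \<noteq> y2"
    using meet_reducible_covers assms by metis
  then obtain z where "covered_by L x z" "y \<noteq> z" by metis
  then show ?thesis using two_covers_parts[OF assms(3), of z] by auto
qed

text \<open>Otherwise \<open>x\<close> would have a second cover by \<open>two_covers_exist\<close>.\<close>
lemma irreducible_steep:
  assumes "x \<in> meet_irreducibles L" "covered_by L x y" "\<not> a \<sqsubseteq> x"
  shows "x \<sqinter> a \<noteq> y \<sqinter> a"
  using two_covers_exist[OF _ assms(3,2)] two_covers_not_irreducible[OF assms(2)] assms(1) coverD[OF assms(2)]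
  by metis

lemma spine_coords:
  assumes "c \<in> drawn_elems L P spine"
  shows "slant (- s) c = slant (- s) (P \<bottom>) \<or> slant s c = slant s (P a)"
proof -
  have 1: "slant (- s) (P x) = slant (- s) (P \<bottom>)" if "x \<in> carrier L" "x \<sqsubseteq> a" for x
    using that meet_a_bottom[of x] meet_a_bottom[of \<bottom>] by (simp add: slant_P)
  have 2: "slant s (P x) = slant s (P a)" if "x \<in> carrier L" "a \<sqsubseteq> x" for x
    using that meet_absorb2[of x a] meet_absorb2[of a a] by (simp add: slant_P)
  obtain x y where xy: "x \<in> spine" "y \<in> spine" "x = y \<or> covered_by L x y" "c \<in> closed_segment (P x) (P y)"
    using drawn_elems_cases[OF assms] .
  have "y \<sqsubseteq> a \<or> a \<sqsubseteq> x" "x \<sqsubseteq> y" "x \<in> carrier L" "y \<in> carrier L"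
    using xy cover_between[of x y a] coverD[of x y] by (auto simp: spine_def)
  note xy = this(3,4,1,2) xy(4)
  obtain t where t: "c = (1 - t) *\<^sub>R P x + t *\<^sub>R P y" using xy(5) by (auto simp: in_segment)
  show ?thesis unfolding t slant_on_segment using 1[of x] 1[of y] 2[of x] 2[of y] xy le_trans[of x y a] le_trans[of a x y] by auto
qed

lemma drawn_bounds:
  assumes "z \<in> drawn_elems L P (carrier L)"
  shows "slant (- s) (P \<bottom>) \<le> slant (- s) z" "slant s z \<le> slant s (P a)"
proof -
  have 1: "slant (- s) (P \<bottom>) \<le> slant (- s) (P x)" if "x \<in> carrier L" for x
    using that le_iff_slant[of \<bottom> x] by simp
  have 2: "slant s (P x) \<le> slant s (P a)" if "x \<in> carrier L" for x
    using that f_le_iff[of "x \<sqinter> a" "a \<sqinter> a"] meet_absorb1[of a a] by (simp add: slant_P)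
  obtain x y where "x \<in> carrier L" "y \<in> carrier L" "x = y \<or> covered_by L x y" "z \<in> closed_segment (P x) (P y)"
    using drawn_elems_cases[OF assms] .
  then have xy: "x \<in> carrier L" "y \<in> carrier L" "x \<sqsubseteq> y" "z \<in> closed_segment (P x) (P y)"
    using coverD[of x y] by auto
  show "slant (- s) (P \<bottom>) \<le> slant (- s) z" "slant s z \<le> slant s (P a)"
    using slant_between[OF xy] 1[OF xy(1)] 2[OF xy(2)] by (force intro: order_trans)+
qed

lemma side_spine: "side_chain L P s spine"
  unfolding side_chain_def
proof (intro conjI ballI impI spine_maxchain)
  fix z c assume "z \<in> drawn_elems L P (carrier L)" "c \<in> drawn_elems L P spine" "snd z = snd c"
  then show "s * fst c \<le> s * fst z"
    using spine_coords[of c] drawn_bounds[of z] by (auto simp: slant_def)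
qed

text \<open>Compare \<open>x\<close> with the point \<open>z\<close> of the path of the spine at the same height. Being on the outer side of
\<open>z\<close>, the point \<open>P x\<close> has an extremal coordinate, because \<open>z\<close> has one; this means \<open>x \<le> a\<close> or \<open>a \<le> x\<close>.\<close>
lemma side_only_spine:
  assumes "side_chain L P s C" "x \<in> C"
  shows "x \<in> spine"
proof -
  have x: "x \<in> carrier L" using assms by (auto simp: side_chain_def pred_on.maxchain_def chain_iff)
  have "snd (P \<bottom>) \<le> snd (P x)" "snd (P x) \<le> snd (P \<top>)"
    using le_iff_slant[of \<bottom> x] le_iff_slant[of x \<top>] x by (auto simp: slant_def)
  then obtain z where z: "z \<in> drawn_elems L P spine" "snd z = snd (P x)"
    using path_point[of P spine "snd (P x)", OF P_rises spine_carrier] spine_next by auto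
  have "z \<in> drawn_elems L P (carrier L)" using z(1) spine_carrier unfolding drawn_elems_def by blast
  moreover have "P x \<in> drawn_elems L P C" using assms by (auto simp: drawn_elems_def)
  ultimately have le: "s * fst (P x) \<le> s * fst z" using assms(1) z(2) unfolding side_chain_def by blast
  show ?thesis using spine_coords[OF z(1)]
  proof
    assume "slant (- s) z = slant (- s) (P \<bottom>)"
    then have "slant (- s) (P x) \<le> slant (- s) (P \<bottom>)" using le z(2) by (simp add: slant_def)
    then have "g (x \<sqinter> b) \<le> g (\<bottom> \<sqinter> b)" using x by (simp add: slant_P)
    then have "x \<sqinter> b \<sqsubseteq> \<bottom>" using g_le_iff[of "x \<sqinter> b" "\<bottom> \<sqinter> b"] x meet_absorb1[of \<bottom> b] by simp
    then have "x \<sqinter> b = \<bottom>" using x below_bottom by simp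
    then have "x = (x \<sqinter> a) \<squnion> \<bottom>" using span[OF x] by simp
    then have "x \<sqsubseteq> a" using x join_le_iff[of "x \<sqinter> a" \<bottom> a] by (metis a_in bottom_closed bottom_lower meet_closed meet_right)
    then show ?thesis using x by (simp add: spine_def)
  next
    assume "slant s z = slant s (P a)"
    then have "slant s (P a) \<le> slant s (P x)" using le z(2) by (simp add: slant_def)
    then have "f (a \<sqinter> a) \<le> f (x \<sqinter> a)" using x by (simp add: slant_P)
    then have "a \<sqsubseteq> x \<sqinter> a" using f_le_iff[of "a \<sqinter> a" "x \<sqinter> a"] x meet_absorb1[of a a] by simp
    then show ?thesis using x by (simp add: spine_def)
  qed
qed

lemma part_strict:
  assumes "covered_by L x y"
  shows "x \<sqinter> a = y \<sqinter> a \<or> f (x \<sqinter> a) < f (y \<sqinter> a)" "x \<sqinter> b = y \<sqinter> b \<or> g (x \<sqinter> b) < g (y \<sqinter> b)"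
  using coverD[OF assms] le_iff_parts[of x y] f_mono[of "x \<sqinter> a" "y \<sqinter> a"] g_mono[of "x \<sqinter> b" "y \<sqinter> b"]
  by (auto simp: lless_eq)

lemma normal_edge:
  assumes "covered_by L x y" "x \<sqinter> a = y \<sqinter> a \<or> x \<sqinter> b = y \<sqinter> b"
  shows "parallel (P y - P x) (1, 1) \<or> parallel (P y - P x) (1, - 1)"
proof -
  note c = coverD[OF assms(1)]
  define df where "df = f (y \<sqinter> a) - f (x \<sqinter> a)"
  define dg where "dg = g (y \<sqinter> b) - g (x \<sqinter> b)"
  have d: "P y - P x = (s * (dg - df), dg + df)" using c by (simp add: P_eq df_def dg_def algebra_simps)
  have "\<not> (x \<sqinter> a = y \<sqinter> a \<and> x \<sqinter> b = y \<sqinter> b)" using cover_changes[OF assms(1)] by metis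
  then have ne: "df \<noteq> 0 \<or> dg \<noteq> 0" using part_strict[OF assms(1)] unfolding df_def dg_def by linarith
  have "df = 0 \<or> dg = 0" using assms(2) unfolding df_def dg_def by auto
  then have "P y - P x = dg *\<^sub>R (s, 1) \<and> dg \<noteq> 0 \<or> P y - P x = df *\<^sub>R (- s, 1) \<and> df \<noteq> 0"
    using ne unfolding d by (auto simp: mult.commute)
  moreover have "(c::real) \<noteq> 0 \<Longrightarrow> parallel (c *\<^sub>R (1, 1)) (1, 1)" "(c::real) \<noteq> 0 \<Longrightarrow> parallel (c *\<^sub>R (- 1, 1)) (1, - 1)" for c
    unfolding parallel_def by (rule exI[of _ c], simp) (rule exI[of _ "- c"], simp)
  ultimately show ?thesis using sign by fastforce
qed

lemma precipitous_edge:
  assumes "covered_by L x y" "x \<sqinter> a \<noteq> y \<sqinter> a" "x \<sqinter> b \<noteq> y \<sqinter> b"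
  shows "parallel (P y - P x) (0, 1) \<or> (\<exists>q. \<bar>q\<bar> > 1 \<and> parallel (P y - P x) (1, q))"
proof -
  note c = coverD[OF assms(1)]
  define df where "df = f (y \<sqinter> a) - f (x \<sqinter> a)"
  define dg where "dg = g (y \<sqinter> b) - g (x \<sqinter> b)"
  have d: "P y - P x = (s * (dg - df), dg + df)" using c by (simp add: P_eq df_def dg_def algebra_simps)
  have pos: "df > 0" "dg > 0" using assms part_strict[OF assms(1)] unfolding df_def dg_def by auto
  show ?thesis
  proof (cases "df = dg")
    case True
    then show ?thesis unfolding d parallel_def using pos by (intro disjI1 exI[of _ "dg + df"]) auto
  next
    case False
    define q where "q = (dg + df) / (s * (dg - df))"
    have ne: "s * (dg - df) \<noteq> 0" using False sign by auto
    have "\<bar>s * (dg - df)\<bar> < \<bar>dg + df\<bar>" using pos sign by (auto simp: abs_if)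
    then have "\<bar>q\<bar> > 1" using ne unfolding q_def by (simp add: abs_divide less_divide_eq)
    moreover have "parallel (P y - P x) (1, q)"
      unfolding d parallel_def using ne by (intro exI[of _ "s * (dg - df)"]) (auto simp: q_def)
    ultimately show ?thesis by blast
  qed
qed

lemma on_boundary_iff: "on_boundary L P x \<longleftrightarrow> x \<in> spine \<or> x \<in> rectangular_frame.spine L b"
proof -
  interpret r: coordinatized L b a g f "- s" P by (rule swap_coordinatized)
  have "on_boundary L P x \<longleftrightarrow> (\<exists>C. x \<in> C \<and> (side_chain L P s C \<or> side_chain L P (- s) C))"
    unfolding on_boundary_def using sign by auto
  then show ?thesis using side_spine r.side_spine side_only_spine r.side_only_spine by blast
qed

lemma spine_normal:
  assumes "x \<in> spine" "x \<in> meet_irreducibles L" "b \<noteq> \<bottom>" "covered_by L x y"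
  shows "x \<sqinter> a = y \<sqinter> a"
proof -
  note c = coverD[OF assms(4)]
  have "a \<sqsubseteq> x" using below_a_doubly_irreducible[of x] assms by (auto simp: spine_def)
  then have "x \<sqinter> a = a" "y \<sqinter> a = a" using meet_absorb2[of x a] meet_absorb2[of y a] le_trans[of a x y] c by auto
  then show ?thesis by simp
qed

text \<open>A meet-irreducible element off the boundary is neither above \<open>a\<close> nor above \<open>b\<close>, so its edge changes
both parts. In all other cases one part is preserved.\<close>
lemma C1_rectangular:
  assumes "a \<noteq> \<bottom>" "b \<noteq> \<bottom>" "draws L F P"
  shows "C1_diagram L F"
proof -
  interpret r: coordinatized L b a g f "- s" P by (rule swap_coordinatized)
  have "planar_diagram L F" using planar_diagram_iff[OF fin_lattice_axioms assms(3)] planar_placement by simp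
  moreover have "if elem F p \<in> meet_irreducibles L \<and> p \<notin> boundary L F
           then precipitous F (p, q) else normal_slope F (p, q)" if "(p, q) \<in> edges F" for p q
  proof -
    define x y where "x = elem F p" and "y = elem F q"
    have pq: "p \<in> vertices F" "q \<in> vertices F" "covered_by L x y" "pos F p = P x" "pos F q = P y"
      using that assms(3) by (auto simp: draws_def x_def y_def)
    have bd: "p \<in> boundary L F \<longleftrightarrow> x \<in> spine \<or> x \<in> r.spine"
      using boundary_iff[OF assms(3) pq(1)] on_boundary_iff by (simp add: x_def)
    note c = coverD[OF pq(3)]
    show ?thesis
    proof (cases "x \<in> meet_irreducibles L \<and> p \<notin> boundary L F")
      case True
      then have "\<not> a \<sqsubseteq> x" "\<not> b \<sqsubseteq> x" using bd c by (auto simp: spine_def r.spine_def)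
      then have "x \<sqinter> a \<noteq> y \<sqinter> a" "x \<sqinter> b \<noteq> y \<sqinter> b"
        using irreducible_steep r.irreducible_steep True pq(3) by blast+
      then have "precipitous F (p, q)"
        using precipitous_edge[OF pq(3)] pq by (simp add: precipitous_def)
      then show ?thesis using True by (simp add: x_def)
    next
      case False
      have "x \<sqinter> a = y \<sqinter> a \<or> x \<sqinter> b = y \<sqinter> b"
      proof (cases "x \<in> meet_irreducibles L")
        case True
        then show ?thesis using False bd spine_normal r.spine_normal assms(1,2) pq(3) by blast
      next
        case False
        then show ?thesis using reducible_normal c pq(3) by blast
      qed
      then have "normal_slope F (p, q)" using normal_edge[OF pq(3)] pq by (simp add: normal_slope_def)
      then show ?thesis using False by (auto simp: x_def)
    qed
  qed
  ultimately show ?thesis unfolding C1_diagram_def using slim_rectangularI[OF assms(1,2)] by blast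
qed

lemma C1_chain:
  assumes "a = \<bottom>" "draws L F P"
  shows "C1_diagram L F"
proof -
  have xa: "x \<sqinter> a = \<bottom>" if "x \<in> carrier L" for x using that assms(1) below_bottom[of "x \<sqinter> \<bottom>"] by simp
  have xb: "x \<sqsubseteq> b" if "x \<in> carrier L" for x
  proof -
    have "\<bottom> \<squnion> (x \<sqinter> b) = x" using span[OF that] xa[OF that] by simp
    moreover have "\<bottom> \<squnion> (x \<sqinter> b) \<sqsubseteq> b" using that by simp
    ultimately show ?thesis by simp
  qed
  have "total_order L" by (rule total_orderI) (use down_b xb in auto)
  then have "finite_chain L" unfolding finite_chain_def using fin nonempty by simp
  moreover have "hasse_diagram L F"
    using planar_diagram_iff[OF fin_lattice_axioms assms(2)] planar_placement by (simp add: planar_diagram_def)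
  moreover have "normal_slope F e" if "e \<in> edges F" for e
  proof -
    obtain p q where e: "e = (p, q)" by (cases e)
    have pq: "covered_by L (elem F p) (elem F q)" "pos F p = P (elem F p)" "pos F q = P (elem F q)"
      using that assms(2) e by (auto simp: draws_def)
    show ?thesis
      using normal_edge[OF pq(1)] xa coverD[OF pq(1)] pq by (simp add: normal_slope_def e)
  qed
  ultimately show ?thesis unfolding C1_diagram_def by blast
qed

lemma C1_of_coordinates: assumes "draws L F P" shows "C1_diagram L F"
  using C1_rectangular C1_chain[OF _ assms] coordinatized.C1_chain[OF swap_coordinatized _ assms] assms by blast

end

section \<open>Coordinates of a quotient diagram\<close>

locale coord_congruence = coordinatized L a b f g s P + frame_congruence L a b \<alpha>
  for L (structure) and a b f g s P \<alpha>
begin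

text \<open>The coordinate functions of the quotient are those of the parts of the block tops; \<open>top_of_meet\<close>
makes them depend only on the parts of the blocks.\<close>
lemma coord_Q:
  "coordinatized Q (cls a) (cls b) (\<lambda>X. f (top_of X \<sqinter> a)) (\<lambda>X. g (top_of X \<sqinter> b)) s (\<lambda>X. P (top_of X))"
proof -
  interpret Q: rectangular_frame Q "cls a" "cls b" by (rule frame_Q)
  show ?thesis
  proof unfold_locales
    show "s = 1 \<or> s = - 1" by (rule sign)
    show "P (top_of X) = (s * (g (top_of (X \<sqinter>\<^bsub>Q\<^esub> cls b) \<sqinter> b) - f (top_of (X \<sqinter>\<^bsub>Q\<^esub> cls a) \<sqinter> a)),
       g (top_of (X \<sqinter>\<^bsub>Q\<^esub> cls b) \<sqinter> b) + f (top_of (X \<sqinter>\<^bsub>Q\<^esub> cls a) \<sqinter> a))" if "X \<in> carrier Q" for X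
      using that by (simp add: top_of_meet P_eq top_of_carrier)
    show "f (top_of X \<sqinter> a) < f (top_of Y \<sqinter> a)"
      if "X \<in> carrier Q" "Y \<in> carrier Q" "X \<sqsubset>\<^bsub>Q\<^esub> Y" "le Q Y (cls a)" for X Y
      using part_mono[OF that a_in] that top_of_carrier by (intro f_mono) auto
    show "g (top_of X \<sqinter> b) < g (top_of Y \<sqinter> b)"
      if "X \<in> carrier Q" "Y \<in> carrier Q" "X \<sqsubset>\<^bsub>Q\<^esub> Y" "le Q Y (cls b)" for X Y
      using part_mono[OF that b_in] that top_of_carrier by (intro g_mono) auto
  qed
qed

lemma draws_Q:
  assumes "draws L F P"
  shows "draws Q (quotient_diagram L F \<alpha>) (\<lambda>X. P (top_of X))"
proof -
  interpret Q: fin_lattice Q by (rule fin_lattice_Q)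
  define G where "G = quotient_diagram L F \<alpha>"
  define T where "T = {v \<in> vertices F. is_top (elem F v)}"
  have G: "vertices G = T" "pos G = pos F" "elem G = (\<lambda>v. cls (elem F v))"
    "edges G = {(u, v). u \<in> T \<and> v \<in> T \<and> elem F u \<sqsubset> elem F v \<and>
         (\<nexists>w. w \<in> T \<and> elem F u \<sqsubset> elem F w \<and> elem F w \<sqsubset> elem F v)}"
    by (auto simp: G_def quotient_diagram_def subdiagram_def T_def is_top_def Let_def)
  have inj: "inj_on (elem F) (vertices F)" and img: "elem F ` vertices F = carrier L"
    using assms by (auto simp: draws_def bij_betw_def)
  have vert: "\<exists>v\<in>T. elem F v = t" if "is_top t" for t
  proof -
    have "t \<in> elem F ` vertices F" using that is_top_carrier img by simp
    then show ?thesis using that by (auto simp: T_def)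
  qed
  have tops: "is_top (elem F v)" "elem F v \<in> carrier L" if "v \<in> T" for v
    using that is_top_carrier by (auto simp: T_def)
  have less_iff: "elem F u \<sqsubset> elem F v \<longleftrightarrow> cls (elem F u) \<sqsubset>\<^bsub>Q\<^esub> cls (elem F v)" if "u \<in> T" "v \<in> T" for u v
    using le_tops[OF tops(2)[OF that(1)] tops(1)[OF that(2)]] tops_eq[OF tops(1)[OF that(1)] tops(1)[OF that(2)]]
    unfolding lless_eq Q.lless_eq by auto
  have "bij_betw (elem G) (vertices G) (carrier Q)"
    unfolding bij_betw_def
  proof
    show "inj_on (elem G) (vertices G)"
    proof (rule inj_onI)
      fix u v assume uv: "u \<in> vertices G" "v \<in> vertices G" "elem G u = elem G v"
      then have "elem F u = elem F v" using tops_eq tops by (simp add: G)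
      then show "u = v" using inj uv by (auto simp: G T_def dest: inj_onD)
    qed
    show "elem G ` vertices G = carrier Q"
    proof
      show "elem G ` vertices G \<subseteq> carrier Q" using tops by (auto simp: G)
      show "carrier Q \<subseteq> elem G ` vertices G"
      proof
        fix X assume X: "X \<in> carrier Q"
        then obtain v where "v \<in> T" "elem F v = top_of X" using vert top_of by metis
        then show "X \<in> elem G ` vertices G" using top_of[OF X] by (intro image_eqI[of _ _ v]) (simp_all add: G)
      qed
    qed
  qed
  moreover have "(u, v) \<in> edges G \<longleftrightarrow> u \<in> T \<and> v \<in> T \<and> covered_by Q (elem G u) (elem G v)" for u v
  proof -
    have "(\<exists>w. w \<in> T \<and> elem F u \<sqsubset> elem F w \<and> elem F w \<sqsubset> elem F v) \<longleftrightarrow>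
      (\<exists>Z. Z \<in> carrier Q \<and> cls (elem F u) \<sqsubset>\<^bsub>Q\<^esub> Z \<and> Z \<sqsubset>\<^bsub>Q\<^esub> cls (elem F v))" if uv: "u \<in> T" "v \<in> T"
    proof
      assume "\<exists>w. w \<in> T \<and> elem F u \<sqsubset> elem F w \<and> elem F w \<sqsubset> elem F v"
      then show "\<exists>Z. Z \<in> carrier Q \<and> cls (elem F u) \<sqsubset>\<^bsub>Q\<^esub> Z \<and> Z \<sqsubset>\<^bsub>Q\<^esub> cls (elem F v)"
        using less_iff uv tops by (metis cls_carrier)
    next
      assume "\<exists>Z. Z \<in> carrier Q \<and> cls (elem F u) \<sqsubset>\<^bsub>Q\<^esub> Z \<and> Z \<sqsubset>\<^bsub>Q\<^esub> cls (elem F v)"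
      then obtain Z where Z: "Z \<in> carrier Q" "cls (elem F u) \<sqsubset>\<^bsub>Q\<^esub> Z" "Z \<sqsubset>\<^bsub>Q\<^esub> cls (elem F v)" by auto
      obtain w where w: "w \<in> T" "elem F w = top_of Z" using vert top_of Z by metis
      have "Z = cls (elem F w)" using top_of[OF Z(1)] w by simp
      then show "\<exists>w. w \<in> T \<and> elem F u \<sqsubset> elem F w \<and> elem F w \<sqsubset> elem F v"
        using Z w less_iff uv by metis
    qed
    then show ?thesis using less_iff tops unfolding covered_by_def by (auto simp: G)
  qed
  moreover have "pos G v = P (top_of (elem G v))" if "v \<in> vertices G" for v
  proof -
    have "top_of (cls (elem F v)) = elem F v" using top_of_cls tops that by (simp add: G)
    moreover have "pos F v = P (elem F v)" using that assms by (auto simp: G T_def draws_def)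
    ultimately show ?thesis by (simp add: G)
  qed
  ultimately show ?thesis unfolding draws_def G_def[symmetric] using G(1) by auto
qed

lemma C1_quotient:
  assumes "draws L F P" shows "C1_diagram (quotient_lattice L \<alpha>) (quotient_diagram L F \<alpha>)"
  using coordinatized.C1_of_coordinates[OF coord_Q draws_Q[OF assms]] .

end

section \<open>C1-diagrams have coordinates\<close>

context planar_placement begin

text \<open>On a common ray from \<open>P x\<close> the nearer cover would lie on the edge to the other one.\<close>
lemma no_parallel_covers:
  assumes "s = 1 \<or> s = - 1" "covered_by L x y" "covered_by L x z" "y \<noteq> z"
    "slant s (P x) = slant s (P y)" "slant s (P x) = slant s (P z)"
  shows False
proof -
  note cy = coverD[OF assms(2)] and cz = coverD[OF assms(3)]
  have "P y \<in> closed_segment (P x) (P z) \<or> P z \<in> closed_segment (P x) (P y)"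
    using in_segment_same_slant[OF assms(1), of "P x" "P z" "P y"]
      in_segment_same_slant[OF assms(1), of "P x" "P y" "P z"] assms(5,6)
      up[OF assms(2)] up[OF assms(3)] by linarith
  then show False
    using avoid[OF assms(3), of y] avoid[OF assms(2), of z] cy cz assms(4) by auto
qed

text \<open>The points \<open>P p\<close>, \<open>P y\<close>, \<open>P t\<close> lie on one line, and with \<open>P x\<close> they form a triangle whose sides are made
up of edges. The edge from \<open>y\<close> to \<open>w\<close> enters the interior of this triangle. An ascending path that
continues it cannot leave the triangle: crossing a side is excluded by planarity, and a vertex on a side is
one of \<open>p, x, y, t\<close>, none of which is above \<open>w\<close>. But \<open>1\<close> is drawn at least as high as \<open>t\<close>, the highest
point of the triangle.\<close>
lemma no_path_into_triangle:
  assumes s: "s = 1 \<or> s = - 1"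
    and cov: "covered_by L p x" "covered_by L p y" "x \<noteq> y" "covered_by L x t" "covered_by L y t"
    and cov2: "covered_by L y w" "w \<noteq> t"
    and u: "slant s (P p) = slant s (P y)" "slant s (P y) = slant s (P t)"
    and v: "slant (- s) (P p) = slant (- s) (P x)" "slant (- s) (P y) = slant (- s) (P w)"
  shows False
proof -
  note c = coverD[OF cov(1)] coverD[OF cov(2)] coverD[OF cov(4)] coverD[OF cov(5)] coverD[OF cov2(1)]
  \<comment> \<open>coordinates with origin \<open>P p\<close>; the triangle has the corners \<open>(0, 0)\<close>, \<open>(k, 0)\<close> and \<open>(0, l)\<close>, and
\<open>P y\<close> is the point \<open>(0, m)\<close>\<close>
  define U where "U z = slant s z - slant s (P p)" for z
  define V where "V z = slant (- s) z - slant (- s) (P p)" for z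
  have H: "U z + V z = 2 * (snd z - snd (P p))" for z
    using slant_height[of s z] slant_height[of s "P p"] by (simp add: U_def V_def)
  define k where "k = U (P x)"
  define l where "l = V (P t)"
  define m where "m = V (P y)"
  have vals: "U (P p) = 0" "V (P p) = 0" "V (P x) = 0" "U (P y) = 0" "U (P t) = 0" "V (P w) = m"
    using u v by (auto simp: U_def V_def m_def)
  have k: "0 < k" and m: "0 < m" and ml: "m < l" and kl: "k < l" and e: "0 < U (P w)"
    using up[OF cov(1)] up[OF cov(2)] up[OF cov(4)] up[OF cov(5)] up[OF cov2(1)]
      H[of "P x"] H[of "P y"] H[of "P t"] H[of "P w"] vals
    by (auto simp: k_def l_def m_def)
  \<comment> \<open>\<open>W\<close> vanishes on the line through \<open>P x\<close> and \<open>P t\<close>\<close>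
  define W where "W z = l * k - l * U z - k * V z" for z
  define I where "I = {z. 0 < U z} \<inter> {z. 0 < V z} \<inter> {z. 0 < W z}"
  define O' where "O' = {z. U z < 0} \<union> {z. V z < 0} \<union> {z. W z < 0}"
  have cont: "continuous_on UNIV U" "continuous_on UNIV V" "continuous_on UNIV W"
    unfolding W_def U_def V_def by (intro continuous_intros)+
  have op: "open I" "open O'"
    unfolding I_def O'_def using cont by (auto intro!: open_Int open_Un open_Collect_less continuous_intros)
  \<comment> \<open>the interior is \<open>I\<close>, the exterior \<open>O'\<close>, and the four edges make up the frontier\<close>
  have frontier: "z \<in> closed_segment (P p) (P x) \<or> z \<in> closed_segment (P p) (P y) \<or>
      z \<in> closed_segment (P x) (P t) \<or> z \<in> closed_segment (P y) (P t)" if z: "z \<notin> I" "z \<notin> O'" for z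
  proof -
    have ge: "0 \<le> U z" "0 \<le> V z" "0 \<le> W z" and "U z = 0 \<or> V z = 0 \<or> W z = 0"
      using z by (auto simp: I_def O'_def)
    then consider "U z = 0" | "V z = 0" | "W z = 0" by blast
    then show ?thesis
    proof cases
      case 1
      then have "k * V z \<le> k * l" using ge by (simp add: W_def mult.commute)
      then have "V z \<le> l" using k by simp
      then show ?thesis
        using in_segment_same_slant[OF s, of "P p" "P y" z] in_segment_same_slant[OF s, of "P y" "P t" z]
          1 u up[OF cov(2)] up[OF cov(5)] H[of z] H[of "P y"] H[of "P t"] vals ge(2)
        unfolding U_def l_def m_def by (smt (verit))
    next
      case 2
      then have "l * U z \<le> l * k" using ge by (simp add: W_def)
      then have "U z \<le> k" using kl k by simp
      moreover have s': "- s = 1 \<or> - s = - 1" using s by auto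
      ultimately show ?thesis
        using in_segment_same_slant[OF s', of "P p" "P x" z]
          2 v up[OF cov(1)] H[of z] H[of "P x"] vals ge(1)
        unfolding V_def k_def by (smt (verit))
    next
      case 3
      define t' where "t' = V z / l"
      have l0: "0 < l" using kl k by simp
      have "0 \<le> l * U z" using ge l0 by simp
      then have "k * V z \<le> k * l" using 3 unfolding W_def mult.commute[of k l] by linarith
      then have "V z \<le> l" using k by simp
      then have t': "0 \<le> t'" "t' \<le> 1" using ge l0 by (auto simp: t'_def)
      have Vz: "V z = t' * l" using l0 by (simp add: t'_def)
      have "l * U z = l * (k - t' * k)" using 3 by (simp add: W_def Vz algebra_simps)
      then have Uz: "U z = k - t' * k" using l0 by simp
      have "z = (1 - t') *\<^sub>R P x + t' *\<^sub>R P t"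
      proof (rule slant_eqI[OF s])
        show "slant s z = slant s ((1 - t') *\<^sub>R P x + t' *\<^sub>R P t)"
          using Uz vals unfolding slant_on_segment U_def k_def by (simp add: algebra_simps)
        show "slant (- s) z = slant (- s) ((1 - t') *\<^sub>R P x + t' *\<^sub>R P t)"
          using Vz vals unfolding slant_on_segment V_def l_def by (simp add: algebra_simps)
      qed
      then show ?thesis using in_segmentI[OF t', of "P x" "P t"] by blast
    qed
  qed
  have wt: "\<not> w \<sqsubseteq> t" using cover_between[OF cov(5), of w] cov2(2) c by auto
  have yx: "\<not> y \<sqsubseteq> x" using cover_between[OF cov(1), of y] cov(3) c by auto
  have above: "v \<notin> {p, x, y, t}" if v: "v \<in> carrier L" "w \<sqsubseteq> v" for v
  proof -
    have "y \<sqsubseteq> v" using le_trans[of y w v] v c by simp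
    moreover have "v \<noteq> y" using v le_antisym[of w y] c by auto
    moreover have "\<not> y \<sqsubseteq> p" using le_antisym[of y p] c by auto
    ultimately show ?thesis using v wt yx by auto
  qed
  \<comment> \<open>an edge ending above \<open>w\<close> meets the frontier at most in \<open>P y\<close>\<close>
  have edge: "z \<in> I \<union> O' \<or> (z = P y \<and> v = y)"
    if v: "covered_by L v v'" "w \<sqsubseteq> v'" "v = y \<or> w \<sqsubseteq> v" "z \<in> closed_segment (P v) (P v')" for v v' z
  proof (rule ccontr)
    assume n: "\<not> (z \<in> I \<union> O' \<or> (z = P y \<and> v = y))"
    note cv = coverD[OF v(1)]
    have v': "v' \<notin> {p, x, y, t}" using above cv v by auto
    have "\<exists>q r. covered_by L q r \<and> q \<in> {p, x, y, t} \<and> r \<in> {p, x, y, t} \<and> z \<in> closed_segment (P q) (P r)"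
      using frontier[of z] n cov by blast
    then obtain q r where qr: "covered_by L q r" "q \<in> {p, x, y, t}" "r \<in> {p, x, y, t}"
      "z \<in> closed_segment (P q) (P r)" by blast
    have "(q, r) \<noteq> (v, v')" using qr v' by auto
    then have z: "z \<in> {P q, P r}" "z \<in> {P v, P v'}" using planar[OF qr(1) v(1)] qr(4) v(4) by blast+
    have qrc: "q \<in> carrier L" "r \<in> carrier L" using coverD[OF qr(1)] by auto
    have inj: "\<And>i j. i \<in> carrier L \<Longrightarrow> j \<in> carrier L \<Longrightarrow> P i = P j \<Longrightarrow> i = j"
      using inj_P by (auto dest: inj_onD)
    have "v \<in> {q, r} \<or> v' \<in> {q, r}" using z inj cv qrc by blast
    then have "v \<in> {p, x, y, t}" "z = P v" using z v' qr inj cv qrc by blast+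
    then have "v = y" using above[of v] v cv by blast
    then show False using n \<open>z = P v\<close> by auto
  qed
  have inside: "S \<subseteq> I" if S: "connected S" "S \<subseteq> I \<union> O'" "S \<inter> I \<noteq> {}" for S
  proof -
    have "I \<inter> O' \<inter> S = {}" by (auto simp: I_def O'_def)
    then have "O' \<inter> S = {}" using connectedD[OF S(1) op] S by blast
    then show ?thesis using S by blast
  qed
  have "v \<in> carrier L \<Longrightarrow> w \<sqsubseteq> v \<Longrightarrow> P v \<in> I" for v
  proof (induction v rule: order_induct)
    case (less v)
    show ?case
    proof (cases "v = w")
      case True
      define S where "S = closed_segment (P y) (P w) - {P y}"
      have yw: "P y \<noteq> P w" using up[OF cov2(1)] by auto
      have conn: "connected S"
      proof (rule connected_intermediate_closure)
        show "connected (open_segment (P y) (P w))" by (simp add: convex_connected)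
        show "open_segment (P y) (P w) \<subseteq> S" by (auto simp: S_def open_segment_def)
        show "S \<subseteq> closure (open_segment (P y) (P w))" using yw by (auto simp: S_def)
      qed
      \<comment> \<open>a parameter small enough for \<open>W\<close> to stay positive, since \<open>W\<close> equals \<open>k * (l - m)\<close> at \<open>P y\<close>\<close>
      define r where "r = min 1 (k * (l - m) / (2 * l * U (P w)))"
      have r: "0 < r" "r \<le> 1" using k m ml kl e by (auto simp: r_def)
      define z where "z = (1 - r) *\<^sub>R P y + r *\<^sub>R P w"
      have Uz: "U z = r * U (P w)"
        using vals unfolding z_def U_def slant_on_segment by (simp add: algebra_simps)
      have Vz: "V z = m"
        using vals m_def unfolding z_def V_def slant_on_segment by (simp add: algebra_simps)
      have "r * (2 * l * U (P w)) \<le> k * (l - m)"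
      proof -
        have pos: "0 < 2 * l * U (P w)" using kl k e by simp
        have "r \<le> k * (l - m) / (2 * l * U (P w))" by (simp add: r_def)
        then show ?thesis using pos by (simp add: pos_le_divide_eq)
      qed
      moreover have "0 < k * (l - m)" using k ml by simp
      ultimately have "l * (r * U (P w)) < k * (l - m)" by (simp add: algebra_simps)
      then have "0 < W z" unfolding W_def Uz Vz by (simp add: algebra_simps)
      then have "z \<in> I" using Uz Vz r e m by (simp add: I_def)
      moreover have "z \<in> S"
      proof -
        have "z \<in> closed_segment (P y) (P w)" unfolding z_def using r by (intro in_segmentI) auto
        moreover have "z \<noteq> P y" using Uz vals r e by auto
        ultimately show ?thesis by (simp add: S_def)
      qed
      moreover have "S \<subseteq> I \<union> O'" using edge[OF cov2(1)] c by (auto simp: S_def)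
      ultimately have "S \<subseteq> I" using inside[OF conn] by blast
      then show ?thesis using yw True by (auto simp: S_def)
    next
      case False
      then have "w \<sqsubset> v" using less.prems less.hyps by (auto simp: lless_eq)
      then obtain v' where v': "covered_by L v' v" "w \<sqsubseteq> v'" using lower_cover_exists less.hyps c by metis
      note cv = coverD[OF v'(1)]
      have "v' \<noteq> y" using above[of v'] cv v' by auto
      then have "closed_segment (P v') (P v) \<subseteq> I \<union> O'" using edge[OF v'(1) less.prems] v' by blast
      moreover have "P v' \<in> I" using less.IH[of v'] cv v' by (simp add: lless_eq)
      ultimately show ?thesis using inside[of "closed_segment (P v') (P v)"] by auto
    qed
  qed
  then have top: "P \<top> \<in> I" using c by simp
  have "t = \<top> \<or> t \<sqsubset> \<top>" using c by (auto simp: lless_eq)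
  then have "snd (P t) \<le> snd (P \<top>)" using height_mono[of P t \<top>] up c by auto
  then have "l \<le> U (P \<top>) + V (P \<top>)" using H[of "P t"] H[of "P \<top>"] vals by (simp add: l_def)
  then have "k * l \<le> k * U (P \<top>) + k * V (P \<top>)" using k mult_left_mono[of l "U (P \<top>) + V (P \<top>)" k] by (simp add: algebra_simps)
  moreover have "k * U (P \<top>) < l * U (P \<top>)" using kl top by (simp add: I_def)
  ultimately show False using top by (simp add: I_def W_def mult.commute)
qed

end

text \<open>An edge has a normal slope exactly if one of the two slanted coordinates is constant along it.\<close>
locale C1_placement = rectangular_frame L a b + planar_placement L P for L (structure) and a b P +
  assumes a_ne: "a \<noteq> \<bottom>" and b_ne: "b \<noteq> \<bottom>"
    and normal: "covered_by L x y \<Longrightarrow> x \<notin> meet_irreducibles L \<or> on_boundary L P x \<Longrightarrow>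
      slant 1 (P x) = slant 1 (P y) \<or> slant (- 1) (P x) = slant (- 1) (P y)"
begin

lemma swap_placement: "C1_placement L b a P"
proof -
  interpret r: rectangular_frame L b a by (rule swap)
  show ?thesis by unfold_locales (use a_ne b_ne normal in auto)
qed

text \<open>Edges from \<open>x\<close> that preserve the \<open>a\<close>-part run parallel to \<open>(1, s)\<close> and those that preserve the \<open>b\<close>-part
parallel to \<open>(1, - s)\<close>.\<close>
definition oriented where
  "oriented s x \<longleftrightarrow> (\<forall>y. covered_by L x y \<longrightarrow>
     (y \<sqinter> a = x \<sqinter> a \<longrightarrow> slant s (P x) = slant s (P y)) \<and>
     (y \<sqinter> b = x \<sqinter> b \<longrightarrow> slant (- s) (P x) = slant (- s) (P y)))"

definition branching where
  "branching x \<longleftrightarrow> (\<exists>y z. covered_by L x y \<and> covered_by L x z \<and> y \<noteq> z)"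

lemma branching_normal:
  assumes "s = 1 \<or> s = - 1" "branching x" "covered_by L x y"
  shows "slant s (P x) = slant s (P y) \<or> slant (- s) (P x) = slant (- s) (P y)"
proof -
  have "x \<notin> meet_irreducibles L" using assms(2) two_covers_not_irreducible unfolding branching_def by blast
  then show ?thesis using normal[OF assms(3)] assms(1) by auto
qed

text \<open>Both edges have normal slopes, and not the same one by \<open>no_parallel_covers\<close>; so one correctly
oriented edge determines the orientation of the other.\<close>
lemma orientedI:
  assumes s: "s = 1 \<or> s = - 1" and cov: "covered_by L x y" "covered_by L x z" "y \<noteq> z"
    and y: "y \<sqinter> a = x \<sqinter> a" and e: "slant s (P x) = slant s (P y) \<or> slant (- s) (P x) = slant (- s) (P z)"
  shows "oriented s x"
proof -
  have s': "- s = 1 \<or> - s = - 1" using s by auto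
  have br: "branching x" using cov unfolding branching_def by blast
  have parts: "y \<sqinter> b \<noteq> x \<sqinter> b" "z \<sqinter> b = x \<sqinter> b" "z \<sqinter> a \<noteq> x \<sqinter> a"
    using two_covers_parts[OF cov] cover_changes[OF cov(1)] y by auto
  have "\<not> (slant s (P x) = slant s (P y) \<and> slant s (P x) = slant s (P z))"
    "\<not> (slant (- s) (P x) = slant (- s) (P y) \<and> slant (- s) (P x) = slant (- s) (P z))"
    using no_parallel_covers[OF s cov] no_parallel_covers[OF s' cov] by auto
  then have yz: "slant s (P x) = slant s (P y)" "slant (- s) (P x) = slant (- s) (P z)"
    using branching_normal[OF s br cov(1)] branching_normal[OF s br cov(2)] e by auto
  show ?thesis
    unfolding oriented_def
  proof (intro allI impI conjI)
    fix w assume w: "covered_by L x w"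
    show "slant s (P x) = slant s (P w)" if "w \<sqinter> a = x \<sqinter> a"
    proof -
      have "w \<sqinter> b \<noteq> x \<sqinter> b" using cover_changes[OF w] that by auto
      then have "w = y" using cover_changing_b_unique[OF w cov(1)] parts by auto
      then show ?thesis using yz by simp
    qed
    show "slant (- s) (P x) = slant (- s) (P w)" if "w \<sqinter> b = x \<sqinter> b"
    proof -
      have "w \<sqinter> a \<noteq> x \<sqinter> a" using cover_changes[OF w] that by auto
      then have "w = z" using cover_changing_a_unique[OF w cov(2)] parts by auto
      then show ?thesis using yz by simp
    qed
  qed
qed

text \<open>Orientation passes from \<open>p\<close> to its cover \<open>y\<close> along an edge that preserves the \<open>a\<close>-part. If it were
reversed at \<open>y\<close>, then the edge from \<open>y\<close> to \<open>t = x \<squnion> y\<close> would prolong the one from \<open>p\<close> to \<open>y\<close>, and the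
other edge from \<open>y\<close> would enter the triangle with corners \<open>p\<close>, \<open>x\<close>, \<open>t\<close>.\<close>
lemma oriented_step:
  assumes s: "s = 1 \<or> s = - 1" and o: "oriented s p"
    and cov: "covered_by L p y" "y \<sqinter> a = p \<sqinter> a" "covered_by L p x" "x \<noteq> y" and br: "branching y"
  shows "oriented s y"
proof -
  note c = coverD[OF cov(1)] coverD[OF cov(3)]
  have xp: "x \<sqinter> b = p \<sqinter> b" "x \<sqinter> a \<noteq> p \<sqinter> a"
    using two_covers_parts[OF cov(3,1,4)] cov(2) cover_changes[OF cov(1)] by auto
  define t where "t = x \<squnion> y"
  have tc: "t \<in> carrier L" using c by (simp add: t_def)
  have "p \<squnion> y = y" "p \<squnion> x = x" using c by (auto intro!: le_antisym)
  moreover have "x \<squnion> y \<noteq> y" "y \<squnion> x \<noteq> x"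
  proof -
    show "x \<squnion> y \<noteq> y" using cover_between[OF cov(1), of x] c cov(4) join_left[of x y] by metis
    show "y \<squnion> x \<noteq> x" using cover_between[OF cov(3), of y] c cov(4) join_left[of y x] by metis
  qed
  ultimately have yt: "covered_by L y t" and xt: "covered_by L x t"
    using semimod[OF cov(3), of y] semimod[OF cov(1), of x] c
    by (auto simp: t_def join_comm[of L y x])
  have ta: "t \<sqinter> a \<noteq> y \<sqinter> a"
  proof
    assume "t \<sqinter> a = y \<sqinter> a"
    moreover have "x \<sqinter> a \<sqsubseteq> t \<sqinter> a" "p \<sqinter> a \<sqsubseteq> x \<sqinter> a"
      using le_iff_parts[of x t] le_iff_parts[of p x] c tc by (auto simp: t_def)
    ultimately show False using xp(2) cov(2) le_antisym[of "x \<sqinter> a" "p \<sqinter> a"] c by auto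
  qed
  obtain w where w: "covered_by L y w" "w \<noteq> t" using br unfolding branching_def by metis
  have wa: "w \<sqinter> a = y \<sqinter> a" using two_covers_parts[OF w(1) yt w(2)] ta by auto
  have u: "slant s (P p) = slant s (P y)" "slant (- s) (P p) = slant (- s) (P x)"
    using o cov xp(1) unfolding oriented_def by auto
  have "slant s (P y) = slant s (P w) \<or> slant (- s) (P y) = slant (- s) (P t)"
  proof (rule ccontr)
    assume n: "\<not> ?thesis"
    then have "slant (- s) (P y) = slant (- s) (P w)" "slant s (P y) = slant s (P t)"
      using branching_normal[OF s br w(1)] branching_normal[OF s br yt] by auto
    then show False
      using no_path_into_triangle[OF s cov(3,1,4) xt yt w u(1) _ u(2)] by blast
  qed
  then show ?thesis using orientedI[OF s w(1) yt w(2) wa] by blast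
qed

lemma oriented_swap: "C1_placement.oriented L b a P (- s) x \<longleftrightarrow> oriented s x"
proof -
  interpret r: C1_placement L b a P by (rule swap_placement)
  show ?thesis unfolding oriented_def r.oriented_def by auto
qed

text \<open>If \<open>x\<close> is not its own \<open>a\<close>-part, then it covers some \<open>y\<close> with the same \<open>a\<close>-part, and \<open>y\<close> also has two
covers, because it is not above \<open>a\<close>.\<close>
lemma oriented_descend:
  assumes s: "s = 1 \<or> s = - 1" and x: "x \<in> carrier L" "branching x" "x \<sqinter> a \<noteq> x"
    and IH: "\<And>y. y \<in> carrier L \<Longrightarrow> y \<sqsubset> x \<Longrightarrow> branching y \<Longrightarrow> oriented s y"
  shows "oriented s x"
proof -
  have "x \<sqinter> a \<sqsubset> x" using x by (simp add: lless_eq)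
  then obtain y where y: "covered_by L y x" "x \<sqinter> a \<sqsubseteq> y" using lower_cover_exists x by (metis a_in meet_closed)
  note c = coverD[OF y(1)]
  have "x \<sqinter> a \<sqsubseteq> y \<sqinter> a" "y \<sqinter> a \<sqsubseteq> x \<sqinter> a" using y c le_iff_parts[of y x] by auto
  then have xa: "x \<sqinter> a = y \<sqinter> a" using c by (intro le_antisym) auto
  have "\<not> a \<sqsubseteq> x" using above_a_one_cover x(2) unfolding branching_def by blast
  then have "\<not> a \<sqsubseteq> y" using le_trans[of a y x] c by auto
  then obtain z where z: "covered_by L y z" "z \<noteq> x" using two_covers_exist[OF c(1) _ y(1) xa] by metis
  have "branching y" using z y(1) unfolding branching_def by blast
  then have "oriented s y" using IH[of y] c by (simp add: lless_eq)
  then show ?thesis using oriented_step[OF s _ y(1) xa z(1,2) x(2)] by blast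
qed

lemma all_oriented:
  assumes s: "s = 1 \<or> s = - 1" and o: "oriented s \<bottom>" and "x \<in> carrier L" "branching x"
  shows "oriented s x"
  using assms(3,4)
proof (induction x rule: order_induct)
  case (less x)
  interpret r: C1_placement L b a P by (rule swap_placement)
  have s': "- s = 1 \<or> - s = - 1" using s by auto
  show ?case
  proof (cases "x \<sqinter> a \<noteq> x")
    case True
    then show ?thesis using oriented_descend[OF s less.hyps less.prems] less.IH by blast
  next
    case False
    show ?thesis
    proof (cases "x \<sqinter> b \<noteq> x")
      case True
      then have "r.oriented (- s) x"
        using r.oriented_descend[OF s' less.hyps less.prems] less.IH by (simp add: oriented_swap)
      then show ?thesis by (simp add: oriented_swap)
    next
      case F2: False
      then have "x \<sqsubseteq> a" "x \<sqsubseteq> b" using False meet_right[OF less.hyps a_in] meet_right[OF less.hyps b_in] by auto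
      then have "x = \<bottom>" using less.hyps meet_ab le_meet_iff[of a b x] below_bottom by auto
      then show ?thesis using o by simp
    qed
  qed
qed

lemma orientation_exists:
  obtains s where "s = 1 \<or> s = - 1" "oriented s \<bottom>"
proof -
  obtain u v where uv: "covered_by L \<bottom> u" "covered_by L \<bottom> v" "u \<noteq> v"
    using below_a_two_covers[OF b_ne, of \<bottom>] a_ne by auto
  obtain y z where yz: "covered_by L \<bottom> y" "covered_by L \<bottom> z" "y \<noteq> z" "y \<sqinter> a = \<bottom> \<sqinter> a"
    using two_covers_parts[OF uv] uv by metis
  have "branching \<bottom>" using uv unfolding branching_def by blast
  then have "slant 1 (P \<bottom>) = slant 1 (P y) \<or> slant (- 1) (P \<bottom>) = slant (- 1) (P y)"
    using branching_normal[of 1 \<bottom> y] yz by simp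
  then show thesis using orientedI[OF _ yz] that by blast
qed

end

locale oriented_placement = C1_placement L a b P for L (structure) and a b P +
  fixes s :: real
  assumes sign: "s = 1 \<or> s = - 1" and oriented_bottom: "oriented s \<bottom>"
begin

lemma swap_oriented: "oriented_placement L b a P (- s)"
proof -
  interpret r: C1_placement L b a P by (rule swap_placement)
  show ?thesis by unfold_locales (use sign oriented_bottom in \<open>auto simp: oriented_swap\<close>)
qed

text \<open>Such an \<open>x\<close> has two covers by \<open>two_covers_exist\<close> and hence is oriented.\<close>
lemma edge_not_above:
  assumes "covered_by L x y" "x \<sqinter> a = y \<sqinter> a" "\<not> a \<sqsubseteq> x"
  shows "slant s (P x) = slant s (P y)"
proof -
  obtain z where "covered_by L x z" "z \<noteq> y"
    using two_covers_exist[of x y] coverD[OF assms(1)] assms by metis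
  then have "branching x" using assms(1) unfolding branching_def by blast
  then have "oriented s x" using all_oriented[OF sign oriented_bottom] coverD[OF assms(1)] by blast
  then show ?thesis using assms unfolding oriented_def by auto
qed

text \<open>The path \<open>D\<close> of the spine divides the strip of heights into the part \<open>A\<close> on its inner and the part \<open>B\<close> on its
outer side; both are closed, and they meet in \<open>D\<close> only. An edge that is not in the path is disjoint
from \<open>D\<close> apart from its ends, so it stays in \<open>A\<close> or in \<open>B\<close> by connectedness. Going upwards from \<open>0\<close>, no edge
gets into \<open>B\<close>: the path can be left only at an element \<open>w < a\<close>, where the
orientation makes the spine turn to the outer and the other edge to the inner side.\<close>
lemma side_spine: "side_chain L P s spine"
proof -
  define D where "D = drawn_elems L P spine"
  define A where "A = {z. \<exists>d\<in>D. snd z = snd d \<and> s * fst d \<le> s * fst z}"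
  define B where "B = {z. \<exists>d\<in>D. snd z = snd d \<and> s * fst z \<le> s * fst d}"
  have spc: "\<And>x. x \<in> spine \<Longrightarrow> x \<in> carrier L" using spine_carrier by auto
  have spch: "x \<sqsubseteq> y \<or> y \<sqsubseteq> x" if "x \<in> spine" "y \<in> spine" for x y
    using spine_maxchain that unfolding pred_on.maxchain_def chain_iff by blast
  have inj: "\<And>i j. i \<in> carrier L \<Longrightarrow> j \<in> carrier L \<Longrightarrow> P i = P j \<Longrightarrow> i = j"
    using inj_P by (auto dest: inj_onD)
  have mono: "snd (P x) < snd (P y)" if "x \<in> carrier L" "y \<in> carrier L" "x \<sqsubseteq> y" "x \<noteq> y" for x y
    using height_mono[of P x y] up that by (simp add: lless_eq)
  \<comment> \<open>the path has only one point at each height, because heights increase along the spine\<close>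
  have unique: "d = e" if de: "d \<in> D" "e \<in> D" "snd d = snd e" for d e
  proof -
    obtain x y where xy: "x \<in> spine" "y \<in> spine" "x = y \<or> covered_by L x y" "d \<in> closed_segment (P x) (P y)"
      using drawn_elems_cases de(1) unfolding D_def by metis
    obtain u v where uv: "u \<in> spine" "v \<in> spine" "u = v \<or> covered_by L u v" "e \<in> closed_segment (P u) (P v)"
      using drawn_elems_cases de(2) unfolding D_def by metis
    have bounds: "snd (P x) \<le> snd d \<and> snd d \<le> snd (P y) \<and> (snd d = snd (P x) \<longrightarrow> d = P x) \<and> (snd d = snd (P y) \<longrightarrow> d = P y)"
      if "x = y \<or> covered_by L x y" "d \<in> closed_segment (P x) (P y)" for x y d
      using that segment_height_bounds[OF up, of x y d] segment_height_unique[OF up, of x y d "P x"]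
        segment_height_unique[OF up, of x y d "P y"] by auto
    note bd = bounds[OF xy(3,4)] and be = bounds[OF uv(3,4)]
    have later: "p = q"
      if h: "x \<in> spine" "y \<in> spine" "x = y \<or> covered_by L x y" "u \<in> spine" "x \<sqsubseteq> u" "x \<noteq> u"
        "snd p \<le> snd (P y)" "snd (P u) \<le> snd q" "snd p = snd q"
        "snd p = snd (P y) \<longrightarrow> p = P y" "snd q = snd (P u) \<longrightarrow> q = P u" for x y u and p q :: "real \<times> real"
    proof -
      have "x \<sqsubseteq> y" using h(3) coverD[of x y] spc[OF h(1)] by auto
      have "y \<sqsubseteq> u"
      proof (rule ccontr)
        assume n: "\<not> y \<sqsubseteq> u"
        then have "u \<sqsubseteq> y" using spch h by blast
        then have "u = y \<or> u = x" using h(3,5) cover_between[of x y u] spc h by (metis le_antisym)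
        then show False using n h(6) le_refl[OF spc[OF h(2)]] by metis
      qed
      then have "snd (P y) \<le> snd (P u)" using mono[of y u] spc h by (cases "y = u") auto
      then have e: "snd p = snd (P y)" "snd q = snd (P u)" "snd (P y) = snd (P u)" using h by auto
      then have "y = u" using mono[of y u] \<open>y \<sqsubseteq> u\<close> spc h by force
      then show ?thesis using e h by auto
    qed
    show ?thesis
    proof (cases "x = u")
      case False
      show ?thesis
        using spch[OF xy(1) uv(1)]
      proof
        assume "x \<sqsubseteq> u"
        from later[OF xy(1-3) uv(1) this False] show ?thesis using bd be de(3) by blast
      next
        assume "u \<sqsubseteq> x"
        from later[OF uv(1-3) xy(1) this False[symmetric]] have "e = d" using bd be de(3)[symmetric] by blast
        then show ?thesis by simp
      qed
    next
      case True
      show ?thesis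
      proof (cases "x = y \<or> u = v")
        case True
        then show ?thesis using \<open>x = u\<close> bd be de(3) xy(4) uv(4) by auto
      next
        case False
        then have c: "covered_by L x y" "covered_by L x v" using xy uv \<open>x = u\<close> by auto
        have "y = v"
          using spch[OF xy(2) uv(2)] cover_between[OF c(1), of v] cover_between[OF c(2), of y] coverD[OF c(1)] coverD[OF c(2)] by auto
        then show ?thesis using segment_height_unique[OF up[OF c(1)]] xy uv de(3) \<open>x = u\<close> by blast
      qed
    qed
  qed
  have AB: "A \<inter> B \<subseteq> D"
  proof
    fix z assume "z \<in> A \<inter> B"
    then obtain d e where de: "d \<in> D" "e \<in> D" "snd z = snd d" "snd z = snd e" "s * fst d \<le> s * fst z" "s * fst z \<le> s * fst e"
      unfolding A_def B_def by blast
    then have "d = e" using unique by simp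
    then have "z = d" using de sign by (auto simp: prod_eq_iff)
    then show "z \<in> D" using de by simp
  qed
  have DA: "D \<subseteq> A" unfolding A_def by auto
  have total: "z \<in> A \<union> B" if z: "snd (P \<bottom>) \<le> snd z" "snd z \<le> snd (P \<top>)" for z
  proof -
    obtain d where d: "d \<in> D" "snd z = snd d"
      using path_point[of P spine "snd z"] up spine_carrier spine_next z unfolding D_def by metis
    have "s * fst d \<le> s * fst z \<or> s * fst z \<le> s * fst d" by linarith
    then show ?thesis using d unfolding A_def B_def Un_iff mem_Collect_eq by blast
  qed
  have compactD: "compact D"
  proof -
    have "finite {(x, y). x \<in> spine \<and> y \<in> spine \<and> covered_by L x y}"
      by (rule finite_subset[of _ "carrier L \<times> carrier L"]) (use spc fin in auto)
    then have "compact (\<Union>(x, y)\<in>{(x, y). x \<in> spine \<and> y \<in> spine \<and> covered_by L x y}. closed_segment (P x) (P y))"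
      by (rule compact_UN) (auto simp: compact_segment)
    moreover have "compact (P ` spine)"
      using finite_subset[OF spine_carrier(1) fin] by (simp add: finite_imp_compact)
    ultimately show ?thesis unfolding D_def drawn_elems_def by (rule compact_Un[rotated])
  qed
  \<comment> \<open>a compact set plus a closed ray is closed\<close>
  have cl: "closed {z. \<exists>d\<in>D. snd z = snd d \<and> r * fst d \<le> r * fst z}" for r :: real
  proof -
    have "closed {v :: real \<times> real. snd v = 0 \<and> 0 \<le> r * fst v}"
      by (intro closed_Collect_conj closed_Collect_eq closed_Collect_le continuous_intros)
    then have "closed (\<Union>d\<in>D. \<Union>v\<in>{v. snd v = 0 \<and> 0 \<le> r * fst v}. {d + v})"
      by (rule compact_closed_sums[OF compactD])
    moreover have "(\<Union>d\<in>D. \<Union>v\<in>{v. snd v = 0 \<and> 0 \<le> r * fst v}. {d + v}) =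
      {z. \<exists>d\<in>D. snd z = snd d \<and> r * fst d \<le> r * fst z}" (is "?l = ?r")
    proof
      show "?l \<subseteq> ?r"
      proof
        fix z assume "z \<in> ?l"
        then obtain d v where dv: "d \<in> D" "snd v = 0" "0 \<le> r * fst v" "z = d + v" by auto
        then have "snd z = snd d" "r * fst d \<le> r * fst z" by (simp_all add: distrib_left)
        then show "z \<in> ?r" using dv(1) by blast
      qed
      show "?r \<subseteq> ?l"
      proof
        fix z assume "z \<in> ?r"
        then obtain d where d: "d \<in> D" "snd z = snd d" "r * fst d \<le> r * fst z" by auto
        then have "z - d \<in> {v. snd v = 0 \<and> 0 \<le> r * fst v}" by (simp add: algebra_simps)
        moreover have "z \<in> {d + (z - d)}" by simp
        ultimately show "z \<in> ?l" using d(1) by blast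
      qed
    qed
    ultimately show ?thesis by simp
  qed
  have closedA: "closed A" unfolding A_def by (rule cl)
  have "B = {z. \<exists>d\<in>D. snd z = snd d \<and> - s * fst d \<le> - s * fst z}" unfolding B_def by simp
  then have closedB: "closed B" using cl[of "- s"] by simp
  have spine_onD: "x \<in> spine" if x: "x \<in> carrier L" "P x \<in> D" for x
  proof -
    obtain u v where uv: "u \<in> spine" "v \<in> spine" "u = v \<or> covered_by L u v" "P x \<in> closed_segment (P u) (P v)"
      using drawn_elems_cases x(2) unfolding D_def by metis
    then have "x = u \<or> x = v" using avoid[of u v x] inj[of x u] x(1) spc by auto
    then show ?thesis using uv by auto
  qed
  have edge: "closed_segment (P w) (P v) \<subseteq> A" if wv: "covered_by L w v" and wA: "P w \<in> A" for w v
  proof (cases "w \<in> spine \<and> v \<in> spine")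
    case True
    then have "closed_segment (P w) (P v) \<subseteq> D" using wv unfolding D_def drawn_elems_def by blast
    then show ?thesis using DA by blast
  next
    case False
    note c = coverD[OF wv]
    define S where "S = open_segment (P w) (P v)"
    have ne: "P w \<noteq> P v" using up[OF wv] by auto
    have conn: "connected S" unfolding S_def by (simp add: convex_connected)
    have clS: "closure S = closed_segment (P w) (P v)" using ne by (simp add: S_def)
    have Sne: "S \<noteq> {}" using ne by (simp add: S_def)
    have SD: "S \<inter> D = {}"
    proof (rule ccontr)
      assume "S \<inter> D \<noteq> {}"
      then obtain z where z: "z \<in> closed_segment (P w) (P v)" "z \<noteq> P w" "z \<noteq> P v" "z \<in> D"
        by (auto simp: S_def open_segment_def)
      obtain i j where ij: "i \<in> spine" "j \<in> spine" "i = j \<or> covered_by L i j" "z \<in> closed_segment (P i) (P j)"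
        using drawn_elems_cases z(4) unfolding D_def by metis
      show False
      proof (cases "i = j")
        case True
        then have "z = P i" using ij by simp
        then show False using avoid[OF wv, of i] z ij spc by auto
      next
        case F: False
        then have "covered_by L i j" "(i, j) \<noteq> (w, v)" using ij False by auto
        then show False using planar[OF wv, of i j] z ij by blast
      qed
    qed
    have "S \<subseteq> A \<union> B"
    proof
      fix z assume "z \<in> S"
      then have "z \<in> closed_segment (P w) (P v)" by (simp add: S_def open_segment_def)
      then have "snd (P w) \<le> snd z" "snd z \<le> snd (P v)" using segment_height_bounds[OF up[OF wv]] by auto
      moreover have "snd (P \<bottom>) \<le> snd (P w)" using mono[of \<bottom> w] c by (cases "w = \<bottom>") auto
      moreover have "snd (P v) \<le> snd (P \<top>)" using mono[of v \<top>] c by (cases "v = \<top>") auto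
      ultimately show "z \<in> A \<union> B" by (intro total) auto
    qed
    then have "S \<subseteq> A \<or> S \<subseteq> B"
      using conn closedA closedB AB SD unfolding connected_closed by blast
    moreover have "\<not> S \<subseteq> B"
    proof (cases "w \<in> spine")
      case F: False
      show ?thesis
      proof
        assume "S \<subseteq> B"
        then have "closed_segment (P w) (P v) \<subseteq> B" using closure_minimal[OF _ closedB, of S] clS by simp
        then have "P w \<in> D" using wA AB by auto
        then show False using spine_onD c F by blast
      qed
    next
      case True
      then have v: "v \<notin> spine" using False by simp
      have wa: "w \<sqsubseteq> a" "\<not> a \<sqsubseteq> w" using True v le_trans[of a w v] c by (auto simp: spine_def)
      have "w \<sqsubset> a" using wa c by (auto simp: lless_eq)
      then obtain e where e: "covered_by L w e" "e \<sqsubseteq> a" using upper_cover_exists[of w a] c by auto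
      note ce = coverD[OF e(1)]
      have es: "e \<in> spine" using ce e by (simp add: spine_def)
      then have ev: "e \<noteq> v" using v by auto
      have "e \<sqinter> a = e" "w \<sqinter> a = w" using ce e wa meet_absorb1 by auto
      then have "v \<sqinter> a = w \<sqinter> a \<and> e \<sqinter> b = w \<sqinter> b" using two_covers_parts[OF e(1) wv ev] ce by auto
      moreover have "branching w" using wv e(1) ev unfolding branching_def by blast
      then have "oriented s w" using all_oriented[OF sign oriented_bottom] c by blast
      ultimately have u: "slant s (P w) = slant s (P v)" "slant (- s) (P w) = slant (- s) (P e)"
        using wv e(1) unfolding oriented_def by auto
      \<comment> \<open>any height that both edges from \<open>w\<close> pass through: there the two edges are compared\<close>
      define h where "h = (snd (P w) + min (snd (P v)) (snd (P e))) / 2"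
      have h: "snd (P w) < h" "h < snd (P v)" "h < snd (P e)" using up[OF wv] up[OF e(1)] by (auto simp: h_def)
      obtain z where z: "z \<in> S" "snd z = h"
        unfolding S_def by (rule segment_at_height[OF up[OF wv] h(1,2)])
      obtain d where d: "d \<in> open_segment (P w) (P e)" "snd d = h"
        by (rule segment_at_height[OF up[OF e(1)] h(1,3)])
      have dD: "d \<in> D"
        using d(1) True es e(1) unfolding D_def drawn_elems_def open_segment_def by blast
      have "slant s z = slant s (P w)"
        using z(1) u by (auto simp: S_def open_segment_def in_segment slant_on_segment)
      moreover have "slant (- s) d = slant (- s) (P w)"
        using d(1) u by (auto simp: open_segment_def in_segment slant_on_segment)
      ultimately have "s * fst d \<le> s * fst z"
        using slant_height[of s "P w"] h z(2) d(2) unfolding slant_def by simp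
      moreover have "snd z = snd d" using z(2) d(2) by simp
      ultimately have "z \<in> A" using dD unfolding A_def by blast
      then show ?thesis using AB SD z(1) by blast
    qed
    ultimately have "S \<subseteq> A" by blast
    then show ?thesis using closure_minimal[OF _ closedA, of S] clS by simp
  qed
  have PA: "P x \<in> A" if "x \<in> carrier L" for x
    using that
  proof (induction x rule: order_induct)
    case (less x)
    show ?case
    proof (cases "x \<in> spine")
      case True
      then show ?thesis using DA unfolding D_def drawn_elems_def by blast
    next
      case False
      then have "x \<noteq> \<bottom>" by (auto simp: spine_def)
      then have "\<bottom> \<sqsubset> x" using less.hyps by (auto simp: lless_eq)
      then obtain w where w: "covered_by L w x" using lower_cover_exists less.hyps by blast
      then have "P w \<in> A" using less.IH[of w] coverD[OF w] by (simp add: lless_eq)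
      then show ?thesis using edge[OF w] by auto
    qed
  qed
  have all: "z \<in> A" if z: "z \<in> drawn_elems L P (carrier L)" for z
  proof -
    obtain x y where xy: "x \<in> carrier L" "x = y \<or> covered_by L x y" "z \<in> closed_segment (P x) (P y)"
      using drawn_elems_cases[OF z] by metis
    then show ?thesis using PA[OF xy(1)] edge[of x y] by auto
  qed
  show ?thesis
    unfolding side_chain_def
  proof (intro conjI ballI impI spine_maxchain)
    fix z c assume z: "z \<in> drawn_elems L P (carrier L)" and c: "c \<in> drawn_elems L P spine" "snd z = snd c"
    obtain d where "d \<in> D" "snd z = snd d" "s * fst d \<le> s * fst z" using all[OF z] unfolding A_def by blast
    then show "s * fst c \<le> s * fst z" using unique[of c d] c unfolding D_def by auto
  qed
qed

lemma spine_normal: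
  assumes "x \<in> spine" "covered_by L x y"
  shows "slant s (P x) = slant s (P y) \<or> slant (- s) (P x) = slant (- s) (P y)"
proof -
  have "on_boundary L P x" unfolding on_boundary_def using side_spine assms(1) sign by auto
  then show ?thesis using normal[OF assms(2)] sign by auto
qed

text \<open>Descend from \<open>x\<close> to its \<open>a\<close>-part through elements with the same \<open>a\<close>-part; the edges up to \<open>x\<close> suffice
for this, which allows the lemma to be used before all edges are under control.\<close>
lemma coordinate_from_part:
  assumes "x \<in> carrier L"
    "\<And>p q. covered_by L p q \<Longrightarrow> q \<sqsubseteq> x \<Longrightarrow> p \<sqinter> a = q \<sqinter> a \<Longrightarrow> slant s (P p) = slant s (P q)"
  shows "slant s (P x) = slant s (P (x \<sqinter> a))"
  using assms
proof (induction x rule: order_induct)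
  case (less x)
  show ?case
  proof (cases "x \<sqinter> a = x")
    case False
    then have "x \<sqinter> a \<sqsubset> x" using less.hyps by (simp add: lless_eq)
    then obtain y where y: "covered_by L y x" "x \<sqinter> a \<sqsubseteq> y"
      using lower_cover_exists less.hyps by (metis a_in meet_closed)
    note c = coverD[OF y(1)]
    have ya: "y \<sqinter> a = x \<sqinter> a" using y c le_iff_parts[of y x] by (intro le_antisym) auto
    have "slant s (P y) = slant s (P (y \<sqinter> a))"
    proof (rule less.IH)
      show "y \<in> carrier L" "y \<sqsubset> x" using c by (auto simp: lless_eq)
      show "slant s (P p) = slant s (P q)" if "covered_by L p q" "q \<sqsubseteq> y" "p \<sqinter> a = q \<sqinter> a" for p q
        using less.prems[OF that(1) _ that(3)] le_trans[OF that(2) c(3)] coverD[OF that(1)] c by blast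
    qed
    moreover have "slant s (P y) = slant s (P x)" using less.prems[OF y(1) _ ya] c by simp
    ultimately show ?thesis using ya by simp
  qed simp
qed

lemma coordinate_not_above:
  assumes "x \<in> carrier L" "\<not> a \<sqsubseteq> x" shows "slant s (P x) = slant s (P (x \<sqinter> a))"
proof (rule coordinate_from_part[OF assms(1)])
  fix p q assume pq: "covered_by L p q" "q \<sqsubseteq> x" "p \<sqinter> a = q \<sqinter> a"
  note c = coverD[OF pq(1)]
  have "p \<sqsubseteq> x" using le_trans[of p q x] c pq assms by simp
  then have "\<not> a \<sqsubseteq> p" using le_trans[of a p x] c assms by auto
  then show "slant s (P p) = slant s (P q)" by (rule edge_not_above[OF pq(1,3)])
qed

text \<open>An edge within the ideal of \<open>a\<close> preserves the \<open>b\<close>-part \<open>0\<close>, so it runs parallel to \<open>(1, - s)\<close>, and going upwards increases the coordinate.\<close>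
lemma coordinate_increasing:
  assumes "x \<in> carrier L" "y \<in> carrier L" "x \<sqsubset> y" "y \<sqsubseteq> a"
  shows "slant s (P x) < slant s (P y)"
  using assms(1,3)
proof (induction x rule: upward_induct)
  case (greater x)
  interpret r: oriented_placement L b a P "- s" by (rule swap_oriented)
  have xy: "x \<sqsubseteq> y" "x \<noteq> y" using greater.prems by (auto simp: lless_eq)
  obtain z where z: "covered_by L x z" "z \<sqsubseteq> y" using upper_cover_exists[OF greater.hyps assms(2) greater.prems] .
  note c = coverD[OF z(1)]
  have za: "z \<sqsubseteq> a" "x \<sqsubseteq> a" using le_trans[of z y a] le_trans[of x y a] z xy c assms by auto
  have "\<not> b \<sqsubseteq> x"
  proof
    assume "b \<sqsubseteq> x"
    then have "b \<sqsubseteq> a" using le_trans[of b x a] za c by auto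
    then show False using meet_a_bottom[of b] meet_absorb1[of b b] b_ne by simp
  qed
  then have "slant (- s) (P x) = slant (- s) (P z)"
    using r.edge_not_above[OF z(1)] meet_a_bottom[of x] meet_a_bottom[of z] za c by simp
  then have lt: "slant s (P x) < slant s (P z)"
    using up[OF z(1)] slant_height[of s "P x"] slant_height[of s "P z"] by linarith
  show ?case
  proof (cases "z = y")
    case False
    then have "slant s (P z) < slant s (P y)" using greater.IH[of z] z c by (simp add: lless_eq)
    then show ?thesis using lt by simp
  qed (use lt in simp)
qed

text \<open>Edges within the filter of \<open>a\<close> have normal slopes, so going upwards does not decrease any coordinate.\<close>
lemma coordinate_above:
  assumes "x \<in> carrier L" "a \<sqsubseteq> x" shows "slant s (P a) \<le> slant s (P x)"
  using assms
proof (induction x rule: order_induct)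
  case (less x)
  show ?case
  proof (cases "x = a")
    case False
    then have "a \<sqsubset> x" using less.prems by (auto simp: lless_eq)
    then obtain y where y: "covered_by L y x" "a \<sqsubseteq> y" using lower_cover_exists[of a x] less.hyps by auto
    note c = coverD[OF y(1)]
    have "y \<in> spine" using y c by (simp add: spine_def)
    then have "slant s (P y) \<le> slant s (P x)"
      using spine_normal[OF _ y(1)] up[OF y(1)] slant_height[of s "P x"] slant_height[of s "P y"] by fastforce
    then show ?thesis using less.IH[of y] y c by (force simp: lless_eq)
  qed simp
qed

text \<open>It remains to treat \<open>p\<close> above \<open>a\<close>, where the slope is normal because \<open>p\<close> is on the boundary. The
other normal slope would keep \<open>slant (- s)\<close> fixed; but this coordinate increases, since the
\<open>b\<close>-part does, or, if \<open>q\<close> is above \<open>b\<close>, since it is at least as large at \<open>q\<close> as at \<open>b\<close>.\<close>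
lemma edge_along:
  assumes "covered_by L p q" "p \<sqinter> a = q \<sqinter> a"
  shows "slant s (P p) = slant s (P q)"
proof (cases "a \<sqsubseteq> p")
  case False
  then show ?thesis using edge_not_above assms by blast
next
  case True
  interpret r: oriented_placement L b a P "- s" by (rule swap_oriented)
  note c = coverD[OF assms(1)]
  have "p \<in> spine" using True c by (simp add: spine_def)
  moreover have "slant (- s) (P p) \<noteq> slant (- s) (P q)"
  proof -
    have "p \<noteq> \<top>" using c top_least by metis
    then have nb: "\<not> b \<sqsubseteq> p" using not_above_both True c by blast
    note p = r.coordinate_not_above[OF c(1) nb]
    have "slant (- s) (P p) < slant (- s) (P q)"
    proof (cases "b \<sqsubseteq> q")
      case False
      have "p \<sqinter> b \<sqsubset> q \<sqinter> b"
        using le_iff_parts[of p q] cover_changes[OF assms(1)] assms(2) c by (auto simp: lless_eq)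
      then have "slant (- s) (P (p \<sqinter> b)) < slant (- s) (P (q \<sqinter> b))" using r.coordinate_increasing c by simp
      then show ?thesis using p r.coordinate_not_above[OF c(2) False] by linarith
    next
      case True
      have "p \<sqinter> b \<noteq> b" using nb meet_left[OF c(1) b_in] by metis
      then have "p \<sqinter> b \<sqsubset> b" using c by (simp add: lless_eq)
      then have "slant (- s) (P (p \<sqinter> b)) < slant (- s) (P b)" using r.coordinate_increasing c by simp
      then show ?thesis using p r.coordinate_above[OF c(2) True] by linarith
    qed
    then show ?thesis by simp
  qed
  ultimately show ?thesis using spine_normal assms(1) by blast
qed

lemma coordinate: "x \<in> carrier L \<Longrightarrow> slant s (P x) = slant s (P (x \<sqinter> a))"
  using coordinate_from_part edge_along by blast

text \<open>Every \<open>P x\<close> has the coordinates of its two parts, which is the required form up to the factor \<open>2\<close>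
in \<open>slant_height\<close>.\<close>
lemma coordinatized:
  "coordinatized L a b (\<lambda>c. slant s (P c) / 2) (\<lambda>c. slant (- s) (P c) / 2) s P"
proof -
  interpret r: oriented_placement L b a P "- s" by (rule swap_oriented)
  show ?thesis
  proof unfold_locales
    show "s = 1 \<or> s = - 1" by (rule sign)
    show "P x = (s * (slant (- s) (P (x \<sqinter> b)) / 2 - slant s (P (x \<sqinter> a)) / 2),
        slant (- s) (P (x \<sqinter> b)) / 2 + slant s (P (x \<sqinter> a)) / 2)" if "x \<in> carrier L" for x
      using coordinate[OF that, symmetric] r.coordinate[OF that, symmetric] sign
      by (auto simp: slant_def prod_eq_iff add_divide_distrib diff_divide_distrib)
    show "slant s (P x) / 2 < slant s (P y) / 2"
      if "x \<in> carrier L" "y \<in> carrier L" "x \<sqsubset> y" "y \<sqsubseteq> a" for x y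
      using coordinate_increasing[OF that] by simp
    show "slant (- s) (P x) / 2 < slant (- s) (P y) / 2"
      if "x \<in> carrier L" "y \<in> carrier L" "x \<sqsubset> y" "y \<sqsubseteq> b" for x y
      using r.coordinate_increasing[OF that] by simp
  qed
qed

end

section \<open>Quotients of C1-diagrams\<close>

lemma planar_diagram_places:
  assumes "planar_diagram L F"
  obtains P where "draws L F P"
proof
  have bij: "bij_betw (elem F) (vertices F) (carrier L)"
    and "edges F = {(p, q). p \<in> vertices F \<and> q \<in> vertices F \<and> covered_by L (elem F p) (elem F q)}"
    using assms by (auto simp: planar_diagram_def hasse_diagram_def)
  then show "draws L F (\<lambda>x. pos F (the_inv_into (vertices F) (elem F) x))"
    by (simp add: draws_def the_inv_into_f_f bij_betw_def)
qed

lemma parallel_slant: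
  "parallel (q - p) (1, 1) \<Longrightarrow> slant 1 p = slant 1 q"
  "parallel (q - p) (1, - 1) \<Longrightarrow> slant (- 1) p = slant (- 1) q"
  by (auto simp: parallel_def slant_def prod_eq_iff algebra_simps)

lemma C1_diagram_coordinates:
  assumes L: "slim_rectangular L" and F: "C1_diagram L F"
  obtains a b f g s P where "coordinatized L a b f g s P" "draws L F P"
proof -
  obtain a b where fr: "rectangular_frame L a b" and ne: "a \<noteq> \<bottom>\<^bsub>L\<^esub>" "b \<noteq> \<bottom>\<^bsub>L\<^esub>"
    using slim_rectangular_frame[OF L] .
  interpret rectangular_frame L a b by (rule fr)
  \<comment> \<open>\<open>a\<close> and \<open>b\<close> are incomparable, so the diagram is not one of a chain\<close>
  have "\<not> total_order L"
  proof
    assume "total_order L"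
    then interpret T: total_order L .
    have "le L a b \<or> le L b a" using T.total_order_total by simp
    then show False using meet_ab meet_absorb1[of a b] meet_absorb2[of a b] ne by auto
  qed
  then have pl: "planar_diagram L F"
    and slope: "\<And>p q. (p, q) \<in> edges F \<Longrightarrow>
        if elem F p \<in> meet_irreducibles L \<and> p \<notin> boundary L F
        then precipitous F (p, q) else normal_slope F (p, q)"
    using F unfolding C1_diagram_def finite_chain_def by auto
  obtain P where d: "draws L F P" using planar_diagram_places[OF pl] .
  interpret planar_placement L P using pl planar_diagram_iff[OF fin_lattice_axioms d] by simp
  interpret C1_placement L a b P
  proof
    show "a \<noteq> \<bottom>\<^bsub>L\<^esub>" "b \<noteq> \<bottom>\<^bsub>L\<^esub>" by (rule ne)+
    fix x y assume xy: "covered_by L x y" and x: "x \<notin> meet_irreducibles L \<or> on_boundary L P x"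
    obtain p q where pq: "(p, q) \<in> edges F" "p \<in> vertices F" "q \<in> vertices F" "elem F p = x" "elem F q = y"
      "pos F p = P x" "pos F q = P y" using draws_edge_elems[OF d xy] .
    have "normal_slope F (p, q)" using slope[OF pq(1)] x boundary_iff[OF d pq(2)] pq(4) by auto
    then have "parallel (P y - P x) (1, 1) \<or> parallel (P y - P x) (1, - 1)"
      using pq(6,7) by (simp add: normal_slope_def)
    then show "slant 1 (P x) = slant 1 (P y) \<or> slant (- 1) (P x) = slant (- 1) (P y)"
      using parallel_slant by blast
  qed
  obtain s where "s = 1 \<or> s = - 1" "oriented s \<bottom>\<^bsub>L\<^esub>" using orientation_exists .
  then interpret oriented_placement L a b P s by unfold_locales
  show thesis using that coordinatized d .
qed

theorem theorem3p6:
  fixes L :: "('a, 'b) gorder_scheme"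
    and F :: "('v, 'a) drawing"
    and \<alpha> :: "'a rel"
  assumes "slim_rectangular L"
    and "C1_diagram L F"
    and "lattice_congruence L \<alpha>"
  shows "C1_diagram (quotient_lattice L \<alpha>) (quotient_diagram L F \<alpha>)"
proof -
  obtain a b f g s P where c: "coordinatized L a b f g s P" and d: "draws L F P"
    using C1_diagram_coordinates[OF assms(1,2)] .
  interpret coordinatized L a b f g s P by (rule c)
  interpret coord_congruence L a b f g s P \<alpha> by unfold_locales (rule assms(3))
  show ?thesis by (rule C1_quotient[OF d])
qed

end
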